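(* Let $F$ be a meromorphic Laplace pair $(\mu_l,\mu_r)$ on a vertical strip $\Omega_{a,b}$, $a<0<b$, with separatrix $\Re(s)=0$, whose poles form a countably infinite set $\{ip_n\}_{n\in\mathbb{N}}$ on the imaginary axis, where $(p_n)$ is a sequence of distinct real numbers with no finite accumulation point. Let $r_n$ be the order of the pole $ip_n$, let $P_n(s)=\sum_{k=1}^{r_n}\frac{a_{n,k}}{(s-ip_n)^k}$ be the principal part of $F$ at $s=ip_n$, and let $P(s)=\sum_{n=1}^{+\infty}P_n(s)$. Suppose that for every $\epsilon>0$ $$\sum_{n=1}^{+\infty}\sum_{k=1}^{r_n}\frac{|a_{n,k}|}{\epsilon^k}<+\infty .$$ If the holomorphic part of $F$, defined by $H(s)=F(s)-P(s)$, satisfies the Phragmén–Lindelöf condition on $\Omega_{a,b}$, then $$\mu_r(t)-\mu_l(t)=\sum_{n=1}^{+\infty}\operatorname{Res}\left((e^{st}-1)\frac{F(s)}{s},\ s=ip_n\right)\qquad(t\in\mathbb{R}),$$ where the series on the right converges uniformly on every compact subset of the real line.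
   Context: For $-\infty\le\alpha<\beta\le+\infty$ put $\Omega_{\alpha,\beta}=\{s\in\mathbb{C}:\alpha<\Re(s)<\beta\}$. Determining functions: a function $\mu:\mathbb{R}\to\mathbb{C}$ of bounded variation on every finite interval is normalized if $\mu(0)=0$ and $\mu(t)=\frac{\mu(t^+)+\mu(t^-)}{2}$ for all $t\in\mathbb{R}$. All determining functions are assumed normalized. The bilateral Laplace–Stieltjes transform is $\mathcal{L}(\mu)(s)=\int_{-\infty}^{+\infty}e^{-st}\,d\mu(t)$ (a convergent improper integral). Laplace pair with separatrix $\Re(s)=0$: a function $F$, holomorphic or meromorphic on $\Omega_{a,b}$ with $a<0<b$, is a Laplace pair $(\mu_l,\mu_r)$ on $\Omega_{a,b}$ if $F(s)=\mathcal{L}(\mu_l)(s)$ for all $s\in\Omega_{a,0}$ and $F(s)=\mathcal{L}(\mu_r)(s)$ for all $s\in\Omega_{0,b}$, the integrals converging there. Under the summability assumption in the claim the series $P(s)$ converges to a meromorphic function on $\mathbb{C}$ with poles exactly at the points $ip_n$ and principal parts $P_n$, so $H=F-P$ is holomorphic on $\Omega_{a,b}$ (after removing removable singularities). Phragmén–Lindelöf condition: a function $G$ meromorphic on $\Omega_{a,b}$ and continuous on the boundary satisfies it if there exist positive constants $A,B,Y$ and $0<K<\frac{\pi}{|b-a|}$ such that, for all $a<x<b$, $|G(x+iy)|\le A e^{Be^{K|y|}}$ whenever $|y|\ge Y$. $\operatorname{Res}(g(s),\,s=s_0)$ denotes the residue of $g$ at $s_0$. *)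

theory Defs
  imports "HOL-Complex_Analysis.Complex_Analysis"
begin

definition vstrip :: "ereal \<Rightarrow> ereal \<Rightarrow> complex set" where
  "vstrip \<alpha> \<beta> = {s. \<alpha> < ereal (Re s) \<and> ereal (Re s) < \<beta>}"

definition locally_bounded_variation :: "(real \<Rightarrow> complex) \<Rightarrow> bool" where
  "locally_bounded_variation \<mu> \<longleftrightarrow>
     (\<forall>a b. \<exists>V. \<forall>D. D division_of {a..b} \<longrightarrow> (\<Sum>K\<in>D. norm (\<mu> (Sup K) - \<mu> (Inf K))) \<le> V)"

definition normalized_determining :: "(real \<Rightarrow> complex) \<Rightarrow> bool" where
  "normalized_determining \<mu> \<longleftrightarrow>
     locally_bounded_variation \<mu> \<and> \<mu> 0 = 0 \<and>
     (\<forall>t. \<exists>l r. (\<mu> \<longlongrightarrow> l) (at_left t) \<and> (\<mu> \<longlongrightarrow> r) (at_right t) \<and> \<mu> t = (r + l) / 2)"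

text \<open>
  The classical Riemann--Stieltjes integral of \<open>f\<close> with respect to \<open>\<mu>\<close> over \<open>[a, b]\<close>:
  the limit of the tagged sums as the mesh of the subdivision tends to 0 (a uniform mesh,
  not a gauge).
\<close>

definition has_stieltjes_integral ::
    "(real \<Rightarrow> complex) \<Rightarrow> (real \<Rightarrow> complex) \<Rightarrow> real \<Rightarrow> real \<Rightarrow> complex \<Rightarrow> bool" where
  "has_stieltjes_integral f \<mu> a b I \<longleftrightarrow>
     (\<forall>e>0. \<exists>\<delta>>0. \<forall>D. D tagged_division_of {a..b} \<and> (\<forall>(x, K)\<in>D. Sup K - Inf K < \<delta>) \<longrightarrow>
        norm ((\<Sum>(x, K)\<in>D. f x * (\<mu> (Sup K) - \<mu> (Inf K))) - I) < e)"

text \<open>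
  The bilateral transform: the integral over \<open>[u, v]\<close> converges to \<open>L\<close> as
  \<open>u\<close> tends to minus infinity and \<open>v\<close> to plus infinity independently (so this is not
  a principal value).
\<close>

definition has_laplace_stieltjes :: "(real \<Rightarrow> complex) \<Rightarrow> complex \<Rightarrow> complex \<Rightarrow> bool" where
  "has_laplace_stieltjes \<mu> s L \<longleftrightarrow>
     (\<exists>J. (\<forall>u v. u \<le> v \<longrightarrow>
              has_stieltjes_integral (\<lambda>t. exp (- s * of_real t)) \<mu> u v (J u v)) \<and>
          ((\<lambda>(u, v). J u v) \<longlongrightarrow> L) (at_bot \<times>\<^sub>F at_top))"

definition meromorphic_laplace_pair ::
    "(complex \<Rightarrow> complex) \<Rightarrow> ereal \<Rightarrow> ereal \<Rightarrow> (real \<Rightarrow> complex) \<Rightarrow> (real \<Rightarrow> complex) \<Rightarrow> bool" where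
  "meromorphic_laplace_pair F a b \<mu>\<^sub>l \<mu>\<^sub>r \<longleftrightarrow>
     F meromorphic_on vstrip a b \<and>
     normalized_determining \<mu>\<^sub>l \<and> normalized_determining \<mu>\<^sub>r \<and>
     (\<forall>s\<in>vstrip a 0. has_laplace_stieltjes \<mu>\<^sub>l s (F s)) \<and>
     (\<forall>s\<in>vstrip 0 b. has_laplace_stieltjes \<mu>\<^sub>r s (F s))"

definition pole_order :: "(complex \<Rightarrow> complex) \<Rightarrow> complex \<Rightarrow> nat" where
  "pole_order F z = nat (- zorder F z)"

definition polar_coeff :: "(complex \<Rightarrow> complex) \<Rightarrow> complex \<Rightarrow> nat \<Rightarrow> complex" where
  "polar_coeff F z k = fls_nth (laurent_expansion F z) (- int k)"

definition principal_part :: "(complex \<Rightarrow> complex) \<Rightarrow> complex \<Rightarrow> complex \<Rightarrow> complex" where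
  "principal_part F z s = (\<Sum>k=1..pole_order F z. polar_coeff F z k / (s - z) ^ k)"

text \<open>
  The difference of \<open>F\<close> and the series of its principal parts at the points \<open>z n\<close>,
  with the removable singularities removed.
\<close>

definition holomorphic_part :: "(complex \<Rightarrow> complex) \<Rightarrow> (nat \<Rightarrow> complex) \<Rightarrow> complex \<Rightarrow> complex" where
  "holomorphic_part F z = remove_sings (\<lambda>s. F s - (\<Sum>n. principal_part F (z n) s))"

text \<open>
  Continuity on the boundary is expressed through the existence of the boundary limits from
  inside the strip, since the value of a total function outside the open strip is irrelevant.
  In \<^typ>\<open>ereal\<close> the bound \<open>\<pi> / \<bar>b - a\<bar>\<close> is 0 for a strip of infinite width, so that the
  condition can only hold for strips of finite width.
\<close>

definition phragmen_lindelof :: "ereal \<Rightarrow> ereal \<Rightarrow> (complex \<Rightarrow> complex) \<Rightarrow> bool" where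
  "phragmen_lindelof a b G \<longleftrightarrow>
     G meromorphic_on vstrip a b \<and>
     (\<forall>z\<in>frontier (vstrip a b). \<exists>c. (G \<longlongrightarrow> c) (at z within vstrip a b)) \<and>
     (\<exists>A B Y K :: real. A > 0 \<and> B > 0 \<and> Y > 0 \<and> K > 0 \<and> ereal K < ereal pi / \<bar>b - a\<bar> \<and>
        (\<forall>x y. a < ereal x \<and> ereal x < b \<and> \<bar>y\<bar> \<ge> Y \<longrightarrow>
           norm (G (Complex x y)) \<le> A * exp (B * exp (K * \<bar>y\<bar>))))"

end

theory Submission
  imports Defs "HOL-Probability.Probability" "HOL-Real_Asymp.Real_Asymp"
begin

text \<open>
  Write \<open>\<Phi>(s) = (e\<^sup>s\<^sup>t - 1) / s\<close>, an entire function, and \<open>E\<^sub>h(s) = exp (h\<^sup>2 s\<^sup>2 / 2)\<close>. Integration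
  by parts turns the transform of \<open>\<mu>\<close> on a line \<open>Re s = c\<close> into \<open>F(s) = s \<integral> e\<^sup>-\<^sup>s\<^sup>u (\<mu>(u) - m) du\<close>, an
  absolutely convergent integral, where \<open>m\<close> is the limit of \<open>\<mu>\<close> at the infinity on the side where
  \<open>e\<^sup>-\<^sup>s\<^sup>u\<close> grows. Hence \<open>\<integral> F \<Phi> E\<^sub>h\<close> along the line is a difference of Gaussian means of \<open>\<mu>\<close>, and it tends
  to \<open>2 \<pi> \<mu>(t)\<close> as \<open>h \<rightarrow> 0\<close>, because \<open>\<mu>\<close> is normalized.

  Take two lines \<open>Re s = \<plusminus> c\<close> with \<open>c\<close> small. On them \<open>F = H + P\<close>. The integrals of \<open>H \<Phi> E\<^sub>h\<close> along both
  lines coincide: the additional factor \<open>exp (- \<delta> cos (2 K s))\<close> beats the double exponential growth of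
  \<open>H\<close>, and is bounded by \<open>1\<close> on the lines, so one may shift the contour and let \<open>\<delta> \<rightarrow> 0\<close>. The integrals
  of \<open>P \<Phi>\<close> converge absolutely, term by term, and the two integrals of \<open>P\<^sub>n \<Phi>\<close> differ by
  \<open>2 \<pi>\<close> times the residue at \<open>i p\<^sub>n\<close>.
\<close>

section \<open>Integration by parts for Stieltjes integrals\<close>

text \<open>On a line the transform \<open>F\<close> may grow like a multiple of |s|, while \<Phi>
  only decays like 1/|s|, so \<open>F\<close> \<Phi> need not be integrable; the Gaussian factor
  makes the integral of \<open>F\<close> absolutely convergent. It cannot control \<open>H\<close>
  between the lines, where the growth may be doubly exponential, hence the second factor. That one
  can be removed again after the shift: on the two lines \<open>H\<close> \<Phi> E_h is a difference
  of the integrable functions that belong to \<open>F\<close> and \<open>P\<close>, so dominated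
  convergence applies. \<open>P\<close> \<Phi> needs neither factor. Each principal part decays like
  1/|s - i p_n|, which together with the 1/|s| of \<Phi> is integrable, with a bound that does not
  depend on the position of p_n. The same bound serves as majorant for the uniform convergence in t.
  The difference e^{st} - 1, in place of e^{st}, not only makes \<Phi> entire: the constant m
  contributes equally to the Gaussian means at t and at 0 and cancels.\<close>

lemma countable_discontinuities_regulated:
  fixes \<mu> :: "real \<Rightarrow> complex"
  assumes lim: "\<And>t. \<exists>l r. (\<mu> \<longlongrightarrow> l) (at_left t) \<and> (\<mu> \<longlongrightarrow> r) (at_right t)"
  shows "countable {t. \<not> isCont \<mu> t}"
proof -
  \<comment> \<open>\<open>D e\<close> collects the points at which the oscillation of
    \<open>\<mu>\<close> is at least \<open>e\<close>. Near a point with one-sided limits the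
    oscillation is small on either side, so \<open>D e\<close> has no accumulation point and is
    countable. The discontinuities are covered by the sets
    \<open>D (1 / real (Suc n))\<close>.\<close>
  define D where "D e = {t. \<forall>d>0. \<exists>x\<in>ball t d. \<exists>y\<in>ball t d. dist (\<mu> x) (\<mu> y) \<ge> e}" for e :: real
  have good: "y \<notin> D e" if o: "open I" "y \<in> I" and I: "\<And>x. x \<in> I \<Longrightarrow> dist (\<mu> x) l < e / 2" for I l y e
  proof -
    obtain d where d: "d > 0" "ball y d \<subseteq> I"
      by (rule openE[OF o])
    have "dist (\<mu> x) (\<mu> z) < e" if "x \<in> ball y d" "z \<in> ball y d" for x z
      using dist_triangle_half_l[OF I[of x] I[of z]] that d by blast
    with d(1) show ?thesis
      unfolding D_def mem_Collect_eq not_all not_imp bex_simps by (intro exI[of _ d]) (auto simp: not_le)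
  qed
  have "\<forall>\<^sub>F y in at t. y \<notin> D e" if "e > 0" for t e
  proof -
    obtain l r where l: "(\<mu> \<longlongrightarrow> l) (at_left t)" and r: "(\<mu> \<longlongrightarrow> r) (at_right t)"
      using lim by blast
    have "\<forall>\<^sub>F x in at_left t. dist (\<mu> x) l < e / 2"
      using tendstoD[OF l, of "e/2"] that by simp
    then obtain b where b: "b < t" "\<And>x. b < x \<Longrightarrow> x < t \<Longrightarrow> dist (\<mu> x) l < e / 2"
      unfolding eventually_at_left_field by auto
    have "\<forall>\<^sub>F x in at_right t. dist (\<mu> x) r < e / 2"
      using tendstoD[OF r, of "e/2"] that by simp
    then obtain c where c: "c > t" "\<And>x. t < x \<Longrightarrow> x < c \<Longrightarrow> dist (\<mu> x) r < e / 2"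
      unfolding eventually_at_right_field by auto
    have "y \<notin> D e" if "b < y" "y < c" "y \<noteq> t" for y
    proof (cases "y < t")
      case True
      then show ?thesis
        by (intro good[of "{b<..<t}" y l e]) (use b that in auto)
    next
      case False
      then show ?thesis
        by (intro good[of "{t<..<c}" y r e]) (use c that in auto)
    qed
    moreover have "\<forall>\<^sub>F y in at t. y \<in> {b<..<c} - {t}"
      using b c by (intro eventually_at_in_open) auto
    ultimately show ?thesis
      by (auto elim!: eventually_mono)
  qed
  then have "countable (D e)" if "e > 0" for e
    using sparse_imp_countable[of UNIV "D e"] that by (simp add: sparse_in_eventually_iff)
  then have "countable (\<Union>n. D (1 / real (Suc n)))"
    by simp
  moreover have "{t. \<not> isCont \<mu> t} \<subseteq> (\<Union>n. D (1 / real (Suc n)))"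
  proof
    fix t assume "t \<in> {t. \<not> isCont \<mu> t}"
    then obtain e where e: "e > 0" "\<And>d. d > 0 \<Longrightarrow> \<exists>x. dist x t < d \<and> dist (\<mu> x) (\<mu> t) \<ge> e"
      unfolding isCont_def LIM_def by (simp add: not_less) (meson not_less)
    obtain n where n: "1 / real (Suc n) < e"
      using e(1) reals_Archimedean by (metis inverse_eq_divide)
    have "t \<in> D (1 / real (Suc n))"
      unfolding D_def
    proof (safe)
      fix d :: real assume "d > 0"
      then obtain x where "dist x t < d" "dist (\<mu> x) (\<mu> t) \<ge> e"
        using e(2) by blast
      with n \<open>d > 0\<close> show "\<exists>x\<in>ball t d. \<exists>y\<in>ball t d. 1 / real (Suc n) \<le> dist (\<mu> x) (\<mu> y)"
        by (intro bexI[of _ x] bexI[of _ t]) (auto simp: dist_commute)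
    qed
    then show "t \<in> (\<Union>n. D (1 / real (Suc n)))"
      by blast
  qed
  ultimately show ?thesis
    using countable_subset by blast
qed

lemma normalized_determining_countable:
  "normalized_determining \<mu> \<Longrightarrow> countable {t. \<not> isCont \<mu> t}"
  by (rule countable_discontinuities_regulated) (auto simp: normalized_determining_def)

lemma normalized_determining_borel:
  assumes "normalized_determining \<mu>"
  shows "\<mu> \<in> borel_measurable borel"
proof (rule borel_measurable_continuous_countable_exceptions)
  show "countable {t. \<not> isCont \<mu> t}"
    by (rule normalized_determining_countable) fact
  show "continuous_on (- {t. \<not> isCont \<mu> t}) \<mu>"
    by (rule continuous_at_imp_continuous_on) auto
qed

text \<open>A bound V for the variation over the whole interval bounds |\<mu> x - \<mu> a| for every
  x, through the division of [a, b] at x.\<close>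

lemma normalized_determining_bounded:
  assumes "normalized_determining \<mu>"
  obtains B where "B \<ge> 0" "\<And>x. x \<in> {a..b} \<Longrightarrow> norm (\<mu> x) \<le> B"
proof -
  obtain V where V: "\<And>D. D division_of {a..b} \<Longrightarrow> (\<Sum>K\<in>D. norm (\<mu> (Sup K) - \<mu> (Inf K))) \<le> V"
    using assms unfolding normalized_determining_def locally_bounded_variation_def by blast
  have "norm (\<mu> x) \<le> V + norm (\<mu> a)" if x: "x \<in> {a..b}" for x
  proof -
    have ab: "a \<le> b" using x by simp
    have sub: "{{a..x}, {x..b}} division_of {a..b}" if "a < x" "x < b"
      using that by (auto simp: division_of_def)
    have "{{a..b}} division_of {a..b}"
      using ab by (auto simp: division_of_def)
    note V[OF this]
    then have ba: "norm (\<mu> b - \<mu> a) \<le> V"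
      using ab by simp
    show ?thesis
    proof (cases "x = a \<or> x = b")
      case True
      then show ?thesis
        using ba norm_ge_zero[of "\<mu> b - \<mu> a"] norm_triangle_ineq[of "\<mu> b - \<mu> a" "\<mu> a"] 
        by (auto simp del: norm_ge_zero)
    next
      case False
      then have ax: "a < x" "x < b"
        using x by auto
      \<comment> \<open>Two different cells, so that the sum over the division really has two
        terms.\<close>
      then have "{a..x} \<noteq> {x..b}"
        by (auto simp: Icc_eq_Icc)
      then have "norm (\<mu> x - \<mu> a) + norm (\<mu> b - \<mu> x) \<le> V"
        using V[OF sub[OF ax]] ax by simp
      then show ?thesis
        using norm_triangle_ineq[of "\<mu> x - \<mu> a" "\<mu> a"] norm_ge_zero[of "\<mu> b - \<mu> x"]
        unfolding diff_add_cancel by linarith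
    qed
  qed
  then show ?thesis
    by (intro that[of "max 0 (V + norm (\<mu> a))"]) (auto simp: le_max_iff_disj)
qed

section \<open>Uniform grids and Abel summation\<close>

lemma tagged_division_of_grid:
  fixes t :: "nat \<Rightarrow> real"
  assumes t: "strict_mono t" and N: "N > 0"
  shows "(\<lambda>k. (t k, {t k..t (Suc k)})) ` {..<N} tagged_division_of {t 0..t N}"
proof -
  have le: "t k \<le> t l" if "k \<le> l" for k l
    using t that by (simp add: strict_mono_less_eq)
  have U: "(\<Union>k<N. {t k..t (Suc k)}) = {t 0..t N}"
    using N
  proof (induction N rule: nat_induct_non_zero)
    case (Suc n)
    then show ?case
      using le[of 0 n] le[of n "Suc n"] by (simp add: lessThan_Suc) (auto)
  qed (auto simp: lessThan_Suc)
  have disj: "interior {t k..t (Suc k)} \<inter> interior {t l..t (Suc l)} = {}" if "k \<noteq> l" for k l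
  proof -
    have "{t k<..<t (Suc k)} \<inter> {t l<..<t (Suc l)} = {}"
      using le[of "Suc k" l] le[of "Suc l" k] that by (cases "k < l") auto
    then show ?thesis
      by simp
  qed
  have sub: "{t k..t (Suc k)} \<subseteq> {t 0..t N}" if "k < N" for k
    using le[of 0 k] le[of "Suc k" N] that by auto
  have "(\<lambda>k. (t k, {t k..t (Suc k)})) ` {..<N} tagged_partial_division_of {t 0..t N}"
    unfolding tagged_partial_division_of_def
  proof (intro conjI allI impI)
    fix x K assume "(x, K) \<in> (\<lambda>k. (t k, {t k..t (Suc k)})) ` {..<N}"
    then obtain k where k: "k < N" "x = t k" "K = {t k..t (Suc k)}" by auto
    then show "x \<in> K" "K \<subseteq> {t 0..t N}" "\<exists>a b. K = cbox a b"
      using le[of k "Suc k"] sub[of k] by auto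
  next
    fix x K y L
    assume *: "(x, K) \<in> (\<lambda>k. (t k, {t k..t (Suc k)})) ` {..<N} \<and>
      (y, L) \<in> (\<lambda>k. (t k, {t k..t (Suc k)})) ` {..<N} \<and> (x, K) \<noteq> (y, L)"
    from * obtain k where k: "(x, K) = (t k, {t k..t (Suc k)})" by (elim conjE imageE)
    from * obtain l where l: "(y, L) = (t l, {t l..t (Suc l)})" by (elim conjE imageE)
    have "k \<noteq> l" using * k l by metis
    with k l show "interior K \<inter> interior L = {}"
      using disj by simp
  qed simp
  moreover have "\<Union>{K. \<exists>x. (x, K) \<in> (\<lambda>k. (t k, {t k..t (Suc k)})) ` {..<N}} = (\<Union>k<N. {t k..t (Suc k)})"
    by auto
  ultimately show ?thesis
    by (simp add: tagged_division_of_def U)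
qed

text \<open>Abel summation. With \<open>f\<close> taken at left ends, the remaining sum takes
  \<open>g\<close> at right ends; this is why the step functions below are constant on cells that
  are open on the left and closed on the right.\<close>

lemma sum_by_parts_grid:
  fixes f g :: "nat \<Rightarrow> 'a :: comm_ring"
  shows "(\<Sum>k<N. f k * (g (Suc k) - g k)) = f N * g N - f 0 * g 0 - (\<Sum>k<N. g (Suc k) * (f (Suc k) - f k))"
  by (induction N) (simp_all add: algebra_simps)

text \<open>The remaining sum of Abel summation as an exact integral: \<open>m\<close> is constant
  on each cell apart from its left end, a null set, and \<open>f'\<close> integrates there to the
  increment of \<open>f\<close>.\<close>

lemma has_integral_step_grid:
  fixes m f' :: "real \<Rightarrow> complex" and f :: "real \<Rightarrow> complex"
  assumes t: "strict_mono t" and N: "N > (0::nat)"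
    and f: "\<And>x. (f has_vector_derivative f' x) (at x)"
    and m: "\<And>k x. k < N \<Longrightarrow> t k < x \<Longrightarrow> x \<le> t (Suc k) \<Longrightarrow> m x = m (t (Suc k))"
  shows "((\<lambda>x. m x * f' x) has_integral (\<Sum>k<N. m (t (Suc k)) * (f (t (Suc k)) - f (t k)))) {t 0..t N}"
  using N m
proof (induction N rule: nat_induct_non_zero)
  case 1
  have eqn: "m x * f' x = m (t 1) * f' x" if "t 0 \<le> x" "x \<le> t 1" "x \<noteq> t 0" for x
    using 1[of 0 x] that by force
  have le: "t 0 \<le> t 1" using t by (simp add: strict_mono_less_eq)
  have "((\<lambda>x. m (t 1) * f' x) has_integral m (t 1) * (f (t 1) - f (t 0))) {t 0..t 1}"
    by (rule has_integral_mult_right[OF fundamental_theorem_of_calculus])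
       (use le in \<open>auto intro: has_vector_derivative_at_within f\<close>)
  then have "((\<lambda>x. m x * f' x) has_integral m (t 1) * (f (t 1) - f (t 0))) {t 0..t 1}"
    by (rule has_integral_spike_finite[of "{t 0}", rotated 2]) (use eqn in auto)
  then show ?case by simp
next
  case (Suc n)
  have eqn: "m x * f' x = m (t (Suc n)) * f' x" if "t n \<le> x" "x \<le> t (Suc n)" "x \<noteq> t n" for x
    using Suc.prems[of n x] that by force
  have le: "t 0 \<le> t n" "t n \<le> t (Suc n)" using t by (simp_all add: strict_mono_less_eq)
  have "((\<lambda>x. m (t (Suc n)) * f' x) has_integral m (t (Suc n)) * (f (t (Suc n)) - f (t n))) {t n..t (Suc n)}"
    by (rule has_integral_mult_right[OF fundamental_theorem_of_calculus])
       (use le in \<open>auto intro: has_vector_derivative_at_within f\<close>)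
  then have "((\<lambda>x. m x * f' x) has_integral m (t (Suc n)) * (f (t (Suc n)) - f (t n))) {t n..t (Suc n)}"
    by (rule has_integral_spike_finite[of "{t n}", rotated 2]) (use eqn in auto)
  from has_integral_combine[OF le Suc.IH this] Suc.prems show ?case
    by simp
qed

text \<open>The ceiling expression is the least point of the grid u + h Z that is not below x: it
  rounds x up to the right end of its cell.\<close>

lemma ceiling_grid_bounds:
  fixes u h x :: real
  assumes "h > 0"
  shows "x \<le> u + h * of_int \<lceil>(x - u) / h\<rceil>" "u + h * of_int \<lceil>(x - u) / h\<rceil> \<le> x + h"
proof -
  have "(x - u) / h \<le> of_int \<lceil>(x - u) / h\<rceil>" "of_int \<lceil>(x - u) / h\<rceil> \<le> (x - u) / h + 1"
    by linarith+
  then have "h * ((x - u) / h) \<le> h * of_int \<lceil>(x - u) / h\<rceil>" "h * of_int \<lceil>(x - u) / h\<rceil> \<le> h * ((x - u) / h + 1)"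
    using assms by (intro mult_left_mono; simp)+
  moreover have "h * ((x - u) / h) = x - u"
    using assms by simp
  ultimately show "x \<le> u + h * of_int \<lceil>(x - u) / h\<rceil>" "u + h * of_int \<lceil>(x - u) / h\<rceil> \<le> x + h"
    by (simp_all only: distrib_left mult_1_right)
qed

lemma tendsto_ceiling_grid:
  fixes u v x :: real
  assumes "u < v"
  shows "(\<lambda>N. u + (v - u) / real (Suc N) * of_int \<lceil>(x - u) / ((v - u) / real (Suc N))\<rceil>) \<longlonglongrightarrow> x"
proof -
  have "(\<lambda>N. x + (v - u) / real (Suc N)) \<longlonglongrightarrow> x + 0"
    by (intro tendsto_intros LIMSEQ_Suc[OF lim_const_over_n])
  then have lim: "(\<lambda>N. x + (v - u) / real (Suc N)) \<longlonglongrightarrow> x"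
    by (simp only: add_0_right)
  have h: "(v - u) / real (Suc N) > 0" for N
    using assms by simp
  show ?thesis
    by (rule tendsto_sandwich[OF _ _ tendsto_const[of x] lim]) (intro always_eventually allI ceiling_grid_bounds h)+
qed

text \<open>The existence of \<open>J\<close> is given, so one sequence of divisions determines it:
  uniform grids with left tags. Abel summation turns their sums into integrals of
  \<open>\<mu> (c N x) * f' x\<close>, where \<open>c N\<close> rounds up to the grid. These
  converge by dominated convergence, since \<open>c N x\<close> tends to x and \<open>\<mu>\<close>
  is continuous outside a countable set.\<close>

lemma stieltjes_integral_by_parts:
  fixes f f' :: "real \<Rightarrow> complex"
  assumes \<mu>: "normalized_determining \<mu>" and uv: "u < v"
    and J: "has_stieltjes_integral f \<mu> u v J"
    and f: "\<And>x. (f has_vector_derivative f' x) (at x)" and f': "continuous_on UNIV f'"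
  shows "J = f v * \<mu> v - f u * \<mu> u - (LINT x:{u..v}|lborel. \<mu> x * f' x)"
proof -
  note [measurable] = normalized_determining_borel[OF \<mu>] borel_measurable_continuous_onI[OF f']
  \<comment> \<open>\<open>c N x\<close> is only estimated by x + (v - u), hence the bound on an
    interval of twice the length.\<close>
  obtain B where B: "B \<ge> 0" "\<And>x. x \<in> {u..v + (v - u)} \<Longrightarrow> norm (\<mu> x) \<le> B"
    using normalized_determining_bounded[OF \<mu>] by blast
  have "bounded (f' ` {u..v})"
    by (intro compact_imp_bounded compact_continuous_image continuous_on_subset[OF f']) auto
  then obtain B' where B': "\<And>x. x \<in> {u..v} \<Longrightarrow> norm (f' x) \<le> B'"
    unfolding bounded_iff by blast
  define h where "h N = (v - u) / real (Suc N)" for N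
  define t where "t N k = u + h N * real k" for N k
  define c where "c N x = u + h N * of_int \<lceil>(x - u) / h N\<rceil>" for N x
  have h: "h N > 0" for N using uv by (simp add: h_def)
  have t: "strict_mono (t N)" for N
    using h[of N] by (intro strict_monoI) (simp add: t_def)
  have t0: "t N 0 = u" and tN: "t N (Suc N) = v" for N
    by (simp_all add: t_def h_def)
  have ct: "c N x = t N (Suc k)" if "t N k < x" "x \<le> t N (Suc k)" for N k x
  proof -
    have "real k < (x - u) / h N" "(x - u) / h N \<le> real k + 1"
      using that h[of N] by (auto simp: t_def field_simps)
    then have "\<lceil>(x - u) / h N\<rceil> = int k + 1"
      by (intro ceiling_unique) auto
    then show ?thesis
      by (simp add: c_def t_def)
  qed
  have cb: "x \<le> c N x \<and> c N x \<le> x + (v - u)" for N x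
  proof -
    have "h N \<le> v - u"
      using uv by (simp add: h_def divide_le_eq mult_le_cancel_left1)
    then show ?thesis
      using ceiling_grid_bounds[OF h[of N], where x=x and u=u] by (simp add: c_def)
  qed
  have clim: "(\<lambda>N. c N x) \<longlonglongrightarrow> x" for x
    using tendsto_ceiling_grid[OF uv] by (simp add: c_def h_def)
  have cmeas [measurable]: "c N \<in> borel_measurable borel" for N
    unfolding c_def by measurable
  have DCT: "(\<lambda>N. LINT x|lborel. indicator {u..v} x *\<^sub>R (\<mu> (c N x) * f' x)) \<longlonglongrightarrow>
      (LINT x|lborel. indicator {u..v} x *\<^sub>R (\<mu> x * f' x))"
   and int: "\<And>N. integrable lborel (\<lambda>x. indicator {u..v} x *\<^sub>R (\<mu> (c N x) * f' x))"
  proof -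
    have 1: "(\<lambda>x. indicator {u..v} x *\<^sub>R (\<mu> x * f' x)) \<in> borel_measurable lborel"
      "(\<lambda>x. indicator {u..v} x *\<^sub>R (\<mu> (c N x) * f' x)) \<in> borel_measurable lborel" for N
      by measurable
    have 2: "integrable lborel (\<lambda>x. indicator {u..v} x *\<^sub>R (B * B'))"
      by (intro integrable_scaleR_left integrable_real_indicator) (auto simp: emeasure_lborel_Icc_eq)
    have 3: "AE x in lborel. (\<lambda>N. indicator {u..v} x *\<^sub>R (\<mu> (c N x) * f' x)) \<longlonglongrightarrow> indicator {u..v} x *\<^sub>R (\<mu> x * f' x)"
    proof (rule AE_I')
      show "{t. \<not> isCont \<mu> t} \<in> null_sets lborel"
        by (intro countable_imp_null_set_lborel normalized_determining_countable \<mu>)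
      show "{x \<in> space lborel. \<not> (\<lambda>N. indicator {u..v} x *\<^sub>R (\<mu> (c N x) * f' x)) \<longlonglongrightarrow> indicator {u..v} x *\<^sub>R (\<mu> x * f' x)}
        \<subseteq> {t. \<not> isCont \<mu> t}"
        using isCont_tendsto_compose[OF _ clim] by (auto intro!: tendsto_intros)
    qed
    have 4: "AE x in lborel. norm (indicator {u..v} x *\<^sub>R (\<mu> (c N x) * f' x)) \<le> indicator {u..v} x *\<^sub>R (B * B')" for N
    proof (rule AE_I2)
      fix x
      show "norm (indicator {u..v} x *\<^sub>R (\<mu> (c N x) * f' x)) \<le> indicator {u..v} x *\<^sub>R (B * B')"
        using B(2)[of "c N x"] B'[of x] cb[of x N] B(1)
        by (auto simp: indicator_def norm_mult intro!: mult_mono)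
    qed
    show "(\<lambda>N. LINT x|lborel. indicator {u..v} x *\<^sub>R (\<mu> (c N x) * f' x)) \<longlonglongrightarrow>
      (LINT x|lborel. indicator {u..v} x *\<^sub>R (\<mu> x * f' x))"
      by (rule integral_dominated_convergence[OF 1(1) 1(2) 2 3 4])
    show "integrable lborel (\<lambda>x. indicator {u..v} x *\<^sub>R (\<mu> (c N x) * f' x))" for N
      by (rule integrable_dominated_convergence2[OF 1(1) 1(2) 2 3 4])
  qed
  have S: "(\<Sum>k<Suc N. f (t N k) * (\<mu> (t N (Suc k)) - \<mu> (t N k))) =
      f v * \<mu> v - f u * \<mu> u - (LINT x|lborel. indicator {u..v} x *\<^sub>R (\<mu> (c N x) * f' x))" for N
  proof -
    have cc: "c N (t N (Suc k)) = t N (Suc k)" for k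
      by (rule ct) (use t[of N] in \<open>auto simp: strict_mono_less\<close>)
    have "((\<lambda>x. \<mu> (c N x) * f' x) has_integral
       (\<Sum>k<Suc N. \<mu> (c N (t N (Suc k))) * (f (t N (Suc k)) - f (t N k)))) {t N 0..t N (Suc N)}"
    proof (rule has_integral_step_grid[OF t _ f])
      show "\<mu> (c N x) = \<mu> (c N (t N (Suc k)))" if "t N k < x" "x \<le> t N (Suc k)" for k x
        using ct[OF that] cc by simp
    qed simp
    then have "((\<lambda>x. \<mu> (c N x) * f' x) has_integral
       (\<Sum>k<Suc N. \<mu> (t N (Suc k)) * (f (t N (Suc k)) - f (t N k)))) {u..v}"
      unfolding cc t0 tN .
    moreover have "((\<lambda>x. \<mu> (c N x) * f' x) has_integral (LINT x:{u..v}|lborel. \<mu> (c N x) * f' x)) {u..v}"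
      using set_borel_integral_eq_integral[of "{u..v}" "\<lambda>x. \<mu> (c N x) * f' x"] int[of N]
      by (simp add: set_integrable_def has_integral_iff)
    ultimately have "(\<Sum>k<Suc N. \<mu> (t N (Suc k)) * (f (t N (Suc k)) - f (t N k))) = (LINT x:{u..v}|lborel. \<mu> (c N x) * f' x)"
      by (rule has_integral_unique)
    then show ?thesis
      using sum_by_parts_grid[of "\<lambda>k. f (t N k)" "\<lambda>k. \<mu> (t N k)" "Suc N"]
      unfolding t0 tN set_lebesgue_integral_def by simp
  qed
  have "(\<lambda>N. \<Sum>k<Suc N. f (t N k) * (\<mu> (t N (Suc k)) - \<mu> (t N k))) \<longlonglongrightarrow> J"
  proof (rule LIMSEQ_I)
    fix e :: real assume "e > 0"
    then obtain d where d: "d > 0" and *: "\<And>D. D tagged_division_of {u..v} \<Longrightarrow> \<forall>(x, K)\<in>D. Sup K - Inf K < d \<Longrightarrow>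
        norm ((\<Sum>(x, K)\<in>D. f x * (\<mu> (Sup K) - \<mu> (Inf K))) - J) < e"
      using J[unfolded has_stieltjes_integral_def, rule_format, OF \<open>e > 0\<close>] by blast
    have "h \<longlonglongrightarrow> 0"
      unfolding h_def by (intro LIMSEQ_Suc[OF lim_const_over_n])
    then obtain N0 where N0: "\<And>N. N \<ge> N0 \<Longrightarrow> h N < d"
      using order_tendstoD(2)[OF \<open>h \<longlonglongrightarrow> 0\<close> d] unfolding eventually_sequentially by blast
    have "norm ((\<Sum>k<Suc N. f (t N k) * (\<mu> (t N (Suc k)) - \<mu> (t N k))) - J) < e" if "N \<ge> N0" for N
    proof -
      let ?D = "(\<lambda>k. (t N k, {t N k..t N (Suc k)})) ` {..<Suc N}"
      have le: "t N k \<le> t N (Suc k)" for k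
        using h[of N] by (simp add: t_def)
      have 1: "?D tagged_division_of {u..v}"
        using tagged_division_of_grid[OF t, of "Suc N" N] unfolding t0 tN by simp
      have 2: "\<forall>(x, K)\<in>?D. Sup K - Inf K < d"
        using N0[OF that] le by (auto simp: t_def algebra_simps)
      have inj: "inj_on (\<lambda>k. (t N k, {t N k..t N (Suc k)})) {..<Suc N}"
        using strict_mono_eq[OF t[of N]] by (auto intro!: inj_onI)
      have "(\<Sum>(x, K)\<in>?D. f x * (\<mu> (Sup K) - \<mu> (Inf K))) = (\<Sum>k<Suc N. f (t N k) * (\<mu> (t N (Suc k)) - \<mu> (t N k)))"
        using le by (subst sum.reindex[OF inj]) (simp)
      with *[OF 1 2] show ?thesis by simp
    qed
    then show "\<exists>no. \<forall>N\<ge>no. norm ((\<Sum>k<Suc N. f (t N k) * (\<mu> (t N (Suc k)) - \<mu> (t N k))) - J) < e"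
      by blast
  qed
  moreover have "(\<lambda>N. \<Sum>k<Suc N. f (t N k) * (\<mu> (t N (Suc k)) - \<mu> (t N k))) \<longlonglongrightarrow>
     f v * \<mu> v - f u * \<mu> u - (LINT x|lborel. indicator {u..v} x *\<^sub>R (\<mu> x * f' x))"
    unfolding S by (intro tendsto_intros DCT)
  ultimately show ?thesis
    unfolding set_lebesgue_integral_def by (rule LIMSEQ_unique)
qed

section \<open>Growth of determining functions\<close>

lemma set_integrable_bounded_Icc:
  fixes f :: "real \<Rightarrow> 'a :: {banach, second_countable_topology}"
  assumes [measurable]: "f \<in> borel_measurable borel" and B: "\<And>x. x \<in> {a..b} \<Longrightarrow> norm (f x) \<le> B"
  shows "set_integrable lborel {a..b} f"
  unfolding set_integrable_def
proof (rule Bochner_Integration.integrable_bound[of _ "\<lambda>x. indicator {a..b} x *\<^sub>R B"])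
  show "integrable lborel (\<lambda>x. indicator {a..b} x *\<^sub>R B)"
    by (intro integrable_scaleR_left integrable_real_indicator) (auto simp: emeasure_lborel_Icc_eq)
  show "AE x in lborel. norm (indicator {a..b} x *\<^sub>R f x) \<le> norm (indicator {a..b} x *\<^sub>R B)"
    using B by (intro AE_I2) (force simp: indicator_def)
qed measurable

text \<open>Both sides are the integral of \<open>f x * g y\<close> over the triangle a <= y <= x <=
  b, which the two bounds make absolutely convergent.\<close>

lemma Fubini_triangle:
  fixes f g :: "real \<Rightarrow> complex"
  assumes [measurable]: "f \<in> borel_measurable borel" "g \<in> borel_measurable borel"
    and F: "\<And>x. x \<in> {a..b} \<Longrightarrow> norm (f x) \<le> F" and G: "\<And>x. x \<in> {a..b} \<Longrightarrow> norm (g x) \<le> G"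
  shows "(LINT x:{a..b}|lborel. f x * (LINT y:{a..x}|lborel. g y)) =
         (LINT y:{a..b}|lborel. g y * (LINT x:{y..b}|lborel. f x))"
proof -
  define k where "k x y = (if a \<le> y \<and> y \<le> x \<and> x \<le> b then f x * g y else 0)" for x y
  have [measurable]: "case_prod k \<in> borel_measurable (lborel \<Otimes>\<^sub>M lborel)"
    unfolding k_def by measurable
  have "integrable (lborel \<Otimes>\<^sub>M lborel) (case_prod k)"
  proof (rule Bochner_Integration.integrable_bound[of _ "\<lambda>z. indicator (cbox (a, a) (b, b)) z *\<^sub>R (F * G)"])
    show "integrable (lborel \<Otimes>\<^sub>M lborel) (\<lambda>z. indicator (cbox (a, a) (b, b)) z *\<^sub>R (F * G))"
      unfolding lborel_prod
      by (intro integrable_scaleR_left integrable_real_indicator) (auto simp: emeasure_lborel_cbox_eq)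
    have "norm (k x y) \<le> norm (indicator (cbox (a, a) (b, b)) (x, y) *\<^sub>R (F * G))" for x y
    proof (cases "a \<le> y \<and> y \<le> x \<and> x \<le> b")
      case True
      then have "norm (f x) * norm (g y) \<le> F * G"
        using F[of x] G[of y] by (intro mult_mono order_trans[OF norm_ge_zero F]) auto
      then show ?thesis
        using True by (simp add: k_def norm_mult indicator_def cbox_Pair_eq)
    qed (auto simp: k_def)
    then show "AE z in lborel \<Otimes>\<^sub>M lborel. norm (case_prod k z) \<le> norm (indicator (cbox (a, a) (b, b)) z *\<^sub>R (F * G))"
      by (intro AE_I2) auto
  qed measurable
  from lborel_pair.Fubini_integral[OF this]
  have "(LINT x|lborel. LINT y|lborel. k x y) = (LINT y|lborel. LINT x|lborel. k x y)"
    by simp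
  moreover have "(LINT y|lborel. k x y) = indicator {a..b} x *\<^sub>R (f x * (LINT y:{a..x}|lborel. g y))" for x
  proof -
    have "(LINT y|lborel. k x y) = (LINT y|lborel. (if x \<le> b then f x else 0) * (indicator {a..x} y *\<^sub>R g y))"
      by (intro Bochner_Integration.integral_cong) (auto simp: k_def indicator_def)
    also have "\<dots> = (if x \<le> b then f x else 0) * (LINT y:{a..x}|lborel. g y)"
      unfolding set_lebesgue_integral_def by (rule integral_mult_right_zero)
    also have "\<dots> = indicator {a..b} x *\<^sub>R (f x * (LINT y:{a..x}|lborel. g y))"
      by (cases "a \<le> x"; cases "x \<le> b") (simp_all add: indicator_simps set_lebesgue_integral_def)
    finally show ?thesis .
  qed
  moreover have "(LINT x|lborel. k x y) = indicator {a..b} y *\<^sub>R (g y * (LINT x:{y..b}|lborel. f x))" for y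
  proof -
    have "(LINT x|lborel. k x y) = (LINT x|lborel. (if a \<le> y then g y else 0) * (indicator {y..b} x *\<^sub>R f x))"
      by (intro Bochner_Integration.integral_cong) (auto simp: k_def indicator_def)
    also have "\<dots> = (if a \<le> y then g y else 0) * (LINT x:{y..b}|lborel. f x)"
      unfolding set_lebesgue_integral_def by (rule integral_mult_right_zero)
    also have "\<dots> = indicator {a..b} y *\<^sub>R (g y * (LINT x:{y..b}|lborel. f x))"
      by (cases "a \<le> y"; cases "y \<le> b") (simp_all add: indicator_simps set_lebesgue_integral_def)
    finally show ?thesis .
  qed
  ultimately show ?thesis
    by (simp add: set_lebesgue_integral_def)
qed

lemma borel_measurable_indefinite_integral [measurable]:
  fixes g :: "real \<Rightarrow> complex"
  assumes [measurable]: "g \<in> borel_measurable borel"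
  shows "(\<lambda>x. LINT y:{a..x}|lborel. g y) \<in> borel_measurable borel"
    "(\<lambda>x. LINT y:{x..b}|lborel. g y) \<in> borel_measurable borel"
proof -
  have "(\<lambda>x. LINT y|lborel. (if a \<le> y \<and> y \<le> x then g y else 0)) \<in> borel_measurable borel"
    by measurable
  then show "(\<lambda>x. LINT y:{a..x}|lborel. g y) \<in> borel_measurable borel"
    unfolding set_lebesgue_integral_def
    by (rule back_subst[of "\<lambda>f. f \<in> borel_measurable borel"]) (auto intro!: ext Bochner_Integration.integral_cong simp: indicator_def)
  have "(\<lambda>x. LINT y|lborel. (if x \<le> y \<and> y \<le> b then g y else 0)) \<in> borel_measurable borel"
    by measurable
  then show "(\<lambda>x. LINT y:{x..b}|lborel. g y) \<in> borel_measurable borel"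
    unfolding set_lebesgue_integral_def
    by (rule back_subst[of "\<lambda>f. f \<in> borel_measurable borel"]) (auto intro!: ext Bochner_Integration.integral_cong simp: indicator_def)
qed

lemma norm_set_integral_Icc_le:
  fixes g :: "real \<Rightarrow> complex"
  assumes [measurable]: "g \<in> borel_measurable borel" and G: "\<And>x. x \<in> {a..b} \<Longrightarrow> norm (g x) \<le> h x"
    and h: "set_integrable lborel {a..b} h"
  shows "norm (LINT x:{a..b}|lborel. g x) \<le> (LINT x:{a..b}|lborel. h x)"
proof -
  have hh: "h x \<ge> 0" if "x \<in> {a..b}" for x
    using G[OF that] norm_ge_zero[of "g x"] by linarith
  have gi: "set_integrable lborel {a..b} g"
    using h G hh by (rule_tac set_integrable_bound[OF h]) (auto simp: set_borel_measurable_def intro!: AE_I2)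
  have "norm (LINT x:{a..b}|lborel. g x) \<le> (LINT x:{a..b}|lborel. norm (g x))"
    by (rule set_integral_norm_bound[OF gi])
  also have "\<dots> \<le> (LINT x:{a..b}|lborel. h x)"
    by (rule set_integral_mono[OF set_integrable_norm[OF gi] h]) (use G in auto)
  finally show ?thesis .
qed

lemma set_integral_exp_Icc:
  fixes \<sigma> :: real
  assumes "y \<le> b"
  shows "(LINT x:{y..b}|lborel. \<sigma> * exp (\<sigma> * x)) = exp (\<sigma> * b) - exp (\<sigma> * y)"
    "(LINT x:{y..b}|lborel. complex_of_real (\<sigma> * exp (\<sigma> * x))) = of_real (exp (\<sigma> * b) - exp (\<sigma> * y))"
proof -
  show *: "(LINT x:{y..b}|lborel. \<sigma> * exp (\<sigma> * x)) = exp (\<sigma> * b) - exp (\<sigma> * y)"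
    unfolding set_lebesgue_integral_def
    by (rule integral_FTC_atLeastAtMost[OF assms])
       (auto intro!: derivative_eq_intros continuous_intros simp: has_real_derivative_iff_has_vector_derivative[symmetric])
  show "(LINT x:{y..b}|lborel. complex_of_real (\<sigma> * exp (\<sigma> * x))) = of_real (exp (\<sigma> * b) - exp (\<sigma> * y))"
    unfolding set_integral_complex_of_real * ..
qed

text \<open>
  With \<open>A\<close> the bounded expression and \<open>M\<close> the integral in it, \<open>(e\<^sup>\<sigma>\<^sup>x M)' = e\<^sup>\<sigma>\<^sup>x A\<close> off the discontinuities
  of \<open>\<mu>\<close>, so \<open>M\<close> is bounded too. Fubini's theorem replaces the differentiation.
\<close>

lemma transform_growth_right:
  fixes \<mu> :: "real \<Rightarrow> complex" and \<sigma> r C :: real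
  assumes [measurable]: "\<mu> \<in> borel_measurable borel" and bd: "\<And>a b. \<exists>B. \<forall>x\<in>{a..b}. norm (\<mu> x) \<le> B"
    and \<sigma>: "\<sigma> > 0"
    and C: "\<And>v. v \<ge> r \<Longrightarrow> norm (of_real (exp (-\<sigma> * v)) * \<mu> v +
        of_real \<sigma> * (LINT x:{r..v}|lborel. of_real (exp (-\<sigma> * x)) * \<mu> x)) \<le> C"
    and v: "v \<ge> r"
  shows "norm (\<mu> v) \<le> 2 * C * exp (\<sigma> * v)"
proof -
  define E where "E x = complex_of_real (exp (\<sigma> * x))" for x
  define g where "g x = complex_of_real (exp (-\<sigma> * x)) * \<mu> x" for x
  define M where "M x = (LINT y:{r..x}|lborel. g y)" for x
  define A where "A x = g x + of_real \<sigma> * M x" for x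
  have Eg: "E x * g x = \<mu> x" for x
    by (simp add: E_def g_def exp_minus flip: of_real_mult)
  have [measurable]: "E \<in> borel_measurable borel" "g \<in> borel_measurable borel" "M \<in> borel_measurable borel"
     "A \<in> borel_measurable borel"
    unfolding A_def E_def g_def M_def by measurable
  have C0: "C \<ge> 0"
    using C[of r] norm_ge_zero order_trans by blast
  have AC: "norm (A x) \<le> C" if "x \<ge> r" for x
    using C[OF that] by (simp add: A_def g_def M_def)
  obtain B where B: "\<And>x. x \<in> {r..v} \<Longrightarrow> norm (\<mu> x) \<le> B"
    using bd[of r v] by blast
  have gB: "norm (g x) \<le> exp (- \<sigma> * r) * B" if "x \<in> {r..v}" for x
    unfolding g_def norm_mult using B[OF that] that \<sigma> by (auto intro!: mult_mono)
  have EB: "norm (of_real \<sigma> * E x) \<le> \<sigma> * exp (\<sigma> * v)" if "x \<in> {r..v}" for x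
    using that \<sigma> by (simp add: E_def norm_mult)
  have \<mu>int: "set_integrable lborel {r..v} \<mu>"
    using B by (rule set_integrable_bounded_Icc[rotated]) measurable
  have "norm (E x * A x) \<le> exp (\<sigma> * v) * C" if "x \<in> {r..v}" for x
    unfolding norm_mult using AC[of x] that \<sigma> by (intro mult_mono) (auto simp: E_def)
  then have EAint: "set_integrable lborel {r..v} (\<lambda>x. E x * A x)"
    by (rule set_integrable_bounded_Icc[rotated]) measurable
  have eq: "of_real \<sigma> * E x * M x = E x * A x - \<mu> x" for x
    using Eg[of x] by (simp add: A_def algebra_simps)
  \<comment> \<open>The integral of \<open>of_real \<sigma> * E x * M x\<close> is computed twice:
    from the definition of \<open>A\<close>, and by Fubini's theorem. The integral of
    \<open>\<mu>\<close> occurs in both results and drops out, which leaves \<open>M v * E v\<close>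
    as the integral of \<open>E x * A x\<close>.\<close>
  have "(LINT x:{r..v}|lborel. E x * A x) - (LINT x:{r..v}|lborel. \<mu> x) =
      (LINT x:{r..v}|lborel. of_real \<sigma> * E x * M x)"
    unfolding eq by (rule set_integral_diff(2)[OF EAint \<mu>int, symmetric])
  also have "\<dots> = (LINT y:{r..v}|lborel. g y * (LINT x:{y..v}|lborel. of_real \<sigma> * E x))"
    unfolding M_def by (rule Fubini_triangle[OF _ _ EB gB]) measurable
  also have "\<dots> = (LINT y:{r..v}|lborel. g y * E v - \<mu> y)"
  proof (rule set_lebesgue_integral_cong; (intro ballI allI impI)?)
    fix y assume "y \<in> {r..v}"
    then have eq: "(LINT x:{y..v}|lborel. of_real \<sigma> * E x) = E v - E y"
      using set_integral_exp_Icc(2)[of y v \<sigma>] unfolding E_def of_real_mult of_real_diff by simp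
    show "g y * (LINT x:{y..v}|lborel. of_real \<sigma> * E x) = g y * E v - \<mu> y"
      unfolding eq using Eg[of y] by (simp add: algebra_simps)
  qed simp
  also have "\<dots> = (LINT y:{r..v}|lborel. g y * E v) - (LINT y:{r..v}|lborel. \<mu> y)"
    by (intro set_integral_diff \<mu>int set_integrable_mult_left set_integrable_bounded_Icc[OF _ gB]) measurable
  also have "(LINT y:{r..v}|lborel. g y * E v) = M v * E v"
    unfolding M_def by (rule set_integral_mult_left)
  finally have "M v * E v = (LINT x:{r..v}|lborel. E x * A x)"
    by simp
  also have "norm \<dots> \<le> (LINT x:{r..v}|lborel. (C / \<sigma>) * (\<sigma> * exp (\<sigma> * x)))"
  proof (rule norm_set_integral_Icc_le)
    show "norm (E x * A x) \<le> C / \<sigma> * (\<sigma> * exp (\<sigma> * x))" if "x \<in> {r..v}" for x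
      using AC[of x] that \<sigma> by (simp add: E_def norm_mult)
    show "set_integrable lborel {r..v} (\<lambda>x. C / \<sigma> * (\<sigma> * exp (\<sigma> * x)))"
      by (intro borel_integrable_atLeastAtMost' continuous_intros)
  qed measurable
  also have "\<dots> = C / \<sigma> * (exp (\<sigma> * v) - exp (\<sigma> * r))"
    by (subst set_integral_mult_right) (simp only: set_integral_exp_Icc(1)[OF v])
  also have "\<dots> \<le> C / \<sigma> * exp (\<sigma> * v)"
    using C0 \<sigma> by (intro mult_left_mono) auto
  finally have "norm (M v) * exp (\<sigma> * v) \<le> C / \<sigma> * exp (\<sigma> * v)"
    by (simp add: norm_mult E_def)
  then have "norm (M v) \<le> C / \<sigma>"
    by (rule mult_right_le_imp_le) simp
  then have "norm (of_real \<sigma> * M v) \<le> C"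
    using \<sigma> by (simp add: norm_mult field_simps)
  \<comment> \<open>Two terms of norm at most \<open>C\<close>: the origin of the factor 2 in the
    claim.\<close>
  moreover have "g v = A v - of_real \<sigma> * M v"
    by (simp add: A_def)
  ultimately have "norm (g v) \<le> 2 * C"
    using AC[OF v] norm_triangle_ineq4[of "A v" "of_real \<sigma> * M v"] by simp
  then have "exp (\<sigma> * v) * norm (g v) \<le> exp (\<sigma> * v) * (2 * C)"
    by (intro mult_left_mono) auto
  moreover have "norm (\<mu> v) = exp (\<sigma> * v) * norm (g v)"
    using Eg[of v] by (metis E_def norm_mult norm_of_real abs_exp_cancel)
  ultimately show ?thesis
    by (simp add: mult_ac)
qed

text \<open>Here \<open>N u * E u\<close> is the integral of \<open>E x * A x\<close> over [u, r].
  The integrand is of order exp (\<sigma> x), so the integral has a limit \<open>l\<close> for u to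
  minus infinity, which need not be 0. Hence \<open>\<mu>\<close> has the limit m = \<sigma> l and
  approaches it at the rate exp (\<sigma> u).\<close>

lemma transform_growth_left:
  fixes \<mu> :: "real \<Rightarrow> complex" and \<sigma> r C :: real
  assumes [measurable]: "\<mu> \<in> borel_measurable borel" and bd: "\<And>a b. \<exists>B. \<forall>x\<in>{a..b}. norm (\<mu> x) \<le> B"
    and \<sigma>: "\<sigma> > 0"
    and C: "\<And>u. u \<le> r \<Longrightarrow> norm (of_real (exp (-\<sigma> * u)) * \<mu> u -
        of_real \<sigma> * (LINT x:{u..r}|lborel. of_real (exp (-\<sigma> * x)) * \<mu> x)) \<le> C"
  obtains m where "\<And>u. u \<le> r \<Longrightarrow> norm (\<mu> u - m) \<le> 2 * C * exp (\<sigma> * u)"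
proof -
  define E where "E x = complex_of_real (exp (\<sigma> * x))" for x
  define g where "g x = complex_of_real (exp (-\<sigma> * x)) * \<mu> x" for x
  define N where "N x = (LINT y:{x..r}|lborel. g y)" for x
  define A where "A x = g x - of_real \<sigma> * N x" for x
  have Eg: "E x * g x = \<mu> x" for x
    by (simp add: E_def g_def exp_minus flip: of_real_mult)
  have [measurable]: "E \<in> borel_measurable borel" "g \<in> borel_measurable borel" "N \<in> borel_measurable borel"
     "A \<in> borel_measurable borel"
    unfolding A_def E_def g_def N_def by measurable
  have C0: "C \<ge> 0"
    using C[of r] norm_ge_zero order_trans by blast
  have AC: "norm (A x) \<le> C" if "x \<le> r" for x
    using C[OF that] by (simp add: A_def g_def N_def)
  have NE: "N u * E u = (LINT x:{u..r}|lborel. E x * A x)" if u: "u \<le> r" for u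
  proof -
    obtain B where B: "\<And>x. x \<in> {u..r} \<Longrightarrow> norm (\<mu> x) \<le> B"
      using bd[of u r] by blast
    have gB: "norm (g x) \<le> exp (- \<sigma> * u) * B" if "x \<in> {u..r}" for x
      unfolding g_def norm_mult using B[OF that] that \<sigma> by (auto intro!: mult_mono)
    have EB: "norm (of_real \<sigma> * E x) \<le> \<sigma> * exp (\<sigma> * r)" if "x \<in> {u..r}" for x
      using that \<sigma> by (simp add: E_def norm_mult)
    have \<mu>int: "set_integrable lborel {u..r} \<mu>"
      using B by (rule set_integrable_bounded_Icc[rotated]) measurable
    have "norm (E x * A x) \<le> exp (\<sigma> * r) * C" if "x \<in> {u..r}" for x
      unfolding norm_mult using AC[of x] that \<sigma> by (intro mult_mono) (auto simp: E_def)
    then have EAint: "set_integrable lborel {u..r} (\<lambda>x. E x * A x)"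
      by (rule set_integrable_bounded_Icc[rotated]) measurable
    \<comment> \<open>The difference \<open>E x - E u\<close> is split off because it is an integral
      of \<open>of_real \<sigma> * E y\<close> over [u, x], to which the exchange of integrals over
      the triangle applies.\<close>
    have "(LINT x:{u..r}|lborel. g x * E u) = (LINT x:{u..r}|lborel. \<mu> x) - (LINT x:{u..r}|lborel. g x * (E x - E u))"
    proof -
      have "norm (g x * E u) \<le> exp (- \<sigma> * u) * B * norm (E u)" if "x \<in> {u..r}" for x
        using gB[OF that] by (simp add: norm_mult mult_right_mono)
      then have 1: "set_integrable lborel {u..r} (\<lambda>x. g x * E u)"
        by (rule set_integrable_bounded_Icc[rotated]) measurable
      have "(LINT x:{u..r}|lborel. g x * (E x - E u)) = (LINT x:{u..r}|lborel. \<mu> x - g x * E u)"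
        using Eg by (simp add: algebra_simps)
      also have "\<dots> = (LINT x:{u..r}|lborel. \<mu> x) - (LINT x:{u..r}|lborel. g x * E u)"
        by (rule set_integral_diff(2)[OF \<mu>int 1])
      finally show ?thesis by simp
    qed
    also have "(LINT x:{u..r}|lborel. g x * (E x - E u)) =
        (LINT x:{u..r}|lborel. g x * (LINT y:{u..x}|lborel. of_real \<sigma> * E y))"
    proof (rule set_lebesgue_integral_cong; (intro ballI allI impI)?)
      fix x assume "x \<in> {u..r}"
      then have eq: "(LINT y:{u..x}|lborel. of_real \<sigma> * E y) = E x - E u"
        using set_integral_exp_Icc(2)[of u x \<sigma>] unfolding E_def of_real_mult of_real_diff by simp
      show "g x * (E x - E u) = g x * (LINT y:{u..x}|lborel. of_real \<sigma> * E y)"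
        unfolding eq ..
    qed simp
    also have "\<dots> = (LINT y:{u..r}|lborel. of_real \<sigma> * E y * N y)"
      unfolding N_def by (rule Fubini_triangle[OF _ _ gB EB]) measurable
    also have "(LINT x:{u..r}|lborel. \<mu> x) - \<dots> = (LINT x:{u..r}|lborel. \<mu> x) - (LINT x:{u..r}|lborel. \<mu> x - E x * A x)"
      using Eg by (simp add: A_def algebra_simps)
    also have "\<dots> = (LINT x:{u..r}|lborel. E x * A x)"
      by (subst set_integral_diff(2)[OF \<mu>int EAint]) simp
    also have "(LINT x:{u..r}|lborel. g x * E u) = N u * E u"
      unfolding N_def by (rule set_integral_mult_left)
    finally show ?thesis .
  qed
  have bound: "norm (LINT x:{u..w}|lborel. E x * A x) \<le> C / \<sigma> * exp (\<sigma> * w)" if "u \<le> w" "w \<le> r" for u w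
  proof -
    have "norm (LINT x:{u..w}|lborel. E x * A x) \<le> (LINT x:{u..w}|lborel. (C / \<sigma>) * (\<sigma> * exp (\<sigma> * x)))"
    proof (rule norm_set_integral_Icc_le)
      show "norm (E x * A x) \<le> C / \<sigma> * (\<sigma> * exp (\<sigma> * x))" if "x \<in> {u..w}" for x
        using AC[of x] that \<sigma> \<open>w \<le> r\<close> by (simp add: E_def norm_mult)
      show "set_integrable lborel {u..w} (\<lambda>x. C / \<sigma> * (\<sigma> * exp (\<sigma> * x)))"
        by (intro borel_integrable_atLeastAtMost' continuous_intros)
    qed measurable
    also have "\<dots> = C / \<sigma> * (exp (\<sigma> * w) - exp (\<sigma> * u))"
      by (subst set_integral_mult_right) (simp only: set_integral_exp_Icc(1)[OF that(1)])
    also have "\<dots> \<le> C / \<sigma> * exp (\<sigma> * w)"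
      using C0 \<sigma> by (intro mult_left_mono) auto
    finally show ?thesis .
  qed
  define I where "I u = (LINT x:{u..r}|lborel. E x * A x)" for u
  have diff: "norm (I u - I w) \<le> C / \<sigma> * exp (\<sigma> * w)" if "u \<le> w" "w \<le> r" for u w
  proof -
    have int: "set_integrable lborel {a..b} (\<lambda>x. E x * A x)" if "b \<le> r" for a b
    proof -
      have "norm (E x * A x) \<le> exp (\<sigma> * b) * C" if "x \<in> {a..b}" for x
        unfolding norm_mult using AC[of x] that \<sigma> \<open>b \<le> r\<close> by (intro mult_mono) (auto simp: E_def)
      then show ?thesis
        by (rule set_integrable_bounded_Icc[rotated]) measurable
    qed
    have "I u = (LINT x:{u..w}|lborel. E x * A x) + I w"
      unfolding I_def using that
      by (subst set_integral_Un_AE[symmetric]) (auto intro!: int AE_I'[of "{w}"] simp: ivl_disj_un)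
    then show ?thesis
      using bound[OF that] by simp
  qed
  \<comment> \<open>A sequence is enough to find the limit; \<open>diff\<close> then gives the rate
    for all real arguments.\<close>
  have "Cauchy (\<lambda>n. I (r - real n))"
  proof (rule CauchyI')
    fix e :: real assume "e > 0"
    have "(\<lambda>n. C / \<sigma> * exp (\<sigma> * (r - real n))) \<longlonglongrightarrow> 0"
      using \<sigma> by real_asymp
    then have "\<forall>\<^sub>F n in sequentially. C / \<sigma> * exp (\<sigma> * (r - real n)) < e"
      using \<open>e > 0\<close> by (rule order_tendstoD(2))
    then obtain M where M: "\<And>n. n \<ge> M \<Longrightarrow> C / \<sigma> * exp (\<sigma> * (r - real n)) < e"
      unfolding eventually_sequentially by blast
    have "norm (I (r - real m) - I (r - real n)) < e" if "m \<ge> M" "n > m" for m n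
      using diff[of "r - real n" "r - real m"] M[OF that(1)] that(2) by (simp add: norm_minus_commute)
    then show "\<exists>M. \<forall>m\<ge>M. \<forall>n>m. dist (I (r - real m)) (I (r - real n)) < e"
      unfolding dist_norm by blast
  qed
  then obtain l where l: "(\<lambda>n. I (r - real n)) \<longlonglongrightarrow> l"
    using Cauchy_convergent_iff convergent_def by blast
  have lim: "norm (l - I w) \<le> C / \<sigma> * exp (\<sigma> * w)" if "w \<le> r" for w
  proof (rule tendsto_upperbound)
    show "(\<lambda>n. norm (I (r - real n) - I w)) \<longlonglongrightarrow> norm (l - I w)"
      by (intro tendsto_intros l)
    show "\<forall>\<^sub>F n in sequentially. norm (I (r - real n) - I w) \<le> C / \<sigma> * exp (\<sigma> * w)"
      using eventually_ge_at_top[of "nat \<lceil>r - w\<rceil>"]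
    proof eventually_elim
      case (elim n)
      then show ?case
        by (intro diff that) linarith
    qed
  qed simp
  show ?thesis
  proof (rule that[of "of_real \<sigma> * l"])
    fix u assume u: "u \<le> r"
    have "\<mu> u = E u * A u + of_real \<sigma> * I u"
      unfolding I_def NE[OF u, symmetric] Eg[of u, symmetric] by (simp add: A_def algebra_simps)
    then have "\<mu> u - of_real \<sigma> * l = E u * A u - of_real \<sigma> * (l - I u)"
      by (simp add: algebra_simps)
    then have "norm (\<mu> u - of_real \<sigma> * l) \<le> norm (E u * A u) + norm (of_real \<sigma> * (l - I u))"
      by (simp only: norm_triangle_ineq4)
    also have "norm (E u * A u) \<le> exp (\<sigma> * u) * C"
      using AC[OF u] by (simp add: norm_mult E_def)
    also have "norm (of_real \<sigma> * (l - I u)) \<le> \<sigma> * (C / \<sigma> * exp (\<sigma> * u))"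
      unfolding norm_mult norm_of_real using mult_left_mono[OF lim[OF u], of \<sigma>] \<sigma>
      by (simp only: abs_of_pos less_imp_le)
    finally show "norm (\<mu> u - of_real \<sigma> * l) \<le> 2 * C * exp (\<sigma> * u)"
      using \<sigma> by simp
  qed
qed

text \<open>The integral of exp (- s t) with respect to \<open>\<mu>\<close> over [u, v] after
  integration by parts: boundary terms and a Lebesgue integral, which can be split, estimated and
  reflected directly.\<close>

definition partial_transform :: "(real \<Rightarrow> complex) \<Rightarrow> complex \<Rightarrow> real \<Rightarrow> real \<Rightarrow> complex" where
  "partial_transform \<mu> s u v = exp (- s * of_real v) * \<mu> v - exp (- s * of_real u) * \<mu> u +
     s * (LINT x:{u..v}|lborel. exp (- s * of_real x) * \<mu> x)"

lemma stieltjes_exp_integral_eq: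
  assumes "normalized_determining \<mu>" "u < v"
    and "has_stieltjes_integral (\<lambda>t. exp (- s * of_real t)) \<mu> u v J"
  shows "J = partial_transform \<mu> s u v"
proof -
  have "J = exp (- s * of_real v) * \<mu> v - exp (- s * of_real u) * \<mu> u -
      (LINT x:{u..v}|lborel. \<mu> x * (- s * exp (- s * of_real x)))"
    by (rule stieltjes_integral_by_parts[OF assms])
       (auto intro!: derivative_eq_intros has_vector_derivative_real_field continuous_intros)
  also have "(LINT x:{u..v}|lborel. \<mu> x * (- s * exp (- s * of_real x))) =
      (LINT x:{u..v}|lborel. - s * (exp (- s * of_real x) * \<mu> x))"
    by (simp add: mult_ac)
  also have "\<dots> = - s * (LINT x:{u..v}|lborel. exp (- s * of_real x) * \<mu> x)"
    by (rule set_integral_mult_right)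
  finally show ?thesis
    by (simp add: partial_transform_def)
qed

lemma has_laplace_stieltjes_tendsto:
  assumes "normalized_determining \<mu>" "has_laplace_stieltjes \<mu> s L"
  shows "((\<lambda>(u, v). partial_transform \<mu> s u v) \<longlongrightarrow> L) (at_bot \<times>\<^sub>F at_top)"
proof -
  obtain J where J: "\<And>u v. u \<le> v \<Longrightarrow> has_stieltjes_integral (\<lambda>t. exp (- s * of_real t)) \<mu> u v (J u v)"
    and lim: "((\<lambda>(u, v). J u v) \<longlongrightarrow> L) (at_bot \<times>\<^sub>F at_top)"
    using assms(2) unfolding has_laplace_stieltjes_def by blast
  \<comment> \<open>Integration by parts is available for u < v only; along the filter this holds
    eventually.\<close>
  have "\<forall>\<^sub>F z in at_bot \<times>\<^sub>F at_top. fst z < (0::real) \<and> 0 < (snd z::real)"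
    unfolding eventually_prod_filter
    by (intro exI[of _ "\<lambda>u. u < 0"] exI[of _ "\<lambda>v. 0 < v"]) (simp add: eventually_gt_at_bot eventually_gt_at_top)
  then have "\<forall>\<^sub>F z in at_bot \<times>\<^sub>F at_top. (case z of (u, v) \<Rightarrow> J u v) = (case z of (u, v) \<Rightarrow> partial_transform \<mu> s u v)"
    by eventually_elim (auto intro!: stieltjes_exp_integral_eq assms J)
  with lim show ?thesis
    by (rule Lim_transform_eventually)
qed

text \<open>Since the end points tend to infinity independently, one of them can be frozen at
  \<plusminus>R while the other runs through a half-line. This yields the one-sided bounds from
  which the growth of \<open>\<mu>\<close> is derived.\<close>

lemma has_laplace_stieltjes_bounded:
  assumes "normalized_determining \<mu>" "has_laplace_stieltjes \<mu> s L"
  shows "\<exists>R C. \<forall>u v. u \<le> -R \<longrightarrow> R \<le> v \<longrightarrow> norm (partial_transform \<mu> s u v) \<le> C"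
proof -
  have "\<forall>\<^sub>F z in at_bot \<times>\<^sub>F at_top. dist (case z of (u, v) \<Rightarrow> partial_transform \<mu> s u v) L < 1"
    using has_laplace_stieltjes_tendsto[OF assms] by (rule tendstoD) simp
  then obtain P Q where P: "eventually P at_bot" and Q: "eventually Q at_top"
     and PQ: "\<And>u v. P u \<Longrightarrow> Q v \<Longrightarrow> dist (partial_transform \<mu> s u v) L < 1"
    unfolding eventually_prod_filter by force
  obtain p where p: "\<And>u. u \<le> p \<Longrightarrow> P u" using P unfolding eventually_at_bot_linorder by blast
  obtain q where q: "\<And>v. v \<ge> q \<Longrightarrow> Q v" using Q unfolding eventually_at_top_linorder by blast
  have "norm (partial_transform \<mu> s u v) \<le> norm L + 1" if "u \<le> - max (-p) q" "max (-p) q \<le> v" for u v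
  proof -
    have "u \<le> p" "q \<le> v" using that by linarith+
    then show ?thesis
      using PQ[OF p q, of u v] norm_triangle_ineq2[of "partial_transform \<mu> s u v" L] by (simp add: dist_norm)
  qed
  then show ?thesis by blast
qed

lemma set_integrable_exp_mult_Icc:
  assumes [measurable]: "\<mu> \<in> borel_measurable borel" and bd: "\<And>a b. \<exists>B. \<forall>x\<in>{a..b}. norm (\<mu> x) \<le> B"
  shows "set_integrable lborel {a..b} (\<lambda>x. exp (- s * of_real x) * \<mu> x :: complex)"
proof -
  obtain B where B: "\<And>x. x \<in> {a..b} \<Longrightarrow> norm (\<mu> x) \<le> B"
    using bd by blast
  have "bounded ((\<lambda>x. exp (- s * complex_of_real x)) ` {a..b})"
    by (intro compact_imp_bounded compact_continuous_image continuous_intros) auto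
  then obtain E where E: "\<And>x. x \<in> {a..b} \<Longrightarrow> norm (exp (- s * complex_of_real x)) \<le> E"
    unfolding bounded_iff by blast
  have [measurable]: "(\<lambda>x. exp (- s * complex_of_real x)) \<in> borel_measurable borel"
    by (intro borel_measurable_continuous_onI continuous_intros)
  show ?thesis
  proof (rule set_integrable_bounded_Icc)
    show "norm (exp (- s * of_real x) * \<mu> x) \<le> E * B" if "x \<in> {a..b}" for x
      unfolding norm_mult using E[OF that] B[OF that] by (intro mult_mono order_trans[OF norm_ge_zero E[OF that]]) auto
  qed measurable
qed

lemma set_integral_Icc_combine:
  fixes f :: "real \<Rightarrow> complex"
  assumes "a \<le> b" "b \<le> c" and f: "\<And>a b. set_integrable lborel {a..b} f"
  shows "(LINT x:{a..c}|lborel. f x) = (LINT x:{a..b}|lborel. f x) + (LINT x:{b..c}|lborel. f x)"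
proof -
  have "{a..c} = {a..b} \<union> {b..c}"
    using assms by auto
  then show ?thesis
    using assms by (simp only:) (rule set_integral_Un_AE, auto intro!: AE_I'[of "{b}"])
qed

text \<open>Two abscissas are needed: \<open>\<sigma>\<^sub>1\<close> controls \<open>\<mu>\<close>
  at plus infinity and \<open>\<sigma>\<^sub>2\<close> at minus infinity, so that exp (- s u)
  (\<mu>(u) - m) decays in both directions when Re s lies strictly between them. The constant
  \<open>m\<close> comes from the left end; on the right it is absorbed by
  \<open>exp (\<sigma>\<^sub>1 * u)\<close>, which is at least 1 there.\<close>

lemma determining_function_growth_pos:
  fixes \<mu> :: "real \<Rightarrow> complex"
  assumes \<mu>: "\<mu> \<in> borel_measurable borel" and bd: "\<And>a b. \<exists>B. \<forall>x\<in>{a..b}. norm (\<mu> x) \<le> B"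
    and \<sigma>: "0 < \<sigma>\<^sub>1" "\<sigma>\<^sub>1 < \<sigma>\<^sub>2"
    and 1: "\<exists>R C. \<forall>u v. u \<le> -R \<longrightarrow> R \<le> v \<longrightarrow> norm (partial_transform \<mu> (of_real \<sigma>\<^sub>1) u v) \<le> C"
    and 2: "\<exists>R C. \<forall>u v. u \<le> -R \<longrightarrow> R \<le> v \<longrightarrow> norm (partial_transform \<mu> (of_real \<sigma>\<^sub>2) u v) \<le> C"
  shows "\<exists>m K. (\<forall>u\<ge>0. norm (\<mu> u - m) \<le> K * exp (\<sigma>\<^sub>1 * u)) \<and> (\<forall>u\<le>0. norm (\<mu> u - m) \<le> K * exp (\<sigma>\<^sub>2 * u))"
proof -
  obtain R1 C1 where R1: "\<And>u v. u \<le> -R1 \<Longrightarrow> R1 \<le> v \<Longrightarrow> norm (partial_transform \<mu> (of_real \<sigma>\<^sub>1) u v) \<le> C1"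
    using 1 by blast
  obtain R2 C2 where R2: "\<And>u v. u \<le> -R2 \<Longrightarrow> R2 \<le> v \<Longrightarrow> norm (partial_transform \<mu> (of_real \<sigma>\<^sub>2) u v) \<le> C2"
    using 2 by blast
  define R where "R = max 0 (max R1 R2)"
  have R: "R \<ge> 0" "R \<ge> R1" "R \<ge> R2" by (auto simp: R_def)
  define g where "g \<sigma> x = complex_of_real (exp (-\<sigma> * x)) * \<mu> x" for \<sigma> x
  have g_eq: "exp (- of_real \<sigma> * of_real x) * \<mu> x = g \<sigma> x" for \<sigma> x
    by (simp add: g_def exp_of_real[symmetric])
  have int: "set_integrable lborel {a..b} (g \<sigma>)" for a b \<sigma>
    using set_integrable_exp_mult_Icc[OF \<mu> bd, of a b "of_real \<sigma>"] unfolding g_eq .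
  have T: "partial_transform \<mu> (of_real \<sigma>) u v = g \<sigma> v - g \<sigma> u + of_real \<sigma> * (LINT x:{u..v}|lborel. g \<sigma> x)" for \<sigma> u v
    unfolding partial_transform_def g_eq ..
  \<comment> \<open>\<open>C1\<close> plus the terms of the transform over [-R, v] that do not
    involve v; \<open>D2\<close> is the analogue for [u, R].\<close>
  define D1 where "D1 = C1 + norm (g \<sigma>\<^sub>1 (-R) - of_real \<sigma>\<^sub>1 * (LINT x:{-R..R}|lborel. g \<sigma>\<^sub>1 x))"
  have right: "norm (\<mu> v) \<le> 2 * D1 * exp (\<sigma>\<^sub>1 * v)" if "v \<ge> R" for v
  proof (rule transform_growth_right[OF \<mu> bd \<sigma>(1) _ that])
    fix v assume v: "R \<le> v"
    have "g \<sigma>\<^sub>1 v + of_real \<sigma>\<^sub>1 * (LINT x:{R..v}|lborel. g \<sigma>\<^sub>1 x) =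
       partial_transform \<mu> (of_real \<sigma>\<^sub>1) (-R) v + (g \<sigma>\<^sub>1 (-R) - of_real \<sigma>\<^sub>1 * (LINT x:{-R..R}|lborel. g \<sigma>\<^sub>1 x))"
      unfolding T using set_integral_Icc_combine[OF _ v int, of "-R" "\<sigma>\<^sub>1"] R by (simp add: algebra_simps)
    also have "norm \<dots> \<le> D1"
      unfolding D1_def using R1[of "-R" v] R v by (intro norm_triangle_le) auto
    finally show "norm (of_real (exp (-\<sigma>\<^sub>1 * v)) * \<mu> v +
        of_real \<sigma>\<^sub>1 * (LINT x:{R..v}|lborel. of_real (exp (-\<sigma>\<^sub>1 * x)) * \<mu> x)) \<le> D1"
      unfolding g_def .
  qed
  define D2 where "D2 = C2 + norm (g \<sigma>\<^sub>2 R + of_real \<sigma>\<^sub>2 * (LINT x:{-R..R}|lborel. g \<sigma>\<^sub>2 x))"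
  have "\<exists>m. \<forall>u\<le>-R. norm (\<mu> u - m) \<le> 2 * D2 * exp (\<sigma>\<^sub>2 * u)"
  proof (rule transform_growth_left[OF \<mu> bd, of \<sigma>\<^sub>2 "-R" D2])
    fix u assume u: "u \<le> -R"
    have "g \<sigma>\<^sub>2 u - of_real \<sigma>\<^sub>2 * (LINT x:{u..-R}|lborel. g \<sigma>\<^sub>2 x) =
       (g \<sigma>\<^sub>2 R + of_real \<sigma>\<^sub>2 * (LINT x:{-R..R}|lborel. g \<sigma>\<^sub>2 x)) - partial_transform \<mu> (of_real \<sigma>\<^sub>2) u R"
      unfolding T using set_integral_Icc_combine[OF u _ int, of R "\<sigma>\<^sub>2"] R by (simp add: algebra_simps)
    also have "norm \<dots> \<le> D2"
      unfolding D2_def using R2[of u R] R u by (intro order_trans[OF norm_triangle_ineq4]) auto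
    finally show "norm (of_real (exp (-\<sigma>\<^sub>2 * u)) * \<mu> u -
        of_real \<sigma>\<^sub>2 * (LINT x:{u..-R}|lborel. of_real (exp (-\<sigma>\<^sub>2 * x)) * \<mu> x)) \<le> D2"
      unfolding g_def .
  qed (use \<sigma> in auto)
  then obtain m where left: "\<And>u. u \<le> -R \<Longrightarrow> norm (\<mu> u - m) \<le> 2 * D2 * exp (\<sigma>\<^sub>2 * u)"
    by blast
  obtain B where B: "\<And>x. x \<in> {-R..R} \<Longrightarrow> norm (\<mu> x) \<le> B"
    using bd by blast
  have B0: "B \<ge> 0" using B[of 0] R by (auto intro: order_trans[OF norm_ge_zero])
  have D1: "D1 \<ge> 0" and D2: "D2 \<ge> 0"
    unfolding D1_def D2_def using R1[of "-R" R] R2[of "-R" R] R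
    by (auto intro!: add_nonneg_nonneg intro: order_trans[OF norm_ge_zero])
  \<comment> \<open>One constant for four ranges: it dominates \<open>2 * D1 + norm m\<close> for u
    >= R, \<open>B + norm m\<close> on [0, R] and \<open>2 * D2\<close> for u <= -R. On [-R, 0] the
    factor \<open>exp (\<sigma>\<^sub>2 * R)\<close> makes up for
    \<open>exp (\<sigma>\<^sub>2 * u)\<close>.\<close>
  define K where "K = 2 * D1 + 2 * D2 + (B + norm m) * exp (\<sigma>\<^sub>2 * R)"
  have e1: "1 \<le> exp (\<sigma>\<^sub>2 * R)" using \<sigma> R by simp
  have mB: "B + norm m \<le> (B + norm m) * exp (\<sigma>\<^sub>2 * R)"
    using mult_left_mono[OF e1, of "B + norm m"] B0 by simp
  have K: "2 * D1 + norm m \<le> K" "B + norm m \<le> K" "2 * D2 \<le> K" "(B + norm m) * exp (\<sigma>\<^sub>2 * R) \<le> K"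
    using D1 D2 mB B0 unfolding K_def by (auto intro!: add_nonneg_nonneg)
  show ?thesis
  proof (rule exI[of _ m], rule exI[of _ K], intro conjI allI impI)
    fix u :: real assume u: "0 \<le> u"
    have e: "1 \<le> exp (\<sigma>\<^sub>1 * u)" using u \<sigma> by simp
    show "norm (\<mu> u - m) \<le> K * exp (\<sigma>\<^sub>1 * u)"
    proof (cases "u \<ge> R")
      case True
      have "norm (\<mu> u - m) \<le> 2 * D1 * exp (\<sigma>\<^sub>1 * u) + norm m * exp (\<sigma>\<^sub>1 * u)"
        using right[OF True] norm_triangle_ineq4[of "\<mu> u" m] mult_left_mono[OF e, of "norm m"] by simp
      also have "\<dots> \<le> K * exp (\<sigma>\<^sub>1 * u)"
        using mult_right_mono[OF K(1), of "exp (\<sigma>\<^sub>1 * u)"] by (simp add: distrib_right)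
      finally show ?thesis .
    next
      case False
      then have "norm (\<mu> u - m) \<le> B + norm m"
        using B[of u] u R norm_triangle_ineq4[of "\<mu> u" m] by simp
      also have "\<dots> \<le> K * 1"
        using K by simp
      also have "\<dots> \<le> K * exp (\<sigma>\<^sub>1 * u)"
        using e K B0 by (intro mult_left_mono) (auto intro: order_trans[OF _ K(2)])
      finally show ?thesis .
    qed
  next
    fix u :: real assume u: "u \<le> 0"
    show "norm (\<mu> u - m) \<le> K * exp (\<sigma>\<^sub>2 * u)"
    proof (cases "u \<le> -R")
      case True
      show ?thesis
        by (rule order_trans[OF left[OF True] mult_right_mono[OF K(3)]]) simp
    next
      case False
      have e: "1 \<le> exp (\<sigma>\<^sub>2 * R) * exp (\<sigma>\<^sub>2 * u)"
        using False \<sigma> by (simp flip: exp_add distrib_left)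
      have "norm (\<mu> u - m) \<le> B + norm m"
        using B[of u] u False norm_triangle_ineq4[of "\<mu> u" m] by simp
      also have "\<dots> \<le> (B + norm m) * (exp (\<sigma>\<^sub>2 * R) * exp (\<sigma>\<^sub>2 * u))"
        using mult_left_mono[OF e, of "B + norm m"] B0 by simp
      also have "\<dots> \<le> K * exp (\<sigma>\<^sub>2 * u)"
        using mult_right_mono[OF K(4), of "exp (\<sigma>\<^sub>2 * u)"] by (simp add: mult_ac)
      finally show ?thesis .
    qed
  qed
qed

text \<open>Reduces transforms on the left of the imaginary axis to transforms on its right. The
  minus sign before \<open>\<mu>\<close> makes up for the exchange of the end points.\<close>

lemma partial_transform_reflect:
  "partial_transform (\<lambda>t. - \<mu> (- t)) (- s) u v = partial_transform \<mu> s (- v) (- u)"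
proof -
  have "(LINT x:{-v..-u}|lborel. exp (- s * of_real x) * \<mu> x) = (LINT x:{u..v}|lborel. exp (s * of_real x) * \<mu> (- x))"
    by (subst set_integral_reflect) (auto intro!: arg_cong[of _ _ "\<lambda>A. set_lebesgue_integral lborel A _"])
  moreover have "(LINT x:{u..v}|lborel. exp (s * of_real x) * - \<mu> (- x)) = - (LINT x:{u..v}|lborel. exp (s * of_real x) * \<mu> (- x))"
    by (simp add: set_lebesgue_integral_def)
  ultimately show ?thesis
    by (simp add: partial_transform_def)
qed

lemma determining_function_growth:
  fixes \<mu> :: "real \<Rightarrow> complex"
  assumes \<mu>: "normalized_determining \<mu>"
    and \<sigma>: "\<sigma>\<^sub>1 < \<sigma>\<^sub>2" "0 < \<sigma>\<^sub>1 \<or> \<sigma>\<^sub>2 < 0"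
    and 1: "has_laplace_stieltjes \<mu> (of_real \<sigma>\<^sub>1) L\<^sub>1" and 2: "has_laplace_stieltjes \<mu> (of_real \<sigma>\<^sub>2) L\<^sub>2"
  obtains m K where "\<And>u. u \<ge> 0 \<Longrightarrow> norm (\<mu> u - m) \<le> K * exp (\<sigma>\<^sub>1 * u)"
    "\<And>u. u \<le> 0 \<Longrightarrow> norm (\<mu> u - m) \<le> K * exp (\<sigma>\<^sub>2 * u)"
proof -
  note [measurable] = normalized_determining_borel[OF \<mu>]
  have bd: "\<exists>B. \<forall>x\<in>{a..b}. norm (\<mu> x) \<le> B" for a b
    using normalized_determining_bounded[OF \<mu>, of a b] by metis
  note T1 = has_laplace_stieltjes_bounded[OF \<mu> 1] and T2 = has_laplace_stieltjes_bounded[OF \<mu> 2]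
  have "\<exists>m K. (\<forall>u\<ge>0. norm (\<mu> u - m) \<le> K * exp (\<sigma>\<^sub>1 * u)) \<and> (\<forall>u\<le>0. norm (\<mu> u - m) \<le> K * exp (\<sigma>\<^sub>2 * u))"
  proof (cases "0 < \<sigma>\<^sub>1")
    case True
    then show ?thesis
      using determining_function_growth_pos[OF _ bd _ \<sigma>(1) T1 T2] by simp
  next
    case False
    let ?\<nu> = "\<lambda>t. - \<mu> (- t)"
    have bd': "\<exists>B. \<forall>x\<in>{a..b}. norm (?\<nu> x) \<le> B" for a b
    proof -
      obtain B where "\<forall>x\<in>{-b..-a}. norm (\<mu> x) \<le> B" using bd by blast
      then show ?thesis by (intro exI[of _ B]) auto
    qed
    have refl: "\<exists>R C. \<forall>u v. u \<le> -R \<longrightarrow> R \<le> v \<longrightarrow> norm (partial_transform ?\<nu> (of_real (- \<sigma>)) u v) \<le> C"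
      if *: "\<exists>R C. \<forall>u v. u \<le> -R \<longrightarrow> R \<le> v \<longrightarrow> norm (partial_transform \<mu> (of_real \<sigma>) u v) \<le> C" for \<sigma>
    proof -
      from * obtain R C where RC: "\<And>u v. u \<le> -R \<Longrightarrow> R \<le> v \<Longrightarrow> norm (partial_transform \<mu> (of_real \<sigma>) u v) \<le> C"
        by blast
      show ?thesis
        unfolding of_real_minus partial_transform_reflect
        by (intro exI[of _ R] exI[of _ C] allI impI RC) auto
    qed
    \<comment> \<open>Reflection negates the abscissas and reverses their order, so
      \<open>\<sigma>\<^sub>1\<close> and \<open>\<sigma>\<^sub>2\<close> change places;
      \<open>m\<close> is now the limit at plus infinity of the unreflected function, up to
      sign.\<close>
    have "\<exists>m K. (\<forall>u\<ge>0. norm (?\<nu> u - m) \<le> K * exp (- \<sigma>\<^sub>2 * u)) \<and> (\<forall>u\<le>0. norm (?\<nu> u - m) \<le> K * exp (- \<sigma>\<^sub>1 * u))"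
      by (rule determining_function_growth_pos[OF _ bd' _ _ refl[OF T2] refl[OF T1]]) (use False \<sigma> in auto)
    then obtain m K where mK: "\<And>u. u \<ge> 0 \<Longrightarrow> norm (?\<nu> u - m) \<le> K * exp (- \<sigma>\<^sub>2 * u)"
       "\<And>u. u \<le> 0 \<Longrightarrow> norm (?\<nu> u - m) \<le> K * exp (- \<sigma>\<^sub>1 * u)"
      by blast
    have nm: "norm (- \<mu> u - m) = norm (\<mu> u - - m)" for u
    proof -
      have "- \<mu> u - m = - (\<mu> u - - m)" by simp
      then show ?thesis by (simp only: norm_minus_cancel)
    qed
    have "norm (\<mu> u - - m) \<le> K * exp (\<sigma>\<^sub>1 * u)" if "u \<ge> 0" for u
      using mK(2)[of "- u"] that by (simp add: nm)
    moreover have "norm (\<mu> u - - m) \<le> K * exp (\<sigma>\<^sub>2 * u)" if "u \<le> 0" for u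
      using mK(1)[of "- u"] that by (simp add: nm)
    ultimately show ?thesis by blast
  qed
  then show ?thesis using that by blast
qed

section \<open>Gaussian inversion of the Laplace--Stieltjes transform\<close>

lemma integrable_inverse_one_plus_square: "integrable lborel (\<lambda>x::real. inverse (1 + x\<^sup>2))"
  using integrable_inverse_1_plus_square by (simp add: set_integrable_def)

lemma integrable_exp_neg_abs:
  fixes d :: real
  assumes d: "d > 0"
  shows "integrable lborel (\<lambda>x. exp (- d * \<bar>x\<bar>))"
proof (rule Bochner_Integration.integrable_bound[OF integrable_mult_right[OF integrable_inverse_one_plus_square, of "1 + 2 / d\<^sup>2"]])
  have "exp (- d * \<bar>x\<bar>) \<le> (1 + 2 / d\<^sup>2) * inverse (1 + x\<^sup>2)" for x
  proof -
    have "1 + d * \<bar>x\<bar> + (d * \<bar>x\<bar>)\<^sup>2 / 2 \<le> exp (d * \<bar>x\<bar>)"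
      using d by (intro exp_lower_Taylor_quadratic) auto
    then have *: "1 + d\<^sup>2 * x\<^sup>2 / 2 \<le> exp (d * \<bar>x\<bar>)"
      using d by (simp add: power_mult_distrib add_increasing2) (smt (verit) mult_nonneg_nonneg abs_ge_zero)
    \<comment> \<open>The constant 1 + 2/d^2 is chosen for this: the expanded product contains both
      1 and x^2, and its second factor is at most exp (d |x|).\<close>
    have "1 + x\<^sup>2 \<le> (1 + 2 / d\<^sup>2) * (1 + d\<^sup>2 * x\<^sup>2 / 2)"
      using d by (simp add: field_simps)
    also have "\<dots> \<le> (1 + 2 / d\<^sup>2) * exp (d * \<bar>x\<bar>)"
      using * by (intro mult_left_mono) auto
    finally have "1 \<le> (1 + 2 / d\<^sup>2) * exp (d * \<bar>x\<bar>) * inverse (1 + x\<^sup>2)"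
      by (simp add: field_simps add_pos_nonneg)
    then have "exp (- d * \<bar>x\<bar>) * 1 \<le> exp (- d * \<bar>x\<bar>) * ((1 + 2 / d\<^sup>2) * exp (d * \<bar>x\<bar>) * inverse (1 + x\<^sup>2))"
      by (intro mult_left_mono) auto
    also have "\<dots> = (1 + 2 / d\<^sup>2) * inverse (1 + x\<^sup>2)"
      by (simp add: exp_minus)
    finally show ?thesis by simp
  qed
  then show "AE x in lborel. norm (exp (- d * \<bar>x\<bar>)) \<le> norm ((1 + 2 / d\<^sup>2) * inverse (1 + x\<^sup>2))"
    by (intro AE_I2) (simp add: abs_mult)
qed measurable

lemma continuous_imp_borel_Complex:
  fixes f :: "complex \<Rightarrow> complex"
  assumes "continuous_on {s. Re s = c} f"
  shows "(\<lambda>y. f (Complex c y)) \<in> borel_measurable borel"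
  by (intro borel_measurable_continuous_onI continuous_on_compose2[OF assms] continuous_intros) auto

lemma integrable_exp_mult_two_sided:
  fixes G :: "real \<Rightarrow> complex"
  assumes [measurable]: "G \<in> borel_measurable borel"
    and r: "\<And>u. u \<ge> 0 \<Longrightarrow> norm (G u) \<le> K * exp (\<alpha> * u)" and l: "\<And>u. u \<le> 0 \<Longrightarrow> norm (G u) \<le> K * exp (\<beta> * u)"
    and c: "\<alpha> < Re s" "Re s < \<beta>"
  shows "integrable lborel (\<lambda>u. exp (- s * of_real u) * G u)"
proof -
  define d where "d = min (Re s - \<alpha>) (\<beta> - Re s)"
  have d: "d > 0" using c by (simp add: d_def)
  have K: "K \<ge> 0" using r[of 0] by (auto intro: order_trans[OF norm_ge_zero])
  have [measurable]: "(\<lambda>u. exp (- s * complex_of_real u)) \<in> borel_measurable borel"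
    by (intro borel_measurable_continuous_onI continuous_intros)
  show ?thesis
  proof (rule Bochner_Integration.integrable_bound[OF integrable_mult_right[OF integrable_exp_neg_abs[OF d], of K]])
    have "norm (exp (- s * of_real u) * G u) \<le> K * exp (- d * \<bar>u\<bar>)" for u
    proof (cases "u \<ge> 0")
      case True
      have "norm (exp (- s * of_real u) * G u) \<le> exp (- Re s * u) * (K * exp (\<alpha> * u))"
        unfolding norm_mult using r[OF True] by (simp add: mult_left_mono)
      also have "\<dots> = K * exp (- (Re s - \<alpha>) * u)"
        by (simp add: algebra_simps exp_add[symmetric] exp_diff exp_minus field_simps)
      also have "\<dots> \<le> K * exp (- d * \<bar>u\<bar>)"
      proof -
        have "d * u \<le> (Re s - \<alpha>) * u"
          using True by (intro mult_right_mono) (auto simp: d_def)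
        then have "- (Re s - \<alpha>) * u \<le> - d * u" by (simp only: mult_minus_left neg_le_iff_le)
        then show ?thesis using True K by (intro mult_left_mono) auto
      qed
      finally show ?thesis .
    next
      case False
      have "norm (exp (- s * of_real u) * G u) \<le> exp (- Re s * u) * (K * exp (\<beta> * u))"
        unfolding norm_mult using l[of u] False by (simp add: mult_left_mono)
      also have "\<dots> = K * exp ((\<beta> - Re s) * u)"
        by (simp add: algebra_simps exp_add[symmetric] exp_diff exp_minus field_simps)
      also have "\<dots> \<le> K * exp (- d * \<bar>u\<bar>)"
      proof -
        have "d * u \<ge> (\<beta> - Re s) * u"
          using False by (intro mult_right_mono_neg) (auto simp: d_def)
        then show ?thesis using False K by (intro mult_left_mono) auto
      qed
      finally show ?thesis .
    qed
    then show "AE u in lborel. norm (exp (- s * of_real u) * G u) \<le> norm (K * exp (- d * \<bar>u\<bar>))"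
      using K by (intro AE_I2) simp
  qed measurable
qed

lemma set_integral_cexp_Icc:
  assumes "u \<le> v"
  shows "s * (LINT x:{u..v}|lborel. exp (- s * complex_of_real x)) = exp (- s * of_real u) - exp (- s * of_real v)"
proof -
  have "(LINT x:{u..v}|lborel. s * exp (- s * complex_of_real x)) = - exp (- s * of_real v) - - exp (- s * of_real u)"
    unfolding set_lebesgue_integral_def
    by (rule integral_FTC_atLeastAtMost[OF assms, where F="\<lambda>x. - exp (- s * of_real x)"])
       (auto intro!: derivative_eq_intros has_vector_derivative_real_field continuous_intros)
  then show ?thesis
    by simp
qed

lemma tendsto_set_integral_symmetric:
  fixes f :: "real \<Rightarrow> complex"
  assumes int: "integrable lborel f"
  shows "(\<lambda>n. LINT x:{- real n..real n}|lborel. f x) \<longlonglongrightarrow> (LINT x|lborel. f x)"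
  unfolding set_lebesgue_integral_def
proof (rule integral_dominated_convergence[OF _ _ integrable_norm[OF int]])
  show "f \<in> borel_measurable lborel"
    using int by (rule borel_measurable_integrable)
  then show "(\<lambda>x. indicator {- real n..real n} x *\<^sub>R f x) \<in> borel_measurable lborel" for n
    by measurable
  show "AE x in lborel. (\<lambda>n. indicator {- real n..real n} x *\<^sub>R f x) \<longlonglongrightarrow> f x"
  proof (rule AE_I2)
    fix x :: real
    have "\<forall>\<^sub>F n in sequentially. indicator {- real n..real n} x *\<^sub>R f x = f x"
      using eventually_ge_at_top[of "nat \<lceil>\<bar>x\<bar>\<rceil>"]
    proof eventually_elim
      case (elim n)
      then have "\<bar>x\<bar> \<le> real n" by linarith
      then show ?case by (simp add: indicator_def abs_le_iff)
    qed
    then show "(\<lambda>n. indicator {- real n..real n} x *\<^sub>R f x) \<longlonglongrightarrow> f x"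
      by (rule tendsto_eventually)
  qed
  show "AE x in lborel. norm (indicator {- real n..real n} x *\<^sub>R f x) \<le> norm (f x)" for n
    by (intro AE_I2) (auto simp: indicator_def)
qed

text \<open>Subtracting a constant from \<open>\<mu>\<close> leaves the partial transform unchanged,
  because the boundary terms and the integral of a constant cancel. For \<open>\<mu> u - m\<close>
  the boundary terms tend to 0 at both ends and the integral converges absolutely, which determines
  \<open>L\<close>.\<close>

lemma laplace_stieltjes_absolute:
  fixes \<mu> :: "real \<Rightarrow> complex"
  assumes \<mu>: "normalized_determining \<mu>"
    and r: "\<And>u. u \<ge> 0 \<Longrightarrow> norm (\<mu> u - m) \<le> K * exp (\<alpha> * u)"
    and l: "\<And>u. u \<le> 0 \<Longrightarrow> norm (\<mu> u - m) \<le> K * exp (\<beta> * u)"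
    and c: "\<alpha> < Re s" "Re s < \<beta>"
    and L: "has_laplace_stieltjes \<mu> s L"
  shows "L = s * (LINT u|lborel. exp (- s * of_real u) * (\<mu> u - m))"
proof -
  note [measurable] = normalized_determining_borel[OF \<mu>]
  define G where "G u = \<mu> u - m" for u
  have [measurable]: "G \<in> borel_measurable borel" unfolding G_def by measurable
  have bd: "\<exists>B. \<forall>x\<in>{a..b}. norm (\<mu> x) \<le> B" for a b
    using normalized_determining_bounded[OF \<mu>, of a b] by metis
  have int: "integrable lborel (\<lambda>u. exp (- s * of_real u) * G u)"
    by (rule integrable_exp_mult_two_sided[where \<alpha>=\<alpha> and \<beta>=\<beta> and K=K]) (use r l c in \<open>auto simp: G_def\<close>)
  have pt: "partial_transform \<mu> s u v = exp (- s * of_real v) * G v - exp (- s * of_real u) * G u +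
     s * (LINT x:{u..v}|lborel. exp (- s * of_real x) * G x)" if "u \<le> v" for u v
  proof -
    have 1: "set_integrable lborel {u..v} (\<lambda>x. exp (- s * of_real x) * \<mu> x)"
      by (rule set_integrable_exp_mult_Icc[OF _ bd]) measurable
    have 2: "set_integrable lborel {u..v} (\<lambda>x. exp (- s * complex_of_real x) * m)"
      by (rule set_integrable_exp_mult_Icc) auto
    have "(LINT x:{u..v}|lborel. exp (- s * of_real x) * G x) =
       (LINT x:{u..v}|lborel. exp (- s * of_real x) * \<mu> x - exp (- s * of_real x) * m)"
      unfolding G_def right_diff_distrib ..
    also have "\<dots> = (LINT x:{u..v}|lborel. exp (- s * of_real x) * \<mu> x) - (LINT x:{u..v}|lborel. exp (- s * of_real x) * m)"
      by (rule set_integral_diff(2)[OF 1 2])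
    also have "(LINT x:{u..v}|lborel. exp (- s * of_real x) * m) = (LINT x:{u..v}|lborel. exp (- s * complex_of_real x)) * m"
      by (rule set_integral_mult_left)
    finally have "s * (LINT x:{u..v}|lborel. exp (- s * of_real x) * G x) =
       s * (LINT x:{u..v}|lborel. exp (- s * of_real x) * \<mu> x) - (s * (LINT x:{u..v}|lborel. exp (- s * complex_of_real x))) * m"
      by (simp only: right_diff_distrib mult.assoc)
    then show ?thesis
      unfolding set_integral_cexp_Icc[OF that] partial_transform_def G_def by (simp add: algebra_simps)
  qed
  \<comment> \<open>The limit over independent end points is known to be \<open>L\<close>, so the
    symmetric ones -n, n identify it.\<close>
  have "filterlim (\<lambda>n. (- real n, real n)) (at_bot \<times>\<^sub>F at_top) sequentially"
    by (intro filterlim_Pair filterlim_real_sequentially) (simp add: filterlim_uminus_at_bot filterlim_real_sequentially)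
  from filterlim_compose[OF has_laplace_stieltjes_tendsto[OF \<mu> L] this]
  have lim1: "(\<lambda>n. partial_transform \<mu> s (- real n) (real n)) \<longlonglongrightarrow> L"
    by simp
  have "(\<lambda>n. exp (- s * of_real (real n)) * G (real n)) \<longlonglongrightarrow> 0"
  proof (rule Lim_null_comparison)
    show "\<forall>\<^sub>F n in sequentially. norm (exp (- s * of_real (real n)) * G (real n)) \<le> K * exp (- (Re s - \<alpha>) * real n)"
    proof (rule always_eventually, rule allI)
      fix n
      have "norm (exp (- s * of_real (real n)) * G (real n)) \<le> exp (- Re s * real n) * (K * exp (\<alpha> * real n))"
        unfolding norm_mult using r[of "real n"] by (simp add: mult_left_mono G_def)
      also have "\<dots> = K * exp (- (Re s - \<alpha>) * real n)"
        by (simp add: algebra_simps exp_add[symmetric] exp_diff exp_minus field_simps)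
      finally show "norm (exp (- s * of_real (real n)) * G (real n)) \<le> K * exp (- (Re s - \<alpha>) * real n)" .
    qed
    show "(\<lambda>n. K * exp (- (Re s - \<alpha>) * real n)) \<longlonglongrightarrow> 0"
      using c(1) by real_asymp
  qed
  moreover have "(\<lambda>n. exp (- s * of_real (- real n)) * G (- real n)) \<longlonglongrightarrow> 0"
  proof (rule Lim_null_comparison)
    show "\<forall>\<^sub>F n in sequentially. norm (exp (- s * of_real (- real n)) * G (- real n)) \<le> K * exp (- (\<beta> - Re s) * real n)"
    proof (rule always_eventually, rule allI)
      fix n
      have "norm (exp (- s * of_real (- real n)) * G (- real n)) \<le> exp (Re s * real n) * (K * exp (\<beta> * - real n))"
        unfolding norm_mult using l[of "- real n"] by (simp add: mult_left_mono G_def)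
      also have "\<dots> = K * exp (- (\<beta> - Re s) * real n)"
        by (simp add: algebra_simps exp_add[symmetric] exp_diff exp_minus field_simps)
      finally show "norm (exp (- s * of_real (- real n)) * G (- real n)) \<le> K * exp (- (\<beta> - Re s) * real n)" .
    qed
    show "(\<lambda>n. K * exp (- (\<beta> - Re s) * real n)) \<longlonglongrightarrow> 0"
      using c(2) by real_asymp
  qed
  moreover have "(\<lambda>n. LINT x:{- real n..real n}|lborel. exp (- s * of_real x) * G x) \<longlonglongrightarrow>
      (LINT u|lborel. exp (- s * of_real u) * G u)"
    by (rule tendsto_set_integral_symmetric[OF int])
  ultimately have "(\<lambda>n. exp (- s * of_real (real n)) * G (real n) - exp (- s * of_real (- real n)) * G (- real n)
     + s * (LINT x:{- real n..real n}|lborel. exp (- s * of_real x) * G x)) \<longlonglongrightarrow>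
       0 - 0 + s * (LINT u|lborel. exp (- s * of_real u) * G u)"
    by (intro tendsto_intros)
  then have "(\<lambda>n. partial_transform \<mu> s (- real n) (real n)) \<longlonglongrightarrow> s * (LINT u|lborel. exp (- s * of_real u) * G u)"
    by (subst pt) auto
  from LIMSEQ_unique[OF lim1 this] show ?thesis
    by (simp add: G_def)
qed

section \<open>Gaussian averaging on a vertical line\<close>

definition gauss_factor :: "real \<Rightarrow> complex \<Rightarrow> complex" where
  "gauss_factor h s = exp (of_real (h\<^sup>2 / 2) * s\<^sup>2)"

lemma norm_gauss_factor: "norm (gauss_factor h (Complex c y)) = exp (h\<^sup>2 * (c\<^sup>2 - y\<^sup>2) / 2)"
  by (simp add: gauss_factor_def power2_eq_square algebra_simps)

lemma continuous_gauss_factor [continuous_intros]: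
  "continuous_on A f \<Longrightarrow> continuous_on A (\<lambda>x. gauss_factor h (f x))"
  unfolding gauss_factor_def by (intro continuous_intros)

lemma holomorphic_gauss_factor [holomorphic_intros]:
  "f holomorphic_on A \<Longrightarrow> (\<lambda>x. gauss_factor h (f x)) holomorphic_on A"
  unfolding gauss_factor_def by (intro holomorphic_intros)

lemma integrable_gauss:
  fixes d :: real
  assumes "d > 0"
  shows "integrable lborel (\<lambda>x. exp (- d * x\<^sup>2))"
proof (rule Bochner_Integration.integrable_bound[OF integrable_mult_right[OF integrable_exp_neg_abs[OF assms], of "exp d"]])
  have "exp (- d * x\<^sup>2) \<le> exp d * exp (- d * \<bar>x\<bar>)" for x
  proof -
    have "\<bar>x\<bar> \<le> 1 + \<bar>x\<bar>\<^sup>2"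
      using zero_le_power2[of "\<bar>x\<bar> - 1"] abs_ge_zero[of x]
      unfolding power2_eq_square left_diff_distrib right_diff_distrib by linarith
    then have "d * \<bar>x\<bar> \<le> d * (1 + \<bar>x\<bar>\<^sup>2)"
      using assms by (intro mult_left_mono) auto
    then show ?thesis
      by (simp add: exp_add[symmetric] algebra_simps)
  qed
  then show "AE x in lborel. norm (exp (- d * x\<^sup>2)) \<le> norm (exp d * exp (- d * \<bar>x\<bar>))"
    by (intro AE_I2) simp
qed measurable

lemma integrable_norm_gauss_factor:
  fixes h c :: real
  assumes "h > 0"
  shows "integrable lborel (\<lambda>y. exp (h\<^sup>2 * (c\<^sup>2 - y\<^sup>2) / 2))"
proof -
  have "integrable lborel (\<lambda>y. exp (h\<^sup>2 * c\<^sup>2 / 2) * exp (- (h\<^sup>2 / 2) * y\<^sup>2))"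
    using assms by (intro integrable_mult_right integrable_gauss) auto
  then show ?thesis
    by (simp add: exp_add[symmetric] algebra_simps diff_divide_distrib)
qed

lemma fourier_std_normal:
  "(LINT z|lborel. complex_of_real (std_normal_density z) * exp (\<i> * of_real (\<xi> * z))) = of_real (exp (- \<xi>\<^sup>2 / 2))"
proof -
  have "(LINT z|lborel. complex_of_real (std_normal_density z) * exp (\<i> * of_real (\<xi> * z))) = char std_normal_distribution \<xi>"
    unfolding char_def by (subst integral_density) (auto simp: scaleR_conv_of_real)
  then show ?thesis
    by (simp add: char_std_normal_distribution)
qed

text \<open>\<open>gauss_factor h\<close> is the moment generating function of the centred normal
  law with standard deviation \<open>h\<close>, and this is its inversion on the line
  \<open>Re s = c\<close>. The value does not depend on \<open>c\<close>: the exponents that contain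
  \<open>c\<close> cancel once the characteristic function of the standard normal law is evaluated
  at \<xi>.\<close>

lemma integral_gauss_factor:
  assumes h: "h > 0"
  shows "(LINT y|lborel. exp (Complex c y * of_real x) * gauss_factor h (Complex c y)) =
     of_real (2 * pi / h * std_normal_density (x / h))"
proof -
  \<comment> \<open>With y = z/h, \<xi> collects what multiplies \<i> z in the exponent: x/h from
    exp (s x), and h c from the cross term of s^2.\<close>
  define \<xi> where "\<xi> = (x + h\<^sup>2 * c) / h"
  let ?f = "\<lambda>y. exp (Complex c y * of_real x) * gauss_factor h (Complex c y)"
  have eq: "?f (0 + (1/h) * z) = of_real (sqrt (2 * pi) * exp (c * x + h\<^sup>2 * c\<^sup>2 / 2)) *
     (complex_of_real (std_normal_density z) * exp (\<i> * of_real (\<xi> * z)))" for z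
  proof -
    have "Complex c (z / h) * of_real x + of_real (h\<^sup>2 / 2) * (Complex c (z / h))\<^sup>2 =
      of_real (c * x + h\<^sup>2 * c\<^sup>2 / 2) + of_real (- z\<^sup>2 / 2) + \<i> * of_real (\<xi> * z)"
      using h by (simp add: complex_eq_iff \<xi>_def power2_eq_square field_simps)
    then have "?f (0 + (1/h) * z) = exp (of_real (c * x + h\<^sup>2 * c\<^sup>2 / 2)) * exp (of_real (- z\<^sup>2 / 2)) * exp (\<i> * of_real (\<xi> * z))"
      unfolding gauss_factor_def by (simp flip: exp_add)
    also have "exp (complex_of_real (- z\<^sup>2 / 2)) = of_real (sqrt (2 * pi)) * of_real (std_normal_density z)"
      unfolding exp_of_real std_normal_density_def of_real_mult[symmetric] by simp
    finally show ?thesis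
      by (simp only: exp_of_real of_real_mult mult_ac)
  qed
  have "(LINT y|lborel. ?f y) = \<bar>1/h\<bar> *\<^sub>R (LINT z|lborel. ?f (0 + (1/h) * z))"
    by (rule lborel_integral_real_affine) (use h in auto)
  also have "\<dots> = of_real (1 / h) * (of_real (sqrt (2 * pi) * exp (c * x + h\<^sup>2 * c\<^sup>2 / 2)) * of_real (exp (- \<xi>\<^sup>2 / 2)))"
    unfolding eq integral_mult_right_zero fourier_std_normal using h by (simp add: scaleR_conv_of_real)
  also have "\<dots> = of_real (1 / h * sqrt (2 * pi) * exp (c * x + h\<^sup>2 * c\<^sup>2 / 2 - \<xi>\<^sup>2 / 2))"
  proof -
    have "exp (c * x + h\<^sup>2 * c\<^sup>2 / 2 - \<xi>\<^sup>2 / 2) = exp (c * x + h\<^sup>2 * c\<^sup>2 / 2) * exp (- \<xi>\<^sup>2 / 2)"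
      by (simp add: exp_add[symmetric])
    then show ?thesis
      by (simp only: of_real_mult mult.assoc)
  qed
  also have "c * x + h\<^sup>2 * c\<^sup>2 / 2 - \<xi>\<^sup>2 / 2 = - (x / h)\<^sup>2 / 2"
    using h by (simp add: \<xi>_def power2_eq_square field_simps)
  also have "1 / h * sqrt (2 * pi) * exp (- (x / h)\<^sup>2 / 2) = 2 * pi / h * std_normal_density (x / h)"
  proof -
    define S where "S = sqrt (2 * pi)"
    have S: "S > 0" "2 * pi = S * S" by (simp_all add: S_def)
    show ?thesis
      unfolding std_normal_density_def S_def[symmetric] unfolding S(2) using S(1) h by simp
  qed
  finally show ?thesis .
qed

lemma integrable_exp_gauss_factor:
  assumes h: "h > 0"
  shows "integrable lborel (\<lambda>y. exp (Complex c y * of_real x) * gauss_factor h (Complex c y))"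
proof (rule Bochner_Integration.integrable_bound[OF integrable_mult_right[OF integrable_norm_gauss_factor[OF h], of "exp (c * x)" c]])
  show "(\<lambda>y. exp (Complex c y * of_real x) * gauss_factor h (Complex c y)) \<in> borel_measurable lborel"
    unfolding measurable_lborel1 measurable_lborel2 by (intro borel_measurable_continuous_onI continuous_intros)
  show "AE y in lborel. norm (exp (Complex c y * of_real x) * gauss_factor h (Complex c y))
    \<le> norm (exp (c * x) * exp (h\<^sup>2 * (c\<^sup>2 - y\<^sup>2) / 2))"
    by (intro AE_I2) (simp add: norm_mult norm_gauss_factor)
qed

text \<open>For fixed u, the y-integral of exp (s (t - u)) times the Gaussian factor is 2 pi times
  the normal density of standard deviation \<open>h\<close> at t - u. After an exchange of integrals
  the line integral therefore averages \<open>G\<close> around t, in the variable w = (u -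
  t)/h.\<close>

lemma gauss_inversion:
  fixes G :: "real \<Rightarrow> complex"
  assumes [measurable]: "G \<in> borel_measurable borel" and h: "h > 0"
    and int: "\<And>s. Re s = c \<Longrightarrow> integrable lborel (\<lambda>u. exp (- s * of_real u) * G u)"
  shows "(LINT y|lborel. (LINT u|lborel. exp (- Complex c y * of_real u) * G u) *
       (exp (Complex c y * of_real t) * gauss_factor h (Complex c y))) =
     2 * pi * (LINT w|lborel. of_real (std_normal_density w) * G (t + h * w))"
    (is "?L = _")
proof -
  define k where "k y u = (exp (- Complex c y * of_real u) * G u) * (exp (Complex c y * of_real t) * gauss_factor h (Complex c y))" for y u
  have m: "(\<lambda>z. exp (- Complex c (fst z) * of_real (snd z)) * (exp (Complex c (fst z) * of_real t) * gauss_factor h (Complex c (fst z)))) \<in> borel_measurable (borel \<Otimes>\<^sub>M borel)"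
    unfolding borel_prod by (intro borel_measurable_continuous_onI continuous_intros)
  have m': "case_prod k \<in> borel_measurable (borel \<Otimes>\<^sub>M borel)"
  proof -
    have "(\<lambda>z. (exp (- Complex c (fst z) * of_real (snd z)) * (exp (Complex c (fst z) * of_real t) * gauss_factor h (Complex c (fst z)))) * G (snd z)) \<in> borel_measurable (borel \<Otimes>\<^sub>M borel)"
      by (intro borel_measurable_times m) measurable
    then show ?thesis
      by (simp add: k_def case_prod_unfold mult_ac)
  qed
  \<comment> \<open>The modulus is a product of a function of u and a function of y, both
    integrable; this is what Fubini's theorem requires.\<close>
  have nk: "norm (k y u) = norm (exp (- of_real c * complex_of_real u) * G u) * (exp (c * t) * exp (h\<^sup>2 * (c\<^sup>2 - y\<^sup>2) / 2))" for y u
    by (simp add: k_def norm_mult norm_gauss_factor)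
  have "integrable (lborel \<Otimes>\<^sub>M lborel) (case_prod k)"
  proof (rule lborel_pair.Fubini_integrable)
    show "case_prod k \<in> borel_measurable (lborel \<Otimes>\<^sub>M lborel)"
      using m' by simp
    have "integrable lborel (\<lambda>y. (LINT u|lborel. norm (exp (- of_real c * complex_of_real u) * G u)) * (exp (c * t) * exp (h\<^sup>2 * (c\<^sup>2 - y\<^sup>2) / 2)))"
      by (intro integrable_mult_right integrable_norm_gauss_factor h)
    then show "integrable lborel (\<lambda>y. LINT u|lborel. norm (case_prod k (y, u)))"
      by (simp only: case_prod_conv nk integral_mult_left_zero)
    show "AE y in lborel. integrable lborel (\<lambda>u. case_prod k (y, u))"
      unfolding case_prod_conv k_def by (intro AE_I2 integrable_mult_left int) simp
  qed
  from lborel_pair.Fubini_integral[OF this]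
  have fub: "(LINT y|lborel. LINT u|lborel. k y u) = (LINT u|lborel. LINT y|lborel. k y u)"
    by simp
  have "?L = (LINT y|lborel. LINT u|lborel. k y u)"
    unfolding k_def integral_mult_left_zero ..
  also have "\<dots> = (LINT u|lborel. G u * of_real (2 * pi / h * std_normal_density ((t - u) / h)))"
    unfolding fub
  proof (rule Bochner_Integration.integral_cong[OF refl])
    fix u
    have "(LINT y|lborel. k y u) = (LINT y|lborel. G u * (exp (Complex c y * of_real (t - u)) * gauss_factor h (Complex c y)))"
      by (intro Bochner_Integration.integral_cong refl)
         (simp add: k_def exp_diff exp_minus field_simps right_diff_distrib)
    also have "\<dots> = G u * of_real (2 * pi / h * std_normal_density ((t - u) / h))"
      unfolding integral_mult_right_zero integral_gauss_factor[OF h] ..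
    finally show "(LINT y|lborel. k y u) = G u * of_real (2 * pi / h * std_normal_density ((t - u) / h))" .
  qed
  also have "\<dots> = \<bar>h\<bar> *\<^sub>R (LINT w|lborel. G (t + h * w) * of_real (2 * pi / h * std_normal_density ((t - (t + h * w)) / h)))"
    by (rule lborel_integral_real_affine) (use h in auto)
  \<comment> \<open>The argument of the density has become -w, and the density is even.\<close>
  also have "\<dots> = \<bar>h\<bar> *\<^sub>R (LINT w|lborel. of_real (2 * pi / h) * (of_real (std_normal_density w) * G (t + h * w)))"
    using h by (intro arg_cong[of _ _ "\<lambda>x. \<bar>h\<bar> *\<^sub>R x"] Bochner_Integration.integral_cong refl)
       (simp add: std_normal_density_def)
  also have "\<dots> = 2 * pi * (LINT w|lborel. of_real (std_normal_density w) * G (t + h * w))"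
    unfolding integral_mult_right_zero using h by (simp add: scaleR_conv_of_real)
  finally show ?thesis .
qed

lemma integrable_std_normal_exp_abs:
  "integrable lborel (\<lambda>w. std_normal_density w * exp (D * \<bar>w\<bar>))"
proof (rule Bochner_Integration.integrable_bound)
  show "integrable lborel (\<lambda>w. exp (D\<^sup>2) * exp (- (1/4) * w\<^sup>2))"
    by (intro integrable_mult_right integrable_gauss) simp
  have "norm (std_normal_density w * exp (D * \<bar>w\<bar>)) \<le> norm (exp (D\<^sup>2) * exp (- (1/4) * w\<^sup>2))" for w
  proof -
    \<comment> \<open>Completing the square: D |w| <= D^2 + w^2/4, which leaves exp (- w^2/4) of the
      Gaussian decay.\<close>
    have "(\<bar>w\<bar> / 2 - D)\<^sup>2 \<ge> 0" by simp
    then have "- w\<^sup>2 / 2 + D * \<bar>w\<bar> \<le> D\<^sup>2 - w\<^sup>2 / 4"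
      by (simp add: power2_eq_square algebra_simps)
    then have "exp (- w\<^sup>2 / 2) * exp (D * \<bar>w\<bar>) \<le> exp (D\<^sup>2) * exp (- (1/4) * w\<^sup>2)"
      unfolding exp_add[symmetric] by simp
    from mult_mono[OF _ this, of "1 / sqrt (2 * pi)" 1]
    have "1 / sqrt (2 * pi) * (exp (- w\<^sup>2 / 2) * exp (D * \<bar>w\<bar>)) \<le> 1 * (exp (D\<^sup>2) * exp (- (1/4) * w\<^sup>2))"
      using pi_gt3 by (simp add: divide_le_eq)
    moreover have "norm (std_normal_density w * exp (D * \<bar>w\<bar>)) = 1 / sqrt (2 * pi) * (exp (- w\<^sup>2 / 2) * exp (D * \<bar>w\<bar>))"
      by (simp add: std_normal_density_def)
    ultimately show ?thesis
      by simp
  qed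
  then show "AE w in lborel. norm (std_normal_density w * exp (D * \<bar>w\<bar>)) \<le> norm (exp (D\<^sup>2) * exp (- (1/4) * w\<^sup>2))"
    by (intro AE_I2)
qed measurable

lemma std_normal_density_half:
  "(LINT w|lborel. std_normal_density w * indicator {0<..} w) = 1 / 2"
  "(LINT w|lborel. std_normal_density w * indicator {..<0} w) = 1 / 2"
proof -
  let ?P = "LINT w|lborel. std_normal_density w * indicator {0<..} w"
  let ?N = "LINT w|lborel. std_normal_density w * indicator {..<0} w"
  have int: "integrable lborel std_normal_density"
    using integrable_std_normal_moment[of 0] by simp
  have i: "integrable lborel (\<lambda>w. std_normal_density w * indicator {0<..} w)"
    "integrable lborel (\<lambda>w. std_normal_density w * indicator {..<0} w)"
    by (rule Bochner_Integration.integrable_bound[OF int]; auto simp: indicator_def)+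
  have "?P = (LINT w|lborel. std_normal_density (0 + (-1) * w) * indicator {0<..} (0 + (-1) * w))"
    by (subst lborel_integral_real_affine[of "-1" _ 0]) auto
  also have "\<dots> = ?N"
    by (intro Bochner_Integration.integral_cong) (auto simp: std_normal_density_def indicator_def)
  finally have "?P = ?N" .
  moreover have "?P + ?N = 1"
  proof -
    have "?P + ?N = (LINT w|lborel. std_normal_density w * indicator {0<..} w + std_normal_density w * indicator {..<0} w)"
      by (rule Bochner_Integration.integral_add[OF i, symmetric])
    also have "\<dots> = (LINT w|lborel. std_normal_density w)"
    proof (rule integral_cong_AE)
      show "AE w in lborel. std_normal_density w * indicator {0<..} w + std_normal_density w * indicator {..<0} w = std_normal_density w"
        using AE_lborel_singleton[of 0] by eventually_elim (auto simp: indicator_def)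
    qed auto
    also have "\<dots> = 1"
      using integral_std_normal_moment_even[of 0] by simp
    finally show ?thesis .
  qed
  ultimately show "?P = 1 / 2" "?N = 1 / 2" by simp_all
qed

text \<open>For w > 0 the argument approaches t from the right, for w < 0 from the left, and each
  half-line has normal mass 1/2. The exponential bound on \<open>G\<close>, with step sizes at most
  1, supplies a majorant that is integrable against the normal density.\<close>

lemma gauss_mean_tendsto:
  fixes G :: "real \<Rightarrow> complex"
  assumes [measurable]: "G \<in> borel_measurable borel"
    and bd: "\<And>u. norm (G u) \<le> K * exp (D * \<bar>u\<bar>)" and D: "D \<ge> 0"
    and l: "(G \<longlongrightarrow> l) (at_left t)" and r: "(G \<longlongrightarrow> r) (at_right t)"
  shows "(\<lambda>n. LINT w|lborel. of_real (std_normal_density w) * G (t + 1 / real (Suc n) * w)) \<longlonglongrightarrow> (r + l) / 2"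
proof -
  \<comment> \<open>The value \<open>G t\<close> at w = 0 makes the pointwise convergence hold there
    too; the integral does not see it.\<close>
  define J where "J w = (if w > 0 then r else if w < 0 then l else G t)" for w :: real
  have K: "K \<ge> 0" using bd[of 0] by (auto intro: order_trans[OF norm_ge_zero])
  have [measurable]: "J \<in> borel_measurable borel" unfolding J_def by measurable
  have "(\<lambda>n. LINT w|lborel. of_real (std_normal_density w) * G (t + 1 / real (Suc n) * w)) \<longlonglongrightarrow>
     (LINT w|lborel. of_real (std_normal_density w) * J w)"
  proof (rule integral_dominated_convergence)
    show "integrable lborel (\<lambda>w. K * exp (D * \<bar>t\<bar>) * (std_normal_density w * exp (D * \<bar>w\<bar>)))"
      by (intro integrable_mult_right integrable_std_normal_exp_abs)
    show "AE w in lborel. (\<lambda>n. of_real (std_normal_density w) * G (t + 1 / real (Suc n) * w)) \<longlonglongrightarrow> of_real (std_normal_density w) * J w"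
    proof (intro AE_I2 tendsto_mult tendsto_const)
      fix w :: real
      have lim: "(\<lambda>n. t + 1 / real (Suc n) * w) \<longlonglongrightarrow> t"
        by real_asymp
      consider "w > 0" | "w < 0" | "w = 0" by linarith
      then show "(\<lambda>n. G (t + 1 / real (Suc n) * w)) \<longlonglongrightarrow> J w"
      proof cases
        case 1
        then have "filterlim (\<lambda>n. t + 1 / real (Suc n) * w) (at_right t) sequentially"
          unfolding filterlim_at using lim by auto
        from filterlim_compose[OF r this] 1 show ?thesis by (simp add: J_def)
      next
        case 2
        then have "filterlim (\<lambda>n. t + 1 / real (Suc n) * w) (at_left t) sequentially"
          unfolding filterlim_at using lim by (auto simp: divide_less_0_iff)
        from filterlim_compose[OF l this] 2 show ?thesis by (simp add: J_def)
      qed (simp add: J_def)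
    qed
    show "AE w in lborel. norm (of_real (std_normal_density w) * G (t + 1 / real (Suc n) * w))
       \<le> K * exp (D * \<bar>t\<bar>) * (std_normal_density w * exp (D * \<bar>w\<bar>))" for n
    proof (rule AE_I2)
      fix w
      have "\<bar>1 / real (Suc n) * w\<bar> \<le> \<bar>w\<bar>"
        by (simp add: abs_mult divide_le_eq mult_le_cancel_left1)
      then have "\<bar>t + 1 / real (Suc n) * w\<bar> \<le> \<bar>t\<bar> + \<bar>w\<bar>"
        by (rule order_trans[OF abs_triangle_ineq add_left_mono])
      then have "K * exp (D * \<bar>t + 1 / real (Suc n) * w\<bar>) \<le> K * exp (D * (\<bar>t\<bar> + \<bar>w\<bar>))"
        using K D by (intro mult_left_mono) (auto intro!: mult_left_mono)
      with bd[of "t + 1 / real (Suc n) * w"] have "norm (G (t + 1 / real (Suc n) * w)) \<le> K * exp (D * (\<bar>t\<bar> + \<bar>w\<bar>))"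
        by (rule order_trans)
      then have "std_normal_density w * norm (G (t + 1 / real (Suc n) * w)) \<le> std_normal_density w * (K * exp (D * (\<bar>t\<bar> + \<bar>w\<bar>)))"
        by (intro mult_left_mono) auto
      then show "norm (of_real (std_normal_density w) * G (t + 1 / real (Suc n) * w))
       \<le> K * exp (D * \<bar>t\<bar>) * (std_normal_density w * exp (D * \<bar>w\<bar>))"
        by (simp add: norm_mult distrib_left exp_add mult_ac)
    qed
  qed measurable
  also have "(LINT w|lborel. of_real (std_normal_density w) * J w) =
     (LINT w|lborel. complex_of_real (std_normal_density w * indicator {0<..} w) * r + complex_of_real (std_normal_density w * indicator {..<0} w) * l)"
  proof (rule integral_cong_AE)
    show "AE w in lborel. of_real (std_normal_density w) * J w =
      complex_of_real (std_normal_density w * indicator {0<..} w) * r + complex_of_real (std_normal_density w * indicator {..<0} w) * l"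
      using AE_lborel_singleton[of 0] by eventually_elim (auto simp: J_def indicator_def)
  qed measurable
  also have "\<dots> = (LINT w|lborel. complex_of_real (std_normal_density w * indicator {0<..} w) * r) +
      (LINT w|lborel. complex_of_real (std_normal_density w * indicator {..<0} w) * l)"
  proof (rule Bochner_Integration.integral_add)
    have int: "integrable lborel std_normal_density"
      using integrable_std_normal_moment[of 0] by simp
    show "integrable lborel (\<lambda>w. complex_of_real (std_normal_density w * indicator {0<..} w) * r)"
      by (intro integrable_mult_left integrable_of_real Bochner_Integration.integrable_bound[OF int]) (auto simp: indicator_def)
    show "integrable lborel (\<lambda>w. complex_of_real (std_normal_density w * indicator {..<0} w) * l)"
      by (intro integrable_mult_left integrable_of_real Bochner_Integration.integrable_bound[OF int]) (auto simp: indicator_def)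
  qed
  also have "\<dots> = (r + l) / 2"
    unfolding integral_mult_left_zero integral_complex_of_real std_normal_density_half by (simp add: add_divide_distrib)
  finally show ?thesis .
qed

definition exp_quot :: "real \<Rightarrow> complex \<Rightarrow> complex" where
  "exp_quot t s = (if s = 0 then of_real t else (exp (s * of_real t) - 1) / s)"

lemma holomorphic_exp_quot: "exp_quot t holomorphic_on UNIV"
proof (rule no_isolated_singularity'[of "{0}"])
  have "((\<lambda>s. exp (s * complex_of_real t)) has_field_derivative of_real t) (at 0)"
    by (auto intro!: derivative_eq_intros)
  then have "(\<lambda>s. (exp (s * of_real t) - 1) / s) \<midarrow>0\<rightarrow> complex_of_real t"
    by (simp add: DERIV_def)
  then have "exp_quot t \<midarrow>0\<rightarrow> complex_of_real t"
    by (rule Lim_transform_eventually) (auto simp: eventually_at_filter exp_quot_def)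
  then show "(exp_quot t \<longlongrightarrow> exp_quot t z) (at z within UNIV)" if "z \<in> {0}" for z
    using that by (simp add: exp_quot_def)
  have "(\<lambda>s. (exp (s * of_real t) - 1) / s) holomorphic_on UNIV - {0}"
    by (intro holomorphic_intros) auto
  then show "exp_quot t holomorphic_on UNIV - {0}"
    by (rule holomorphic_transform) (auto simp: exp_quot_def)
qed auto

text \<open>The division by s in \<open>exp_quot\<close> cancels the factor s in front of the
  absolutely convergent integral, and exp (s t) - 1 splits into two Gaussian inversions, at t and at
  0. Both limits contain -m, which drops out of the difference, and \<open>\<mu> 0 = 0\<close>
  removes the rest of the second one.\<close>

lemma laplace_line_inversion:
  fixes F :: "complex \<Rightarrow> complex" and \<mu> :: "real \<Rightarrow> complex"
  assumes \<mu>: "normalized_determining \<mu>"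
    and \<sigma>: "\<sigma>\<^sub>1 < c" "c < \<sigma>\<^sub>2" "0 < \<sigma>\<^sub>1 \<or> \<sigma>\<^sub>2 < 0"
    and conv: "\<And>s. \<sigma>\<^sub>1 \<le> Re s \<Longrightarrow> Re s \<le> \<sigma>\<^sub>2 \<Longrightarrow> has_laplace_stieltjes \<mu> s (F s)"
  shows "\<exists>B. \<forall>y. norm (F (Complex c y)) \<le> B * norm (Complex c y)"
    and "(\<lambda>y. F (Complex c y)) \<in> borel_measurable borel"
    and "h > 0 \<Longrightarrow> integrable lborel (\<lambda>y. F (Complex c y) * exp_quot t (Complex c y) * gauss_factor h (Complex c y))"
    and "(\<lambda>n. LINT y|lborel. F (Complex c y) * exp_quot t (Complex c y) * gauss_factor (1 / real (Suc n)) (Complex c y))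
       \<longlonglongrightarrow> 2 * pi * \<mu> t"
proof -
  note [measurable] = normalized_determining_borel[OF \<mu>]
  obtain m :: complex and K :: real where r: "\<And>u. u \<ge> 0 \<Longrightarrow> norm (\<mu> u - m) \<le> K * exp (\<sigma>\<^sub>1 * u)"
    and l: "\<And>u. u \<le> 0 \<Longrightarrow> norm (\<mu> u - m) \<le> K * exp (\<sigma>\<^sub>2 * u)"
    by (rule determining_function_growth[OF \<mu> _ \<sigma>(3) conv[of "of_real \<sigma>\<^sub>1"] conv[of "of_real \<sigma>\<^sub>2"]]) (use \<sigma> in auto)
  define G where "G u = \<mu> u - m" for u
  have [measurable]: "G \<in> borel_measurable borel" unfolding G_def by measurable
  have int: "integrable lborel (\<lambda>u. exp (- s * of_real u) * G u)" if "Re s = c" for s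
    by (rule integrable_exp_mult_two_sided[where \<alpha>=\<sigma>\<^sub>1 and \<beta>=\<sigma>\<^sub>2 and K=K]) (use r l \<sigma> that in \<open>auto simp: G_def\<close>)
  define I where "I y = (LINT u|lborel. exp (- Complex c y * of_real u) * G u)" for y
  have F: "F (Complex c y) = Complex c y * I y" for y
    unfolding I_def G_def
    by (rule laplace_stieltjes_absolute[OF \<mu> r l _ _ conv]) (use \<sigma> in auto)
  define B where "B = (LINT u|lborel. norm (exp (- of_real c * complex_of_real u) * G u))"
  have I_bound: "norm (I y) \<le> B" for y
  proof -
    have "norm (I y) \<le> (LINT u|lborel. norm (exp (- Complex c y * of_real u) * G u))"
      unfolding I_def by (rule integral_norm_bound)
    also have "\<dots> = B"
      unfolding B_def by (intro Bochner_Integration.integral_cong refl) (simp add: norm_mult)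
    finally show ?thesis .
  qed
  show "\<exists>B. \<forall>y. norm (F (Complex c y)) \<le> B * norm (Complex c y)"
    using I_bound by (intro exI[of _ B] allI) (simp add: F norm_mult mult.commute mult_right_mono)
  have Imeas [measurable]: "I \<in> borel_measurable borel"
  proof -
    have m: "(\<lambda>z. exp (- Complex c (fst z) * of_real (snd z))) \<in> borel_measurable (borel \<Otimes>\<^sub>M borel)"
      unfolding borel_prod by (intro borel_measurable_continuous_onI continuous_intros)
    have "(\<lambda>z. exp (- Complex c (fst z) * of_real (snd z)) * G (snd z)) \<in> borel_measurable (borel \<Otimes>\<^sub>M borel)"
      by (intro borel_measurable_times m) measurable
    then have "(\<lambda>(y, u). exp (- Complex c y * of_real u) * G u) \<in> borel_measurable (borel \<Otimes>\<^sub>M lborel)"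
      by (simp add: case_prod_unfold)
    then show ?thesis
      unfolding I_def by (rule lborel.borel_measurable_lebesgue_integral)
  qed
  have [measurable]: "Complex c \<in> borel_measurable borel"
    by (intro borel_measurable_continuous_onI continuous_intros)
  show "(\<lambda>y. F (Complex c y)) \<in> borel_measurable borel"
    unfolding F by measurable
  have c0: "Complex c y \<noteq> 0" for y
    using \<sigma> by (auto simp: complex_eq_iff)
  have split: "F (Complex c y) * exp_quot t (Complex c y) * gauss_factor h (Complex c y) =
      I y * (exp (Complex c y * of_real t) * gauss_factor h (Complex c y)) -
      I y * (exp (Complex c y * of_real 0) * gauss_factor h (Complex c y))" for t y h
  proof -
    have eq: "F (Complex c y) * exp_quot t (Complex c y) = I y * (exp (Complex c y * of_real t) - 1)"
      using c0[of y] by (simp add: F exp_quot_def)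
    show ?thesis
      unfolding eq by (simp add: algebra_simps)
  qed
  have piece: "integrable lborel (\<lambda>y. I y * (exp (Complex c y * of_real t) * gauss_factor h (Complex c y)))"
    if "h > 0" for t h
  proof (rule Bochner_Integration.integrable_bound[OF integrable_mult_right[OF integrable_norm[OF integrable_exp_gauss_factor[OF that]], of B c t]])
    have "(\<lambda>y. exp (Complex c y * of_real t) * gauss_factor h (Complex c y)) \<in> borel_measurable borel"
      by (intro borel_measurable_continuous_onI continuous_intros)
    then show "(\<lambda>y. I y * (exp (Complex c y * of_real t) * gauss_factor h (Complex c y))) \<in> borel_measurable lborel"
      by measurable
    have "norm (I y * z) \<le> norm (B * norm z)" for y z
      using mult_right_mono[OF I_bound, of "norm z" y] by (simp add: norm_mult abs_mult)
        (smt (verit) I_bound norm_ge_zero mult_right_mono)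
    then show "AE y in lborel. norm (I y * (exp (Complex c y * of_real t) * gauss_factor h (Complex c y)))
      \<le> norm (B * norm (exp (Complex c y * of_real t) * gauss_factor h (Complex c y)))"
      by (intro AE_I2)
  qed
  show "integrable lborel (\<lambda>y. F (Complex c y) * exp_quot t (Complex c y) * gauss_factor h (Complex c y))" if "h > 0"
    unfolding split by (intro Bochner_Integration.integrable_diff piece that)
  have eq: "(LINT y|lborel. F (Complex c y) * exp_quot t (Complex c y) * gauss_factor h (Complex c y)) =
     2 * pi * (LINT w|lborel. of_real (std_normal_density w) * G (t + h * w)) -
     2 * pi * (LINT w|lborel. of_real (std_normal_density w) * G (0 + h * w))" if h: "h > 0" for h
    unfolding split Bochner_Integration.integral_diff[OF piece[OF h] piece[OF h]]
    unfolding I_def by (subst (1 2) gauss_inversion[OF _ h int]) auto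
  \<comment> \<open>One exponent for both directions, as the majorant of the Gaussian means
    requires.\<close>
  define D where "D = max \<bar>\<sigma>\<^sub>1\<bar> \<bar>\<sigma>\<^sub>2\<bar>"
  have K: "K \<ge> 0" using r[of 0] by (auto intro: order_trans[OF norm_ge_zero])
  have bd: "norm (G u) \<le> K * exp (D * \<bar>u\<bar>)" for u
  proof (cases "u \<ge> 0")
    case True
    have "\<sigma>\<^sub>1 * u \<le> D * \<bar>u\<bar>"
      using True by (auto simp: D_def intro!: mult_right_mono)
    then have "K * exp (\<sigma>\<^sub>1 * u) \<le> K * exp (D * \<bar>u\<bar>)"
      using K by (intro mult_left_mono) auto
    then show ?thesis using r[OF True] by (simp add: G_def)
  next
    case False
    have "\<sigma>\<^sub>2 * u \<le> \<bar>\<sigma>\<^sub>2\<bar> * \<bar>u\<bar>"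
      by (metis abs_ge_self abs_mult)
    also have "\<dots> \<le> D * \<bar>u\<bar>"
      by (auto simp: D_def intro!: mult_right_mono)
    finally have "K * exp (\<sigma>\<^sub>2 * u) \<le> K * exp (D * \<bar>u\<bar>)"
      using K by (intro mult_left_mono) auto
    then show ?thesis using l[of u] False by (simp add: G_def)
  qed
  \<comment> \<open>The normalization of \<open>\<mu>\<close> enters here: the mean of the one-sided
    limits is the value at the point.\<close>
  have lim: "(\<lambda>n. LINT w|lborel. of_real (std_normal_density w) * G (t + 1 / real (Suc n) * w)) \<longlonglongrightarrow> \<mu> t - m" for t
  proof -
    obtain a b where a: "(\<mu> \<longlongrightarrow> a) (at_left t)" and b: "(\<mu> \<longlongrightarrow> b) (at_right t)" and \<mu>t: "\<mu> t = (b + a) / 2"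
      using \<mu> unfolding normalized_determining_def by blast
    have "(\<lambda>n. LINT w|lborel. of_real (std_normal_density w) * G (t + 1 / real (Suc n) * w)) \<longlonglongrightarrow> ((b - m) + (a - m)) / 2"
    proof (rule gauss_mean_tendsto[OF _ bd])
      show "(G \<longlongrightarrow> a - m) (at_left t)" "(G \<longlongrightarrow> b - m) (at_right t)"
        unfolding G_def using a b by (auto intro!: tendsto_intros)
    qed (auto simp: D_def)
    also have "((b - m) + (a - m)) / 2 = \<mu> t - m"
      by (simp add: \<mu>t field_simps)
    finally show ?thesis .
  qed
  have inverse_Suc_pos: "1 / real (Suc n) > 0" for n by simp
  have \<mu>0: "\<mu> 0 = 0" using \<mu> by (simp add: normalized_determining_def)
  have "(\<lambda>n. LINT y|lborel. F (Complex c y) * exp_quot t (Complex c y) * gauss_factor (1 / real (Suc n)) (Complex c y))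
       \<longlonglongrightarrow> 2 * pi * (\<mu> t - m) - 2 * pi * (\<mu> 0 - m)"
    unfolding eq[OF inverse_Suc_pos] by (intro tendsto_diff tendsto_mult tendsto_const lim)
  then show "(\<lambda>n. LINT y|lborel. F (Complex c y) * exp_quot t (Complex c y) * gauss_factor (1 / real (Suc n)) (Complex c y))
       \<longlonglongrightarrow> 2 * pi * \<mu> t"
    by (simp add: \<mu>0 algebra_simps)
qed

section \<open>Contour shifts in a vertical strip\<close>

text \<open>Contour integrals over vertical segments come as gauge integrals, the integrals over
  whole lines as Lebesgue integrals; this is the passage between them.\<close>

lemma tendsto_integral_symmetric:
  fixes f :: "real \<Rightarrow> complex"
  assumes int: "integrable lborel f"
  shows "(\<lambda>n. integral {- real n..real n} f) \<longlonglongrightarrow> (LINT x|lborel. f x)"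
proof -
  have "set_integrable lborel {- real n..real n} f" for n
    using int by (intro integrable_mult_indicator[of "{- real n..real n}" lborel f, folded set_integrable_def]) auto
  then show ?thesis
    using tendsto_set_integral_symmetric[OF int] by (simp add: set_borel_integral_eq_integral(2))
qed

lemma convex_strip: "convex {s. a < Re s \<and> Re s < b}"
  using convex_Int[OF convex_halfspace_Re_gt[of a] convex_halfspace_Re_lt[of b]] by (simp add: Collect_conj_eq)

lemma open_strip: "open {s. a < Re s \<and> Re s < b}"
  using open_Int[OF open_halfspace_Re_gt[of a] open_halfspace_Re_lt[of b]] by (simp add: Collect_conj_eq)

text \<open>Residue theorem on the rectangles [-c, c] x [-n, n]: the horizontal sides have fixed
  length and vanish by \<open>decay\<close>, and ds = \<i> dy on the vertical sides turns 2 pi \<i>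
  into 2 pi. If \<open>g\<close> is holomorphic at \<open>z\<close> as well, this is a pure contour
  shift.\<close>

lemma strip_residue:
  fixes g :: "complex \<Rightarrow> complex"
  assumes c: "a < - c" "0 < c" "c < b"
    and holo: "g holomorphic_on {s. a < Re s \<and> Re s < b} - {z}" and z: "Re z = 0"
    and decay: "\<And>e. e > 0 \<Longrightarrow> \<exists>T. \<forall>x y. \<bar>x\<bar> \<le> c \<longrightarrow> T \<le> \<bar>y\<bar> \<longrightarrow> norm (g (Complex x y)) \<le> e"
    and int: "integrable lborel (\<lambda>y. g (Complex c y))" "integrable lborel (\<lambda>y. g (Complex (- c) y))"
  shows "(LINT y|lborel. g (Complex c y)) - (LINT y|lborel. g (Complex (- c) y)) = 2 * pi * residue g z"
proof -
  define S where "S = {s. a < Re s \<and> Re s < b}"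
  define R where "R n = integral {- real n..real n} (\<lambda>y. g (Complex c y))" for n
  define L where "L n = integral {- real n..real n} (\<lambda>y. g (Complex (- c) y))" for n
  have cont: "continuous_on (S - {z}) g"
    using holo unfolding S_def by (rule holomorphic_on_imp_continuous_on)
  \<comment> \<open>Two horizontal sides of length 2 c, on which \<open>g\<close> is at most
    \<open>e\<close>, give 4 c e. The condition on n puts \<open>z\<close> inside the
    rectangle.\<close>
  have main: "norm (2 * pi * residue g z - (R n - L n)) \<le> 4 * c * e"
    if n: "\<bar>Im z\<bar> < real n" and e: "e \<ge> 0" and T: "\<And>x. \<bar>x\<bar> \<le> c \<Longrightarrow> norm (g (Complex x (real n))) \<le> e"
       "\<And>x. \<bar>x\<bar> \<le> c \<Longrightarrow> norm (g (Complex x (- real n))) \<le> e" for n e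
  proof -
    define a1 a2 a3 a4 where "a1 = Complex (- c) (- real n)" and "a2 = Complex c (- real n)"
      and "a3 = Complex c (real n)" and "a4 = Complex (- c) (real n)"
    note a_defs = a1_def a2_def a3_def a4_def
    have n0: "real n > 0" using n by linarith
    have rect: "rectpath a1 a3 = linepath a1 a2 +++ linepath a2 a3 +++ linepath a3 a4 +++ linepath a4 a1"
      unfolding rectpath_def Let_def a_defs by simp
    have img: "path_image (rectpath a1 a3) \<subseteq> S - {z}"
      unfolding a_defs using c z n n0
      by (subst path_image_rectpath) (auto simp: S_def)
    have sub: "closed_segment a1 a2 \<subseteq> S - {z}" "closed_segment a2 a3 \<subseteq> S - {z}"
      "closed_segment a3 a4 \<subseteq> S - {z}" "closed_segment a4 a1 \<subseteq> S - {z}"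
      using img unfolding rect by (auto simp: path_image_join)
    have ci: "g contour_integrable_on linepath a1 a2" "g contour_integrable_on linepath a2 a3"
      "g contour_integrable_on linepath a3 a4" "g contour_integrable_on linepath a4 a1"
      by (intro contour_integrable_continuous_linepath continuous_on_subset[OF cont] sub)+
    have res: "contour_integral (rectpath a1 a3) g =
       2 * pi * \<i> * (\<Sum>p\<in>{z}. winding_number (rectpath a1 a3) p * residue g p)"
    proof (rule Residue_theorem[of S])
      show "open S" unfolding S_def by (rule open_strip)
      show "connected S" unfolding S_def by (intro convex_connected convex_strip)
      show "g holomorphic_on S - {z}" using holo by (simp add: S_def)
      show "path_image (rectpath a1 a3) \<subseteq> S - {z}" by (rule img)
      show "\<forall>w. w \<notin> S \<longrightarrow> winding_number (rectpath a1 a3) w = 0"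
        using img convex_strip[of a b]
        by (intro allI impI winding_number_zero_outside[of _ S]) (auto simp: S_def)
    qed auto
    have "winding_number (rectpath a1 a3) z = 1"
      by (rule winding_number_rectpath) (use c z n in \<open>auto simp: in_box_complex_iff a_defs\<close>)
    then have 1: "contour_integral (rectpath a1 a3) g = 2 * pi * \<i> * residue g z"
      using res by simp
    have 2: "contour_integral (rectpath a1 a3) g = contour_integral (linepath a1 a2) g +
      (contour_integral (linepath a2 a3) g + (contour_integral (linepath a3 a4) g + contour_integral (linepath a4 a1) g))"
      unfolding rect using ci by (simp add: contour_integrable_join)
    have 3: "contour_integral (linepath a2 a3) g = \<i> * R n"
      unfolding R_def using n0 by (intro contour_integral_linepath_same_Re) (auto simp: a_defs)
    have "contour_integral (linepath a1 a4) g = \<i> * L n"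
      unfolding L_def using n0 by (intro contour_integral_linepath_same_Re) (auto simp: a_defs)
    then have 4: "contour_integral (linepath a4 a1) g = - (\<i> * L n)"
      using contour_integral_reversepath[of "linepath a1 a4" g] by simp
    have "norm (contour_integral (linepath a1 a2) g) \<le> e * norm (a2 - a1)"
    proof (rule contour_integral_bound_linepath[OF ci(1) e])
      fix w assume "w \<in> closed_segment a1 a2"
      then have "w = Complex (Re w) (- real n)" "\<bar>Re w\<bar> \<le> c"
        using c by (auto simp: a_defs closed_segment_same_Im complex_eq_iff closed_segment_eq_real_ivl)
      then show "norm (g w) \<le> e" using T(2) by metis
    qed
    moreover have "norm (contour_integral (linepath a3 a4) g) \<le> e * norm (a4 - a3)"
    proof (rule contour_integral_bound_linepath[OF ci(3) e])
      fix w assume "w \<in> closed_segment a3 a4"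
      then have "w = Complex (Re w) (real n)" "\<bar>Re w\<bar> \<le> c"
        using c by (auto simp: a_defs closed_segment_same_Im complex_eq_iff closed_segment_eq_real_ivl)
      then show "norm (g w) \<le> e" using T(1) by metis
    qed
    moreover have "norm (a2 - a1) = 2 * c" "norm (a4 - a3) = 2 * c"
      using c by (auto simp: a_defs cmod_def real_sqrt_mult)
    ultimately have 5: "norm (contour_integral (linepath a1 a2) g + contour_integral (linepath a3 a4) g) \<le> 4 * c * e"
      using norm_triangle_ineq[of "contour_integral (linepath a1 a2) g" "contour_integral (linepath a3 a4) g"] by (simp add: mult_ac)
    have "\<i> * (2 * pi * residue g z - (R n - L n)) = contour_integral (linepath a1 a2) g + contour_integral (linepath a3 a4) g"
      using 1 2 unfolding 3 4 by (simp add: algebra_simps)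
    then have "norm (2 * pi * residue g z - (R n - L n)) = norm (contour_integral (linepath a1 a2) g + contour_integral (linepath a3 a4) g)"
      by (metis norm_mult norm_ii mult_1)
    with 5 show ?thesis by simp
  qed
  have "(\<lambda>n. R n - L n) \<longlonglongrightarrow> 2 * pi * residue g z"
  proof (rule LIMSEQ_I)
    fix r :: real assume r: "r > 0"
    define e where "e = r / (8 * c)"
    have e: "e > 0" using r c by (simp add: e_def)
    obtain T where T: "\<And>x y. \<bar>x\<bar> \<le> c \<Longrightarrow> T \<le> \<bar>y\<bar> \<Longrightarrow> norm (g (Complex x y)) \<le> e"
      using decay[OF e] by blast
    define N where "N = nat \<lceil>max T \<bar>Im z\<bar>\<rceil> + 1"
    have "norm (R n - L n - 2 * pi * residue g z) < r" if "n \<ge> N" for n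
    proof -
      have n: "\<bar>Im z\<bar> < real n" "T \<le> real n"
        using that unfolding N_def by linarith+
      have "norm (2 * pi * residue g z - (R n - L n)) \<le> 4 * c * e"
        by (rule main) (use n e T in auto)
      also have "\<dots> < r" using r c by (simp add: e_def)
      finally show ?thesis by (simp add: norm_minus_commute)
    qed
    then show "\<exists>no. \<forall>n\<ge>no. norm (R n - L n - 2 * pi * residue g z) < r" by blast
  qed
  moreover have "(\<lambda>n. R n - L n) \<longlonglongrightarrow> (LINT y|lborel. g (Complex c y)) - (LINT y|lborel. g (Complex (- c) y))"
    unfolding R_def L_def by (intro tendsto_diff tendsto_integral_symmetric int)
  ultimately show ?thesis
    using LIMSEQ_unique by blast
qed

lemma cos_ge_half: "\<bar>x\<bar> \<le> 1 \<Longrightarrow> cos x \<ge> (1/2 :: real)"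
  using cos_monotone_0_pi_le[of "\<bar>x\<bar>" "pi / 3"] pi_gt3 by (simp add: cos_60 cos_abs_real)

text \<open>Re cos (x + \<i> y) = cos x cosh y, where cos x >= 1/2 because |x| <= 1 < pi/3, and cosh
  y >= exp |y| / 2.\<close>

lemma Re_cos_ge:
  assumes "\<bar>Re z\<bar> \<le> 1"
  shows "Re (cos z) \<ge> exp \<bar>Im z\<bar> / 4"
proof -
  have "exp \<bar>Im z\<bar> \<le> exp (Im z) + exp (- Im z)"
    by (cases "Im z \<ge> 0") auto
  moreover have "Re (cos z) = cos (Re z) * (exp (Im z) + exp (- Im z)) / 2"
    by (simp add: Re_cos)
  moreover have "1 / 2 * (exp (Im z) + exp (- Im z)) \<le> cos (Re z) * (exp (Im z) + exp (- Im z))"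
    using cos_ge_half[OF assms] by (intro mult_right_mono add_nonneg_nonneg) auto
  ultimately show ?thesis by simp
qed

text \<open>The frequency 2 K in the cosine has two tasks: exp (2 K |y|) outgrows exp (K |y|)
  whatever \<delta> > 0 and \<open>B\<close> are, and \<open>2 * K * c \<le> 1\<close> keeps the
  real part of the cosine positive between the lines.\<close>

lemma strip_integral_shift:
  fixes U :: "complex \<Rightarrow> complex"
  assumes c: "a < - c" "0 < c" "c < b"
    and holo: "U holomorphic_on {s. a < Re s \<and> Re s < b}"
    and int: "integrable lborel (\<lambda>y. U (Complex c y))" "integrable lborel (\<lambda>y. U (Complex (- c) y))"
    and growth: "\<And>x y. \<bar>x\<bar> \<le> c \<Longrightarrow> Y \<le> \<bar>y\<bar> \<Longrightarrow> norm (U (Complex x y)) \<le> A * exp (B * exp (K * \<bar>y\<bar>))"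
    and K: "K > 0" "2 * K * c \<le> 1" and B: "B > 0"
  shows "(LINT y|lborel. U (Complex c y)) = (LINT y|lborel. U (Complex (- c) y))"
proof -
  define E where "E \<delta> s = exp (- of_real \<delta> * cos (of_real (2 * K) * s))" for \<delta> :: real and s :: complex
  have norm_E: "norm (E \<delta> (Complex x y)) \<le> exp (- (\<delta> / 4) * exp (2 * K * \<bar>y\<bar>))" if "\<bar>x\<bar> \<le> c" "\<delta> \<ge> 0" for \<delta> x y
  proof -
    have "2 * K * \<bar>x\<bar> \<le> 2 * K * c"
      using that K by (intro mult_left_mono) auto
    moreover have "\<bar>2 * K * x\<bar> = 2 * K * \<bar>x\<bar>"
      using K by (simp add: abs_mult)
    ultimately have "\<bar>2 * K * x\<bar> \<le> 1"
      using K(2) by linarith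
    then have "Re (cos (of_real (2 * K) * Complex x y)) \<ge> exp (2 * K * \<bar>y\<bar>) / 4"
      using Re_cos_ge[of "of_real (2 * K) * Complex x y"] K by (simp add: abs_mult)
    then have "\<delta> * Re (cos (of_real (2 * K) * Complex x y)) \<ge> \<delta> * (exp (2 * K * \<bar>y\<bar>) / 4)"
      using that by (intro mult_left_mono) auto
    then show ?thesis
      by (simp add: E_def)
  qed
  have norm_E1: "norm (E \<delta> (Complex x y)) \<le> 1" if "\<bar>x\<bar> \<le> c" "\<delta> \<ge> 0" for \<delta> x y
    by (rule order_trans[OF norm_E[OF that]]) (use that in auto)
  have E_cont: "continuous_on S (E \<delta>)" for \<delta> S
    unfolding E_def by (intro continuous_intros)
  have E_meas [measurable]: "(\<lambda>y. E \<delta> (Complex x y)) \<in> borel_measurable borel" for \<delta> x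
    by (intro borel_measurable_continuous_onI continuous_on_compose2[OF E_cont[of UNIV]] continuous_intros) auto
  have intE: "integrable lborel (\<lambda>y. U (Complex x y) * E \<delta> (Complex x y))"
    if "x = c \<or> x = - c" "\<delta> \<ge> 0" for x \<delta>
  proof -
    have i: "integrable lborel (\<lambda>y. U (Complex x y))"
      using that int by auto
    show ?thesis
    proof (rule Bochner_Integration.integrable_bound[OF i])
      show "(\<lambda>y. U (Complex x y) * E \<delta> (Complex x y)) \<in> borel_measurable lborel"
        using borel_measurable_integrable[OF i] by measurable
      have "norm (U (Complex x y) * E \<delta> (Complex x y)) \<le> norm (U (Complex x y))" for y
        using mult_left_mono[OF norm_E1[of x \<delta> y], of "norm (U (Complex x y))"] that c by (auto simp: norm_mult)
      then show "AE y in lborel. norm (U (Complex x y) * E \<delta> (Complex x y)) \<le> norm (U (Complex x y))"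
        by (intro AE_I2)
    qed
  qed
  have shift: "(LINT y|lborel. U (Complex c y) * E \<delta> (Complex c y)) = (LINT y|lborel. U (Complex (- c) y) * E \<delta> (Complex (- c) y))"
    if \<delta>: "\<delta> > 0" for \<delta>
  proof -
    let ?g = "\<lambda>s. U s * E \<delta> s"
    have hg: "?g holomorphic_on {s. a < Re s \<and> Re s < b}"
      unfolding E_def by (intro holomorphic_intros holo)
    \<comment> \<open>The point 0 is a placeholder: \<open>?g\<close> is holomorphic there, so its
      residue is 0.\<close>
    have "(LINT y|lborel. ?g (Complex c y)) - (LINT y|lborel. ?g (Complex (- c) y)) = 2 * pi * residue ?g 0"
    proof (rule strip_residue[OF c])
      show "?g holomorphic_on {s. a < Re s \<and> Re s < b} - {0}"
        by (rule holomorphic_on_subset[OF hg]) auto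
      show "integrable lborel (\<lambda>y. ?g (Complex c y))" "integrable lborel (\<lambda>y. ?g (Complex (- c) y))"
        using intE[of _ \<delta>] \<delta> by auto
      fix e :: real assume e: "e > 0"
      have "((\<lambda>r. A * exp (B * exp (K * r)) * exp (- (\<delta> / 4) * exp (2 * K * r))) \<longlongrightarrow> 0) at_top"
        using \<delta> K B by real_asymp
      then have "\<forall>\<^sub>F r in at_top. A * exp (B * exp (K * r)) * exp (- (\<delta> / 4) * exp (2 * K * r)) < e"
        using e by (rule order_tendstoD(2))
      then obtain T where T: "\<And>r. r \<ge> T \<Longrightarrow> A * exp (B * exp (K * r)) * exp (- (\<delta> / 4) * exp (2 * K * r)) < e"
        unfolding eventually_at_top_linorder by blast
      have "norm (?g (Complex x y)) \<le> e" if "\<bar>x\<bar> \<le> c" "max T Y \<le> \<bar>y\<bar>" for x y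
      proof -
        have "norm (?g (Complex x y)) \<le> (A * exp (B * exp (K * \<bar>y\<bar>))) * exp (- (\<delta> / 4) * exp (2 * K * \<bar>y\<bar>))"
          unfolding norm_mult using that growth[of x y] norm_E[of x \<delta> y] \<delta>
          by (intro mult_mono) (auto intro: order_trans[OF norm_ge_zero])
        also have "\<dots> < e" using T[of "\<bar>y\<bar>"] that by simp
        finally show ?thesis by simp
      qed
      then show "\<exists>T. \<forall>x y. \<bar>x\<bar> \<le> c \<longrightarrow> T \<le> \<bar>y\<bar> \<longrightarrow> norm (?g (Complex x y)) \<le> e"
        by blast
    qed simp
    also have "residue ?g 0 = 0"
      by (rule residue_holo[OF open_strip _ hg]) (use c in auto)
    finally show ?thesis by simp
  qed
  have lim: "(\<lambda>n. LINT y|lborel. U (Complex x y) * E (1 / real (Suc n)) (Complex x y)) \<longlonglongrightarrow> (LINT y|lborel. U (Complex x y))"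
    if x: "x = c \<or> x = - c" for x
  proof -
    have i: "integrable lborel (\<lambda>y. U (Complex x y))"
      using x int by auto
    note [measurable] = borel_measurable_integrable[OF i]
    show ?thesis
    proof (rule integral_dominated_convergence[OF _ _ integrable_norm[OF i]])
      show "(\<lambda>y. U (Complex x y) * E (1 / real (Suc n)) (Complex x y)) \<in> borel_measurable lborel" for n
        by measurable
      have "(\<lambda>n. E (1 / real (Suc n)) s) \<longlonglongrightarrow> exp (- of_real 0 * cos (of_real (2 * K) * s))" for s
        unfolding E_def by (intro tendsto_intros LIMSEQ_Suc[OF lim_const_over_n])
      then have "(\<lambda>n. E (1 / real (Suc n)) s) \<longlonglongrightarrow> 1" for s
        by simp
      from tendsto_mult[OF tendsto_const this]
      show "AE y in lborel. (\<lambda>n. U (Complex x y) * E (1 / real (Suc n)) (Complex x y)) \<longlonglongrightarrow> U (Complex x y)"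
        by (intro AE_I2) simp
      have "norm (U (Complex x y) * E (1 / real (Suc n)) (Complex x y)) \<le> norm (U (Complex x y))" for n y
        using mult_left_mono[OF norm_E1[of x "1 / real (Suc n)" y], of "norm (U (Complex x y))"] x c by (auto simp: norm_mult)
      then show "AE y in lborel. norm (U (Complex x y) * E (1 / real (Suc n)) (Complex x y)) \<le> norm (U (Complex x y))" for n
        by (intro AE_I2)
    qed fact
  qed
  have "(\<lambda>n. LINT y|lborel. U (Complex (- c) y) * E (1 / real (Suc n)) (Complex (- c) y)) \<longlonglongrightarrow> (LINT y|lborel. U (Complex c y))"
    using lim[of c] shift by (simp del: of_nat_Suc)
  from LIMSEQ_unique[OF this lim[of "- c"]] show ?thesis by simp
qed

section \<open>The series of principal parts\<close>

lemma norm_exp_quot_le: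
  assumes "\<bar>Re s\<bar> \<le> c" "s \<noteq> 0" "\<bar>t\<bar> \<le> R"
  shows "norm (exp_quot t s) \<le> (exp (c * R) + 1) / norm s"
proof -
  have "Re s * t \<le> \<bar>Re s\<bar> * \<bar>t\<bar>"
    by (metis abs_ge_self abs_mult)
  also have "\<dots> \<le> c * R"
    using assms by (intro mult_mono) auto
  finally have "exp (Re s * t) \<le> exp (c * R)"
    by simp
  moreover have "norm (exp (s * of_real t) - 1) \<le> exp (Re s * t) + 1"
    using norm_triangle_ineq4[of "exp (s * of_real t)" 1] by (simp add: norm_exp_eq_Re)
  ultimately have "norm (exp (s * of_real t) - 1) \<le> exp (c * R) + 1"
    by linarith
  then show ?thesis
    using assms by (simp add: exp_quot_def norm_divide divide_right_mono)
qed

text \<open>The inner sum of the summability hypothesis; it majorises the principal part at all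
  points whose distance from the pole is at least \<epsilon>.\<close>

definition polar_weight :: "(complex \<Rightarrow> complex) \<Rightarrow> complex \<Rightarrow> real \<Rightarrow> real" where
  "polar_weight F z \<epsilon> = (\<Sum>k=1..pole_order F z. norm (polar_coeff F z k) / \<epsilon> ^ k)"

lemma polar_weight_nonneg: "\<epsilon> > 0 \<Longrightarrow> polar_weight F z \<epsilon> \<ge> 0"
  unfolding polar_weight_def by (intro sum_nonneg) auto

lemma norm_principal_part_le:
  assumes "\<epsilon> > 0" "norm (s - z) \<ge> \<epsilon>"
  shows "norm (principal_part F z s) \<le> polar_weight F z \<epsilon>"
  unfolding principal_part_def polar_weight_def
proof (rule order_trans[OF norm_sum], rule sum_mono)
  fix k
  have "\<epsilon> ^ k \<le> norm (s - z) ^ k"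
    using assms by (intro power_mono) auto
  then show "norm (polar_coeff F z k / (s - z) ^ k) \<le> norm (polar_coeff F z k) / \<epsilon> ^ k"
    using assms by (simp add: norm_divide norm_power frac_le)
qed

text \<open>Every term has k >= 1, so one factor 1 / |s - z| is kept and only the other k - 1 are
  estimated by 1/\<epsilon>. This is the decay that makes the product with \<open>exp_quot\<close>
  integrable along a line.\<close>

lemma norm_principal_part_le_div:
  assumes "\<epsilon> > 0" "norm (s - z) \<ge> \<epsilon>"
  shows "norm (principal_part F z s) \<le> \<epsilon> * polar_weight F z \<epsilon> / norm (s - z)"
proof -
  have "norm (principal_part F z s) \<le> (\<Sum>k=1..pole_order F z. \<epsilon> * (norm (polar_coeff F z k) / \<epsilon> ^ k) / norm (s - z))"
    unfolding principal_part_def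
  proof (rule order_trans[OF norm_sum], rule sum_mono)
    fix k assume "k \<in> {1..pole_order F z}"
    then obtain j where k: "k = Suc j" by (cases k) auto
    have "\<epsilon> ^ j \<le> norm (s - z) ^ j"
      using assms by (intro power_mono) auto
    then have "norm (polar_coeff F z k) / (norm (s - z) * norm (s - z) ^ j) \<le> norm (polar_coeff F z k) / (norm (s - z) * \<epsilon> ^ j)"
      using assms by (intro frac_le mult_left_mono mult_pos_pos) auto
    then show "norm (polar_coeff F z k / (s - z) ^ k) \<le> \<epsilon> * (norm (polar_coeff F z k) / \<epsilon> ^ k) / norm (s - z)"
      using assms by (simp add: norm_divide norm_mult norm_power k mult_ac)
  qed
  also have "\<dots> = \<epsilon> * polar_weight F z \<epsilon> / norm (s - z)"
    unfolding polar_weight_def by (simp add: sum_distrib_left sum_divide_distrib)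
  finally show ?thesis .
qed

lemma holomorphic_principal_part: "z \<notin> A \<Longrightarrow> principal_part F z holomorphic_on A"
  unfolding principal_part_def by (intro holomorphic_intros) auto

section \<open>Laurent expansion and residue at a pole\<close>

lemma analytic_of_eventually_eq:
  assumes "g analytic_on {z}" "eventually (\<lambda>s. f s = g s) (at z)"
  shows "remove_sings f analytic_on {z}" "isolated_singularity_at f z"
proof -
  show iso: "isolated_singularity_at f z"
    using isolated_singularity_at_cong[OF assms(2) refl] isolated_singularity_at_analytic[OF assms(1)] by simp
  have "g \<midarrow>z\<rightarrow> g z"
    using assms(1) by (simp add: analytic_at_imp_isCont isContD)
  then have "f \<midarrow>z\<rightarrow> g z"
    by (rule Lim_transform_eventually) (use assms(2) in \<open>auto elim: eventually_mono\<close>)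
  with iso show "remove_sings f analytic_on {z}"
    by (rule remove_sings_analytic_at)
qed

text \<open>Subtracting the Laurent polynomial \<open>Q\<close> removes all negative coefficients:
  those up to the pole order by construction, while beyond it there are none, since the expansion
  starts at \<open>zorder F z\<close>.\<close>

lemma principal_part_removes_pole:
  assumes iso: "isolated_singularity_at F z" and ess: "not_essential F z"
  obtains g where "g analytic_on {z}" "eventually (\<lambda>s. F s = principal_part F z s + g s) (at z)"
proof -
  define L where "L = laurent_expansion F z"
  define Q where "Q = (\<Sum>k=1..pole_order F z. fls_const (polar_coeff F z k) * fls_X_inv ^ k)"
  have L: "(\<lambda>w. F (z + w)) has_laurent_expansion L"
    unfolding L_def by (rule not_essential_has_laurent_expansion[OF iso ess])
  have "(\<lambda>w. \<Sum>k=1..pole_order F z. polar_coeff F z k * inverse w ^ k) has_laurent_expansion Q"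
    unfolding Q_def by (intro laurent_expansion_intros)
  then have Q: "(\<lambda>w. principal_part F z (z + w)) has_laurent_expansion Q"
    by (simp add: principal_part_def divide_inverse power_inverse)
  have D: "(\<lambda>w. F (z + w) - principal_part F z (z + w)) has_laurent_expansion (L - Q)"
    by (intro laurent_expansion_intros L Q)
  have nth: "fls_nth (L - Q) n = 0" if n: "n < 0" for n
  proof -
    define k where "k = nat (- n)"
    have k: "k \<ge> 1" "n = - int k" using n by (auto simp: k_def)
    have Qn: "fls_nth Q n = (if k \<le> pole_order F z then fls_nth L n else 0)"
    proof -
      have "fls_nth Q n = (\<Sum>j=1..pole_order F z. if j = k then polar_coeff F z k else 0)"
        unfolding Q_def fls_nth_sum by (intro sum.cong) (auto simp: k)
      also have "\<dots> = (if k \<le> pole_order F z then polar_coeff F z k else 0)"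
        using k by (simp add: sum.delta)
      finally show ?thesis by (simp add: polar_coeff_def L_def k)
    qed
    show ?thesis
    \<comment> \<open>\<open>zorder\<close> is known to be the subdegree only for a nonzero
      expansion, so \<open>L = 0\<close> joins the first case.\<close>
    proof (cases "k \<le> pole_order F z \<or> L = 0")
      case True
      then show ?thesis using Qn by auto
    next
      case False
      then have "zorder F z = fls_subdegree L"
        by (intro has_laurent_expansion_zorder[OF L]) auto
      then have "n < fls_subdegree L"
        using False k by (auto simp: pole_order_def)
      then show ?thesis
        using Qn False by simp
    qed
  qed
  then have "fls_subdegree (L - Q) \<ge> 0"
    by (intro fls_subdegree_ge0I)
  from has_laurent_expansion_imp_tendsto[OF D this]
  have lim: "(\<lambda>s. F s - principal_part F z s) \<midarrow>z\<rightarrow> fls_nth (L - Q) 0" .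
  have iso': "isolated_singularity_at (\<lambda>s. F s - principal_part F z s) z"
    by (rule has_laurent_expansion_isolated[OF D])
  show ?thesis
  proof (rule that)
    show "remove_sings (\<lambda>s. F s - principal_part F z s) analytic_on {z}"
      by (rule remove_sings_analytic_at[OF iso' lim])
    show "eventually (\<lambda>s. F s = principal_part F z s + remove_sings (\<lambda>s. F s - principal_part F z s) s) (at z)"
      using eventually_remove_sings_eq_at[OF iso'] by eventually_elim simp
  qed
qed

text \<open>Near z, \<open>F\<close> is its principal part plus an analytic function, and the
  product of the latter with the entire function \<open>exp_quot t\<close> has residue 0. The
  comparison takes place in a punctured neighbourhood, so it covers z = 0, where the integrand on
  the left divides by s.\<close>

lemma residue_principal_part:
  assumes iso: "isolated_singularity_at F z" and ess: "not_essential F z"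
  shows "residue (\<lambda>s. (exp (s * of_real t) - 1) * (F s / s)) z = residue (\<lambda>s. principal_part F z s * exp_quot t s) z"
proof -
  obtain g where g: "g analytic_on {z}" and ev: "eventually (\<lambda>s. F s = principal_part F z s + g s) (at z)"
    using principal_part_removes_pole[OF assms] .
  obtain A where A: "open A" "z \<in> A" "g holomorphic_on A"
    using g by (auto simp: analytic_at)
  have "eventually (\<lambda>s. s \<noteq> 0) (at z)"
    by (rule eventually_neq_at_within)
  with ev have "eventually (\<lambda>s. (exp (s * of_real t) - 1) * (F s / s) = principal_part F z s * exp_quot t s + g s * exp_quot t s) (at z)"
    by eventually_elim (simp add: exp_quot_def field_simps)
  then have "residue (\<lambda>s. (exp (s * of_real t) - 1) * (F s / s)) z =
     residue (\<lambda>s. principal_part F z s * exp_quot t s + g s * exp_quot t s) z"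
    by (rule residue_cong) simp
  also have "\<dots> = residue (\<lambda>s. principal_part F z s * exp_quot t s) z + residue (\<lambda>s. g s * exp_quot t s) z"
    by (rule residue_add[OF A(1,2)])
       (intro holomorphic_intros holomorphic_principal_part holomorphic_on_subset[OF holomorphic_exp_quot] holomorphic_on_subset[OF A(3)]; auto)+
  also have "residue (\<lambda>s. g s * exp_quot t s) z = 0"
    by (rule residue_holo[OF A(1,2)]) (intro holomorphic_intros A(3) holomorphic_on_subset[OF holomorphic_exp_quot]; auto)
  finally show ?thesis by simp
qed

section \<open>Principal parts along the lines Re s = \<plusminus>c\<close>

lemma integrable_inverse_square_plus:
  fixes c p :: real
  assumes "c > 0"
  shows "integrable lborel (\<lambda>y. inverse (c\<^sup>2 + (y - p)\<^sup>2))"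
    "(LINT y|lborel. inverse (c\<^sup>2 + (y - p)\<^sup>2)) = (LINT y|lborel. inverse (c\<^sup>2 + y\<^sup>2))"
proof -
  have "integrable lborel (\<lambda>y. inverse (c\<^sup>2 + y\<^sup>2))"
  proof (rule Bochner_Integration.integrable_bound[OF integrable_mult_right[OF integrable_inverse_one_plus_square, of "1 + 1 / c\<^sup>2"]])
    have "inverse (c\<^sup>2 + y\<^sup>2) \<le> (1 + 1 / c\<^sup>2) * inverse (1 + y\<^sup>2)" for y
    proof -
      have "c\<^sup>2 + y\<^sup>2 > 0" "1 + y\<^sup>2 > 0"
        using assms by (auto intro: add_pos_nonneg)
      moreover have "1 + y\<^sup>2 \<le> (1 + 1 / c\<^sup>2) * (c\<^sup>2 + y\<^sup>2)"
        using assms by (simp add: field_simps)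
      ultimately show ?thesis
        by (simp add: divide_simps mult_ac)
    qed
    then show "AE y in lborel. norm (inverse (c\<^sup>2 + y\<^sup>2)) \<le> norm ((1 + 1 / c\<^sup>2) * inverse (1 + y\<^sup>2))"
      by (intro AE_I2) (simp add: abs_mult)
  qed measurable
  from lborel_integrable_real_affine[OF this, of 1 "-p"]
  show "integrable lborel (\<lambda>y. inverse (c\<^sup>2 + (y - p)\<^sup>2))"
    by (simp add: algebra_simps)
  show "(LINT y|lborel. inverse (c\<^sup>2 + (y - p)\<^sup>2)) = (LINT y|lborel. inverse (c\<^sup>2 + y\<^sup>2))"
    using lborel_integral_real_affine[of 1 "\<lambda>y. inverse (c\<^sup>2 + y\<^sup>2)" "-p"] by (simp add: algebra_simps)
qed

text \<open>Separates the distance from a pole and the distance from 0: integrated along the line,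
  each inverse square gives the same constant, wherever the pole lies.\<close>

lemma inverse_mult_le_mean_squares:
  fixes A B :: real
  assumes "A > 0" "B > 0"
  shows "1 / (A * B) \<le> (inverse (A\<^sup>2) + inverse (B\<^sup>2)) / 2"
proof -
  have "0 \<le> (1 / A - 1 / B)\<^sup>2" by simp
  then show ?thesis
    using assms by (simp add: power2_diff power_divide inverse_eq_divide)
qed

text \<open>Every pole is at distance at least \<open>c\<close> from the lines Re s = \<plusminus>c,
  so the weights are taken at \<epsilon> = c.\<close>

locale polar_series =
  fixes F :: "complex \<Rightarrow> complex" and p :: "nat \<Rightarrow> real" and c :: real
  assumes c: "c > 0"
    and summable_weight: "summable (\<lambda>n. polar_weight F (\<i> * of_real (p n)) c)"
begin

abbreviation pp :: "nat \<Rightarrow> complex \<Rightarrow> complex" where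
  "pp n \<equiv> principal_part F (\<i> * of_real (p n))"

text \<open>The constant of the n-th term for |t| <= R: \<open>c\<close> times the weight stems from
  the principal part, exp (c R) + 1 from \<open>exp_quot\<close>.\<close>

abbreviation term_bound :: "real \<Rightarrow> nat \<Rightarrow> real" where
  "term_bound R n \<equiv> c * polar_weight F (\<i> * of_real (p n)) c * (exp (c * R) + 1)"

lemma dist_pole_ge: "\<bar>x\<bar> = c \<Longrightarrow> norm (Complex x y - \<i> * of_real (p n)) \<ge> c"
  using abs_Re_le_cmod[of "Complex x y - \<i> * of_real (p n)"] by simp

lemma norm_term_le:
  assumes x: "\<bar>x\<bar> = c" and t: "\<bar>t\<bar> \<le> R"
  shows "norm (pp n (Complex x y) * exp_quot t (Complex x y)) \<le>
     term_bound R n * ((inverse (c\<^sup>2 + (y - p n)\<^sup>2) + inverse (c\<^sup>2 + y\<^sup>2)) / 2)"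
proof -
  let ?s = "Complex x y" and ?z = "\<i> * complex_of_real (p n)"
  have d: "norm (?s - ?z) \<ge> c" by (rule dist_pole_ge[OF x])
  have s: "norm ?s \<ge> c" using abs_Re_le_cmod[of ?s] x by simp
  have x2: "x\<^sup>2 = c\<^sup>2" using x by (metis power2_abs)
  have n2: "(norm ?s)\<^sup>2 = c\<^sup>2 + y\<^sup>2" "(norm (?s - ?z))\<^sup>2 = c\<^sup>2 + (y - p n)\<^sup>2"
    using x2 by (simp_all add: cmod_power2)
  have "norm (pp n ?s * exp_quot t ?s) \<le> (c * polar_weight F ?z c / norm (?s - ?z)) * ((exp (c * R) + 1) / norm ?s)"
    unfolding norm_mult
  proof (rule mult_mono)
    show "norm (pp n ?s) \<le> c * polar_weight F ?z c / norm (?s - ?z)"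
      by (rule norm_principal_part_le_div[OF c d])
    show "norm (exp_quot t ?s) \<le> (exp (c * R) + 1) / norm ?s"
      using x t s c by (intro norm_exp_quot_le) auto
    show "0 \<le> c * polar_weight F ?z c / norm (?s - ?z)"
      using polar_weight_nonneg[OF c] c by (intro divide_nonneg_nonneg mult_nonneg_nonneg) auto
  qed simp
  also have "\<dots> = term_bound R n * (1 / (norm (?s - ?z) * norm ?s))"
    by simp
  also have "\<dots> \<le> term_bound R n * ((inverse ((norm (?s - ?z))\<^sup>2) + inverse ((norm ?s)\<^sup>2)) / 2)"
    using polar_weight_nonneg[OF c] c d s
    by (intro mult_left_mono inverse_mult_le_mean_squares mult_nonneg_nonneg add_nonneg_nonneg) auto
  finally show ?thesis unfolding n2 .
qed

lemma term_measurable: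
  assumes "\<bar>x\<bar> = c"
  shows "(\<lambda>y. pp n (Complex x y) * exp_quot t (Complex x y)) \<in> borel_measurable borel"
proof (rule continuous_imp_borel_Complex)
  have "(\<lambda>s. pp n s * exp_quot t s) holomorphic_on {s. Re s = x}"
    using assms c by (intro holomorphic_intros holomorphic_principal_part holomorphic_on_subset[OF holomorphic_exp_quot]) auto
  then show "continuous_on {s. Re s = x} (\<lambda>s. pp n s * exp_quot t s)"
    by (rule holomorphic_on_imp_continuous_on)
qed

lemma term_integrable:
  assumes x: "\<bar>x\<bar> = c"
  shows "integrable lborel (\<lambda>y. pp n (Complex x y) * exp_quot t (Complex x y))"
proof (rule Bochner_Integration.integrable_bound)
  show "integrable lborel (\<lambda>y. term_bound \<bar>t\<bar> n * ((inverse (c\<^sup>2 + (y - p n)\<^sup>2) + inverse (c\<^sup>2 + y\<^sup>2)) / 2))"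
    using integrable_inverse_square_plus(1)[OF c, of "p n"] integrable_inverse_square_plus(1)[OF c, of 0] by simp
  show "(\<lambda>y. pp n (Complex x y) * exp_quot t (Complex x y)) \<in> borel_measurable lborel"
    using term_measurable[OF x] by simp
  show "AE y in lborel. norm (pp n (Complex x y) * exp_quot t (Complex x y))
    \<le> norm (term_bound \<bar>t\<bar> n * ((inverse (c\<^sup>2 + (y - p n)\<^sup>2) + inverse (c\<^sup>2 + y\<^sup>2)) / 2))"
    by (intro AE_I2 order_trans[OF norm_term_le[OF x order_refl]]) simp
qed

text \<open>By translation the majorant has the same integral for all n, so the pole enters only
  through its weight.\<close>

lemma term_integral_norm_le:
  assumes x: "\<bar>x\<bar> = c" and t: "\<bar>t\<bar> \<le> R"
  shows "(LINT y|lborel. norm (pp n (Complex x y) * exp_quot t (Complex x y)))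
     \<le> term_bound R n * (LINT y|lborel. inverse (c\<^sup>2 + y\<^sup>2))"
proof -
  note i = integrable_inverse_square_plus(1)[OF c, of "p n"] integrable_inverse_square_plus(1)[OF c, of 0, simplified]
  have "(LINT y|lborel. norm (pp n (Complex x y) * exp_quot t (Complex x y))) \<le>
     (LINT y|lborel. term_bound R n * ((inverse (c\<^sup>2 + (y - p n)\<^sup>2) + inverse (c\<^sup>2 + y\<^sup>2)) / 2))"
  proof (rule integral_mono)
    show "integrable lborel (\<lambda>y. norm (pp n (Complex x y) * exp_quot t (Complex x y)))"
      by (intro integrable_norm term_integrable x)
    show "integrable lborel (\<lambda>y. term_bound R n * ((inverse (c\<^sup>2 + (y - p n)\<^sup>2) + inverse (c\<^sup>2 + y\<^sup>2)) / 2))"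
      using i by simp
  qed (rule norm_term_le[OF x t])
  also have "\<dots> = term_bound R n * (LINT y|lborel. inverse (c\<^sup>2 + y\<^sup>2))"
    using i integrable_inverse_square_plus(2)[OF c, of "p n"] by (simp del: integral_mult_right)
  finally show ?thesis .
qed

lemma summable_term_bound: "summable (term_bound R)"
  by (intro summable_mult summable_mult2 summable_weight)

lemma summable_norm_pp:
  assumes x: "\<bar>x\<bar> = c"
  shows "summable (\<lambda>n. norm (pp n (Complex x y)))"
  by (rule summable_comparison_test'[OF summable_weight])
     (use norm_principal_part_le[OF c dist_pole_ge[OF x]] in auto)

lemma series_integral:
  assumes x: "\<bar>x\<bar> = c"
  shows "integrable lborel (\<lambda>y. (\<Sum>n. pp n (Complex x y)) * exp_quot t (Complex x y))"
    "(\<lambda>n. LINT y|lborel. pp n (Complex x y) * exp_quot t (Complex x y)) sums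
       (LINT y|lborel. (\<Sum>n. pp n (Complex x y)) * exp_quot t (Complex x y))"
proof -
  have eq: "(\<Sum>n. pp n (Complex x y)) * exp_quot t (Complex x y) = (\<Sum>n. pp n (Complex x y) * exp_quot t (Complex x y))" for y
    by (rule suminf_mult2[OF summable_norm_cancel[OF summable_norm_pp[OF x]]])
  have 1: "AE y in lborel. summable (\<lambda>n. norm (pp n (Complex x y) * exp_quot t (Complex x y)))"
    unfolding norm_mult by (intro AE_I2 summable_mult2 summable_norm_pp x)
  have 2: "summable (\<lambda>n. LINT y|lborel. norm (pp n (Complex x y) * exp_quot t (Complex x y)))"
  proof (rule summable_comparison_test')
    show "summable (\<lambda>n. term_bound \<bar>t\<bar> n * (LINT y|lborel. inverse (c\<^sup>2 + y\<^sup>2)))"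
      by (intro summable_mult2 summable_term_bound)
    show "norm (LINT y|lborel. norm (pp n (Complex x y) * exp_quot t (Complex x y))) \<le>
       term_bound \<bar>t\<bar> n * (LINT y|lborel. inverse (c\<^sup>2 + y\<^sup>2))" for n
      using term_integral_norm_le[OF x order_refl, where n = n and t = t]
      by (simp only: real_norm_def abs_of_nonneg[OF integral_nonneg_AE[OF AE_I2[OF norm_ge_zero]]])
  qed
  show "integrable lborel (\<lambda>y. (\<Sum>n. pp n (Complex x y)) * exp_quot t (Complex x y))"
    unfolding eq by (rule integrable_suminf[OF term_integrable[OF x] 1 2])
  show "(\<lambda>n. LINT y|lborel. pp n (Complex x y) * exp_quot t (Complex x y)) sums
       (LINT y|lborel. (\<Sum>n. pp n (Complex x y)) * exp_quot t (Complex x y))"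
    unfolding eq by (rule sums_integral[OF term_integrable[OF x] 1 2])
qed

lemma term_residue:
  "2 * pi * residue (\<lambda>s. pp n s * exp_quot t s) (\<i> * of_real (p n)) =
     (LINT y|lborel. pp n (Complex c y) * exp_quot t (Complex c y)) -
     (LINT y|lborel. pp n (Complex (- c) y) * exp_quot t (Complex (- c) y))"
proof (rule strip_residue[symmetric, where a = "- c - 1" and b = "c + 1"])
  let ?z = "\<i> * complex_of_real (p n)"
  show "(\<lambda>s. pp n s * exp_quot t s) holomorphic_on {s. - c - 1 < Re s \<and> Re s < c + 1} - {?z}"
    by (intro holomorphic_intros holomorphic_principal_part holomorphic_on_subset[OF holomorphic_exp_quot]) auto
  show "integrable lborel (\<lambda>y. pp n (Complex c y) * exp_quot t (Complex c y))"
    "integrable lborel (\<lambda>y. pp n (Complex (- c) y) * exp_quot t (Complex (- c) y))"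
    by (rule term_integrable; use c in simp)+
  fix e :: real assume e: "e > 0"
  \<comment> \<open>Weight at distance 1, not \<open>c\<close>: between the lines a point may be
    nearer to the pole than \<open>c\<close>, but at heights |y| >= |p n| + 1 its distance from the
    pole is at least 1.\<close>
  define W where "W = polar_weight F ?z 1"
  define E where "E = exp (c * \<bar>t\<bar>) + 1"
  have W: "W \<ge> 0" unfolding W_def by (rule polar_weight_nonneg) simp
  have E: "E > 0" unfolding E_def by (intro add_pos_pos) auto
  \<comment> \<open>The summand W E / e of the height makes W E / |s - z| at most \<open>e\<close>;
    the summand 1 keeps |s - z| and |s| at least 1.\<close>
  have "norm (pp n (Complex x y) * exp_quot t (Complex x y)) \<le> e"
    if x: "\<bar>x\<bar> \<le> c" and y: "\<bar>p n\<bar> + 1 + W * E / e \<le> \<bar>y\<bar>" for x y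
  proof -
    let ?s = "Complex x y"
    have WE: "W * E / e \<ge> 0" using W E e by simp
    have y1: "\<bar>y\<bar> \<ge> 1" using y WE by linarith
    have yp: "\<bar>y - p n\<bar> \<ge> 1 + W * E / e" using y by linarith
    have d: "norm (?s - ?z) \<ge> 1 + W * E / e"
      using abs_Im_le_cmod[of "?s - ?z"] yp by simp
    then have d1: "norm (?s - ?z) \<ge> 1" using WE by linarith
    have s: "norm ?s \<ge> 1"
      using abs_Im_le_cmod[of ?s] y1 by simp
    have "norm (pp n ?s * exp_quot t ?s) \<le> (W / norm (?s - ?z)) * E"
      unfolding norm_mult
    proof (rule mult_mono)
      show "norm (pp n ?s) \<le> W / norm (?s - ?z)"
        using norm_principal_part_le_div[OF _ d1, of F] by (simp add: W_def)
      have "norm (exp_quot t ?s) \<le> E / norm ?s"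
        unfolding E_def using x s by (intro norm_exp_quot_le) auto
      also have "\<dots> \<le> E / 1"
        using s E by (intro divide_left_mono) auto
      finally show "norm (exp_quot t ?s) \<le> E" by simp
    qed (use W in auto)
    also have "\<dots> \<le> e"
    proof -
      have "W * E / e \<le> norm (?s - ?z)" using d by linarith
      then have "W * E \<le> e * norm (?s - ?z)" using e by (simp add: field_simps)
      then show ?thesis using d1 e by (simp add: divide_le_eq)
    qed
    finally show ?thesis .
  qed
  then show "\<exists>T. \<forall>x y. \<bar>x\<bar> \<le> c \<longrightarrow> T \<le> \<bar>y\<bar> \<longrightarrow> norm (pp n (Complex x y) * exp_quot t (Complex x y)) \<le> e"
    by blast
qed (use c in auto)

lemma residues_sums:
  "(\<lambda>n. residue (\<lambda>s. pp n s * exp_quot t s) (\<i> * of_real (p n))) sums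
     (((LINT y|lborel. (\<Sum>n. pp n (Complex c y)) * exp_quot t (Complex c y)) -
       (LINT y|lborel. (\<Sum>n. pp n (Complex (- c) y)) * exp_quot t (Complex (- c) y))) / (2 * pi))"
proof -
  have "residue (\<lambda>s. pp n s * exp_quot t s) (\<i> * of_real (p n)) =
     ((LINT y|lborel. pp n (Complex c y) * exp_quot t (Complex c y)) -
     (LINT y|lborel. pp n (Complex (- c) y) * exp_quot t (Complex (- c) y))) / (2 * pi)" for n
    using term_residue[of n t] by (simp add: field_simps)
  then show ?thesis
    using c by (simp only:) (intro sums_divide sums_diff series_integral(2); simp)
qed

text \<open>Estimating the residue by the two line integrals gives a bound that is uniform for |t|
  <= R and summable over n; 1/pi is two lines divided by 2 pi.\<close>

lemma norm_residue_le:
  assumes t: "\<bar>t\<bar> \<le> R"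
  shows "norm (residue (\<lambda>s. pp n s * exp_quot t s) (\<i> * of_real (p n))) \<le>
     term_bound R n * (LINT y|lborel. inverse (c\<^sup>2 + y\<^sup>2)) / pi"
proof -
  let ?I = "\<lambda>x. LINT y|lborel. pp n (Complex x y) * exp_quot t (Complex x y)"
  have "norm (?I x) \<le> term_bound R n * (LINT y|lborel. inverse (c\<^sup>2 + y\<^sup>2))" if "\<bar>x\<bar> = c" for x
    by (rule order_trans[OF integral_norm_bound term_integral_norm_le[OF that t]])
  from this[of c] this[of "- c"]
  have "norm (?I c - ?I (- c)) \<le> 2 * (term_bound R n * (LINT y|lborel. inverse (c\<^sup>2 + y\<^sup>2)))"
    using norm_triangle_ineq4[of "?I c" "?I (- c)"] c by simp
  then have "norm (2 * pi * residue (\<lambda>s. pp n s * exp_quot t s) (\<i> * of_real (p n))) \<le> 2 * (term_bound R n * (LINT y|lborel. inverse (c\<^sup>2 + y\<^sup>2)))"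
    unfolding term_residue .
  then show ?thesis
    by (simp add: norm_mult pos_le_divide_eq mult_ac)
qed

lemma residues_uniform_limit:
  assumes "\<And>t. (\<lambda>n. residue (\<lambda>s. pp n s * exp_quot t s) (\<i> * of_real (p n))) sums f t"
    and C: "compact C"
  shows "uniform_limit C (\<lambda>N t. \<Sum>n<N. residue (\<lambda>s. pp n s * exp_quot t s) (\<i> * of_real (p n))) f sequentially"
proof -
  obtain R where R: "\<And>t. t \<in> C \<Longrightarrow> \<bar>t\<bar> \<le> R"
    using compact_imp_bounded[OF C] unfolding bounded_iff real_norm_def by blast
  have f: "f = (\<lambda>t. \<Sum>n. residue (\<lambda>s. pp n s * exp_quot t s) (\<i> * of_real (p n)))"
    using assms(1) by (intro ext sums_unique) 
  show ?thesis
    unfolding f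
  proof (rule Weierstrass_m_test)
    show "norm (residue (\<lambda>s. pp n s * exp_quot t s) (\<i> * of_real (p n))) \<le>
       term_bound R n * (LINT y|lborel. inverse (c\<^sup>2 + y\<^sup>2)) / pi" if "t \<in> C" for n t
      by (rule norm_residue_le[OF R[OF that]])
    show "summable (\<lambda>n. term_bound R n * (LINT y|lborel. inverse (c\<^sup>2 + y\<^sup>2)) / pi)"
      by (intro summable_divide summable_mult2 summable_term_bound)
  qed
qed

end

text \<open>Apart from a term with pole z itself, all terms have their poles at distance at least 2
  r from z. So on the ball the weights at \<epsilon> = r form a summable majorant, and
  \<open>Q\<close> is a uniform limit of holomorphic functions.\<close>

lemma principal_part_series_near:
  assumes inj: "inj p" and nolim: "\<And>x. \<not> x islimpt range p"
    and summable: "\<And>\<epsilon>. \<epsilon> > 0 \<Longrightarrow> summable (\<lambda>n. polar_weight F (\<i> * of_real (p n)) \<epsilon>)"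
  obtains Q r where "r > 0" "Q holomorphic_on ball z r"
    "\<And>s. s \<in> ball z r \<Longrightarrow> (\<Sum>n. principal_part F (\<i> * of_real (p n)) s) =
       (if z \<in> range (\<lambda>n. \<i> * of_real (p n)) then principal_part F z s else 0) + Q s"
proof -
  obtain e where e: "e > 0" "\<And>n. p n \<noteq> Im z \<Longrightarrow> dist (p n) (Im z) \<ge> e"
    using nolim[of "Im z"] unfolding islimpt_approachable by (auto simp: not_less)
  \<comment> \<open>At most half the distance to the other poles: \<open>e\<close> separates those
    with p n different from Im z, while a pole with p n = Im z differs from z only if Re z is not 0,
    and is then |Re z| away.\<close>
  define r where "r = min e (if Re z = 0 then e else \<bar>Re z\<bar>) / 2"
  have r: "r > 0" using e by (simp add: r_def)
  have sep: "norm (s - \<i> * of_real (p n)) \<ge> r" if "\<i> * of_real (p n) \<noteq> z" "s \<in> ball z r" for n s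
  proof -
    have "norm (z - \<i> * of_real (p n)) \<ge> 2 * r"
    proof (cases "p n = Im z")
      case True
      then have "Re z \<noteq> 0"
        using that(1) by (auto simp: complex_eq_iff)
      then show ?thesis
        using abs_Re_le_cmod[of "z - \<i> * of_real (p n)"] by (simp add: r_def)
    next
      case False
      then show ?thesis
        using abs_Im_le_cmod[of "z - \<i> * of_real (p n)"] e(2)[OF False] by (simp add: r_def dist_real_def)
    qed
    moreover have "norm (z - \<i> * of_real (p n)) \<le> norm (z - s) + norm (s - \<i> * of_real (p n))"
      using norm_triangle_ineq[of "z - s" "s - \<i> * of_real (p n)"] by simp
    moreover have "norm (z - s) < r"
      using that(2) by (simp add: dist_norm)
    ultimately show ?thesis by linarith
  qed
  define f where "f n s = (if \<i> * of_real (p n) = z then 0 else principal_part F (\<i> * of_real (p n)) s)" for n s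
  define Q where "Q s = (\<Sum>n. f n s)" for s
  have f_le: "norm (f n s) \<le> polar_weight F (\<i> * of_real (p n)) r" if "s \<in> ball z r" for n s
    using norm_principal_part_le[OF r sep[OF _ that]] polar_weight_nonneg[OF r] by (auto simp: f_def)
  have unif: "uniform_limit (ball z r) (\<lambda>N s. \<Sum>n<N. f n s) Q sequentially"
    unfolding Q_def by (rule Weierstrass_m_test[OF f_le summable[OF r]])
  have f_holo: "f n holomorphic_on ball z r" for n
  proof (cases "\<i> * of_real (p n) = z")
    case False
    have "\<i> * of_real (p n) \<notin> ball z r"
      using sep[OF False, of "\<i> * of_real (p n)"] r by auto
    then show ?thesis
      using False holomorphic_principal_part by (simp add: f_def[abs_def])
  qed (simp add: f_def[abs_def])
  have "Q holomorphic_on ball z r"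
  proof (rule holomorphic_uniform_sequence[of _ "\<lambda>N s. \<Sum>n<N. f n s"])
    show "(\<lambda>s. \<Sum>n<N. f n s) holomorphic_on ball z r" for N
      by (intro holomorphic_intros f_holo)
    fix x assume "x \<in> ball z r"
    then obtain d where "d > 0" "cball x d \<subseteq> ball z r"
      using open_contains_cball_eq[OF open_ball] by blast
    then show "\<exists>d>0. cball x d \<subseteq> ball z r \<and> uniform_limit (cball x d) (\<lambda>N s. \<Sum>n<N. f n s) Q sequentially"
      using uniform_limit_on_subset[OF unif] by blast
  qed auto
  moreover have "(\<Sum>n. principal_part F (\<i> * of_real (p n)) s) =
       (if z \<in> range (\<lambda>n. \<i> * of_real (p n)) then principal_part F z s else 0) + Q s" if s: "s \<in> ball z r" for s
  proof -
    have Qs: "(\<lambda>n. f n s) sums Q s"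
      unfolding Q_def by (intro summable_sums summable_comparison_test'[OF summable[OF r] f_le[OF s]])
    show ?thesis
    proof (cases "z \<in> range (\<lambda>n. \<i> * of_real (p n))")
      case True
      then obtain m where m: "z = \<i> * of_real (p m)" by auto
      \<comment> \<open>By injectivity of \<open>p\<close>, the term of index m is the only one left
        out of \<open>Q\<close>. The identity includes s = z, where division by 0 makes this term
        0.\<close>
      have "(\<lambda>n. if n = m then principal_part F z s else 0) sums principal_part F z s"
        by (rule sums_single)
      from sums_add[OF this Qs] have "(\<lambda>n. principal_part F (\<i> * of_real (p n)) s) sums (principal_part F z s + Q s)"
        by (rule sums_cong[THEN iffD1, rotated]) (use inj in \<open>auto simp: f_def m inj_eq\<close>)
      with True show ?thesis by (simp add: sums_unique[symmetric])
    next
      case False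
      then have "f n s = principal_part F (\<i> * of_real (p n)) s" for n
        by (auto simp: f_def)
      with False show ?thesis by (simp add: Q_def)
    qed
  qed
  ultimately show ?thesis
    using that r by blast
qed

text \<open>Up to a removable singularity, \<open>F\<close> minus its principal part is analytic at
  a pole of the list, and so is \<open>F\<close> elsewhere, its singularity being neither a pole nor
  essential. \<open>Q\<close> accounts for the remaining terms of the series.\<close>

lemma holomorphic_part_analytic:
  assumes inj: "inj p" and nolim: "\<And>x. \<not> x islimpt range p"
    and summable: "\<And>\<epsilon>. \<epsilon> > 0 \<Longrightarrow> summable (\<lambda>n. polar_weight F (\<i> * of_real (p n)) \<epsilon>)"
    and iso: "isolated_singularity_at F z" and ess: "not_essential F z"
    and pole: "is_pole F z \<Longrightarrow> z \<in> range (\<lambda>n. \<i> * of_real (p n))"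
  shows "holomorphic_part F (\<lambda>n. \<i> * of_real (p n)) analytic_on {z}"
proof -
  obtain Q r where r: "r > 0" and Q: "Q holomorphic_on ball z r"
    and eq: "\<And>s. s \<in> ball z r \<Longrightarrow> (\<Sum>n. principal_part F (\<i> * of_real (p n)) s) =
       (if z \<in> range (\<lambda>n. \<i> * of_real (p n)) then principal_part F z s else 0) + Q s"
    by (rule principal_part_series_near[OF inj nolim summable, where z = z]) (assumption, rule that)
  have near: "eventually (\<lambda>s. s \<in> ball z r) (at z)"
    using r by (intro eventually_at_in_open') auto
  have Qa: "Q analytic_on {z}"
    using Q r by (auto simp: analytic_at intro!: exI[of _ "ball z r"])
  have "\<exists>g. g analytic_on {z} \<and> eventually (\<lambda>s. F s = (if z \<in> range (\<lambda>n. \<i> * of_real (p n)) then principal_part F z s else 0) + g s) (at z)"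
  proof (cases "z \<in> range (\<lambda>n. \<i> * of_real (p n))")
    case True
    obtain g where "g analytic_on {z}" "eventually (\<lambda>s. F s = principal_part F z s + g s) (at z)"
      using principal_part_removes_pole[OF iso ess] .
    then show ?thesis by (simp only: True if_True) blast
  next
    case False
    then obtain l where "F \<midarrow>z\<rightarrow> l"
      using pole ess by (auto simp: not_essential_def)
    then have "remove_sings F analytic_on {z}"
      by (rule remove_sings_analytic_at[OF iso])
    moreover have "eventually (\<lambda>s. F s = 0 + remove_sings F s) (at z)"
      using eventually_remove_sings_eq_at[OF iso] by eventually_elim simp
    ultimately show ?thesis by (simp only: False if_False) blast
  qed
  then obtain g where g: "g analytic_on {z}"
    and ev: "eventually (\<lambda>s. F s = (if z \<in> range (\<lambda>n. \<i> * of_real (p n)) then principal_part F z s else 0) + g s) (at z)"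
    by blast
  have "eventually (\<lambda>s. F s - (\<Sum>n. principal_part F (\<i> * of_real (p n)) s) = g s - Q s) (at z)"
    using ev near by eventually_elim (simp only: eq, simp)
  then show ?thesis
    unfolding holomorphic_part_def by (intro analytic_of_eventually_eq(1)[of "\<lambda>s. g s - Q s"] analytic_intros g Qa)
qed

text \<open>Off the imaginary axis the series of principal parts is holomorphic, so where
  \<open>F\<close> is analytic the removal of singularities changes nothing.\<close>

lemma holomorphic_part_eq:
  assumes inj: "inj p" and nolim: "\<And>x. \<not> x islimpt range p"
    and summable: "\<And>\<epsilon>. \<epsilon> > 0 \<Longrightarrow> summable (\<lambda>n. polar_weight F (\<i> * of_real (p n)) \<epsilon>)"
    and F: "F analytic_on {z}" and z: "Re z \<noteq> 0"
  shows "holomorphic_part F (\<lambda>n. \<i> * of_real (p n)) z = F z - (\<Sum>n. principal_part F (\<i> * of_real (p n)) z)"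
proof -
  obtain Q r where r: "r > 0" and Q: "Q holomorphic_on ball z r"
    and eq: "\<And>s. s \<in> ball z r \<Longrightarrow> (\<Sum>n. principal_part F (\<i> * of_real (p n)) s) =
       (if z \<in> range (\<lambda>n. \<i> * of_real (p n)) then principal_part F z s else 0) + Q s"
    by (rule principal_part_series_near[OF inj nolim summable, where z = z]) (assumption, rule that)
  have "z \<notin> range (\<lambda>n. \<i> * of_real (p n))"
    using z by auto
  then have eq': "(\<Sum>n. principal_part F (\<i> * of_real (p n)) s) = Q s" if "s \<in> ball z r" for s
    using eq[OF that] by simp
  have "(\<lambda>s. \<Sum>n. principal_part F (\<i> * of_real (p n)) s) holomorphic_on ball z r"
    using Q by (rule holomorphic_transform) (simp add: eq')
  then have "(\<lambda>s. \<Sum>n. principal_part F (\<i> * of_real (p n)) s) analytic_on {z}"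
    using r by (auto simp: analytic_at intro!: exI[of _ "ball z r"])
  then have "(\<lambda>s. F s - (\<Sum>n. principal_part F (\<i> * of_real (p n)) s)) analytic_on {z}"
    by (intro analytic_intros F)
  then show ?thesis
    unfolding holomorphic_part_def by simp
qed

section \<open>The difference of the determining functions\<close>

text \<open>The points where a meromorphic function fails to be analytic are sparse, hence
  countable, and so meet a line in a null set.\<close>

lemma AE_line_analytic:
  assumes F: "F meromorphic_on A" and A: "open A" and line: "\<And>y. Complex x y \<in> A"
  shows "AE y in lborel. F analytic_on {Complex x y}"
proof -
  have "countable (A \<inter> {w. \<not> F analytic_on {w}})"
    by (rule sparse_imp_countable[OF A meromorphic_on_imp_sparse_singularities[OF F]])
  then have "countable (Im ` (A \<inter> {w. \<not> F analytic_on {w}}))"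
    by (rule countable_image)
  then show ?thesis
  proof (rule AE_I'[OF countable_imp_null_set_lborel])
    show "{y \<in> space lborel. \<not> F analytic_on {Complex x y}} \<subseteq> Im ` (A \<inter> {w. \<not> F analytic_on {w}})"
      using line by (force intro!: image_eqI[where x = "Complex x _"])
  qed
qed

lemma open_vstrip: "open (vstrip a b)"
proof -
  have "vstrip a b = (\<lambda>s. ereal (Re s)) -` {a<..<b}"
    by (auto simp: vstrip_def)
  then show ?thesis
    by (simp only:) (intro open_vimage continuous_intros open_greaterThanLessThan; simp)
qed

theorem theorem4p2:
  fixes a b :: ereal
    and F :: "complex \<Rightarrow> complex"
    and \<mu>\<^sub>l \<mu>\<^sub>r :: "real \<Rightarrow> complex"
    and p :: "nat \<Rightarrow> real"
  assumes "a < 0" and "0 < b"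
    and "meromorphic_laplace_pair F a b \<mu>\<^sub>l \<mu>\<^sub>r"
    and "inj p"
    and "\<And>x. \<not> x islimpt range p"
    and "{z \<in> vstrip a b. is_pole F z} = range (\<lambda>n. \<i> * of_real (p n))"
    and "\<And>\<epsilon>::real. \<epsilon> > 0 \<Longrightarrow>
           summable (\<lambda>n. \<Sum>k=1..pole_order F (\<i> * of_real (p n)).
             norm (polar_coeff F (\<i> * of_real (p n)) k) / \<epsilon> ^ k)"
    and "phragmen_lindelof a b (holomorphic_part F (\<lambda>n. \<i> * of_real (p n)))"
  shows "(\<forall>t::real. (\<lambda>n. residue (\<lambda>s. (exp (s * of_real t) - 1) * (F s / s)) (\<i> * of_real (p n)))
             sums (\<mu>\<^sub>r t - \<mu>\<^sub>l t)) \<and>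
         (\<forall>C::real set. compact C \<longrightarrow>
            uniform_limit C
              (\<lambda>N t. \<Sum>n<N. residue (\<lambda>s. (exp (s * of_real t) - 1) * (F s / s)) (\<i> * of_real (p n)))
              (\<lambda>t. \<mu>\<^sub>r t - \<mu>\<^sub>l t) sequentially)"
proof -
  define H where "H = holomorphic_part F (\<lambda>n. \<i> * of_real (p n))"
  define P where "P s = (\<Sum>n. principal_part F (\<i> * of_real (p n)) s)" for s
  have mero: "F meromorphic_on vstrip a b"
    and \<mu>: "normalized_determining \<mu>\<^sub>l" "normalized_determining \<mu>\<^sub>r"
    and Ll: "\<And>s. s \<in> vstrip a 0 \<Longrightarrow> has_laplace_stieltjes \<mu>\<^sub>l s (F s)"
    and Lr: "\<And>s. s \<in> vstrip 0 b \<Longrightarrow> has_laplace_stieltjes \<mu>\<^sub>r s (F s)"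
    using assms(3) unfolding meromorphic_laplace_pair_def by auto
  have poles: "z \<in> range (\<lambda>n. \<i> * of_real (p n))" if "z \<in> vstrip a b" "is_pole F z" for z
    using assms(6) that by blast
  have pole_in: "\<i> * of_real (p n) \<in> vstrip a b" for n
    using assms(6) by blast
  have sing: "isolated_singularity_at F z" "not_essential F z" if "z \<in> vstrip a b" for z
    using mero that by (auto intro: meromorphic_on_isolated_singularity meromorphic_on_not_essential meromorphic_on_subset)
  have weight: "summable (\<lambda>n. polar_weight F (\<i> * of_real (p n)) \<epsilon>)" if "\<epsilon> > 0" for \<epsilon>
    unfolding polar_weight_def by (rule assms(7)[OF that])
  obtain A B Y K :: real where PL: "A > 0" "B > 0" "Y > 0" "K > 0"
    and growth: "\<And>x y. a < ereal x \<Longrightarrow> ereal x < b \<Longrightarrow> Y \<le> \<bar>y\<bar> \<Longrightarrow> norm (H (Complex x y)) \<le> A * exp (B * exp (K * \<bar>y\<bar>))"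
    using assms(8) unfolding phragmen_lindelof_def H_def by blast
  obtain a' :: real where a': "a < ereal a'" "a' < 0"
    using ereal_dense2[OF assms(1)] by auto
  obtain b' :: real where b': "0 < b'" "ereal b' < b"
    using ereal_dense2[OF assms(2)] by auto
  \<comment> \<open>Small enough for the abscissas c/2 < c < 3c/2 and their negatives to lie in the
    strip, and for \<open>2 * K * c \<le> 1\<close>, which the cosine factor needs.\<close>
  define c where "c = min (min (- a') b' / 2) (1 / (2 * K))"
  have c: "c > 0" "2 * c \<le> - a'" "2 * c \<le> b'" "2 * K * c \<le> 1"
  proof -
    show "c > 0" "2 * c \<le> - a'" "2 * c \<le> b'"
      using a' b' PL(4) by (auto simp: c_def min_def)
    have "2 * K * c \<le> 2 * K * (1 / (2 * K))"
      using PL(4) by (intro mult_left_mono) (auto simp: c_def)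
    then show "2 * K * c \<le> 1"
      using PL(4) by simp
  qed
  have in_ab: "a < ereal x" "ereal x < b" if "\<bar>x\<bar> \<le> 3 / 2 * c" for x
    using that a' b' c by (auto intro: less_le_trans[OF a'(1)] le_less_trans[OF _ b'(2)])
  have in_strip: "Complex x y \<in> vstrip a b" if "\<bar>x\<bar> \<le> 3 / 2 * c" for x y
    using in_ab[OF that] by (simp add: vstrip_def)
  interpret series: polar_series F p c
    by standard (use c weight in auto)
  have H_holo: "H holomorphic_on {s. - (3 / 2 * c) < Re s \<and> Re s < 3 / 2 * c}"
  proof (rule analytic_imp_holomorphic, subst analytic_on_analytic_at, intro ballI)
    fix z assume "z \<in> {s. - (3 / 2 * c) < Re s \<and> Re s < 3 / 2 * c}"
    then have "- (3 / 2 * c) < Re z" "Re z < 3 / 2 * c"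
      by auto
    then have "\<bar>Re z\<bar> \<le> 3 / 2 * c"
      by linarith
    from in_strip[OF this, of "Im z"] have "z \<in> vstrip a b"
      by simp
    then show "H analytic_on {z}"
      unfolding H_def using sing poles by (intro holomorphic_part_analytic assms weight) auto
  qed
  \<comment> \<open>Only almost everywhere: a meromorphic \<open>F\<close> may have arbitrary values at removable singularities.\<close>
  have F_split: "AE y in lborel. F (Complex x y) = H (Complex x y) + P (Complex x y)" if x: "\<bar>x\<bar> = c" for x
  proof -
    have "AE y in lborel. F analytic_on {Complex x y}"
      using x c by (intro AE_line_analytic[OF mero open_vstrip] in_strip) simp
    then show ?thesis
    proof eventually_elim
      case (elim y)
      have "H (Complex x y) = F (Complex x y) - P (Complex x y)"
        unfolding H_def P_def using x c by (intro holomorphic_part_eq assms weight elim) auto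
      then show ?case by simp
    qed
  qed
  \<comment> \<open>The growth of the determining functions is taken from the abscissas c/2 and
    3c/2, on either side of the line and both off the separatrix; likewise with negative
    signs.\<close>
  note right = laplace_line_inversion[OF \<mu>(2), of "c / 2" c "3 / 2 * c" F]
  note left = laplace_line_inversion[OF \<mu>(1), of "- (3 / 2 * c)" "- c" "- (c / 2)" F]
  have Lr': "has_laplace_stieltjes \<mu>\<^sub>r s (F s)" if "c / 2 \<le> Re s" "Re s \<le> 3 / 2 * c" for s
    using that c in_ab[of "Re s"] by (intro Lr) (auto simp: vstrip_def)
  have Ll': "has_laplace_stieltjes \<mu>\<^sub>l s (F s)" if "- (3 / 2 * c) \<le> Re s" "Re s \<le> - (c / 2)" for s
    using that c in_ab[of "Re s"] by (intro Ll) (auto simp: vstrip_def)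
  have F_int: "integrable lborel (\<lambda>y. F (Complex x y) * exp_quot t (Complex x y) * gauss_factor h (Complex x y))"
    if "x = c \<or> x = - c" "h > 0" for x t h
    using that right(3)[of h t] left(3)[of h t] Lr' Ll' c by auto
  have line_cont: "(\<lambda>y. f (Complex x y)) \<in> borel_measurable borel" if "continuous_on UNIV f" for f :: "complex \<Rightarrow> complex" and x
    by (rule continuous_imp_borel_Complex[OF continuous_on_subset[OF that]]) simp
  have gauss_meas [measurable]: "(\<lambda>y. gauss_factor h (Complex x y)) \<in> borel_measurable borel" for h x
    by (intro line_cont continuous_intros)
  have P_int: "integrable lborel (\<lambda>y. P (Complex x y) * exp_quot t (Complex x y))" if "\<bar>x\<bar> = c" for x t
    unfolding P_def by (rule series.series_integral(1)[OF that])
  \<comment> \<open>Uniform in \<open>h\<close>, as the dominated limit of the integrals of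
    \<open>P\<close> for \<open>h\<close> to 0 requires.\<close>
  have gauss_bound: "norm (gauss_factor h (Complex x y)) \<le> exp (c\<^sup>2)" if "\<bar>x\<bar> \<le> c" "0 \<le> h" "h \<le> 1" for h x y
  proof -
    have "x\<^sup>2 \<le> c\<^sup>2" using that c by (simp add: abs_le_square_iff[symmetric])
    then have "h\<^sup>2 * (x\<^sup>2 - y\<^sup>2) \<le> h\<^sup>2 * c\<^sup>2"
      by (intro mult_left_mono) (auto intro: order_trans[OF _ \<open>x\<^sup>2 \<le> c\<^sup>2\<close>])
    also have "\<dots> \<le> 1 * c\<^sup>2"
      using that by (intro mult_right_mono) (auto simp: power_le_one)
    finally have "h\<^sup>2 * (x\<^sup>2 - y\<^sup>2) / 2 \<le> c\<^sup>2"
      using zero_le_power2[of c] by linarith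
    then show ?thesis
      by (simp add: norm_gauss_factor)
  qed
  have P_gauss_int: "integrable lborel (\<lambda>y. P (Complex x y) * exp_quot t (Complex x y) * gauss_factor h (Complex x y))"
    if x: "\<bar>x\<bar> = c" and h: "0 \<le> h" "h \<le> 1" for x t h
  proof (rule Bochner_Integration.integrable_bound[OF integrable_mult_left[OF integrable_norm[OF P_int[OF x, of t]], of "exp (c\<^sup>2)"]])
    show "(\<lambda>y. P (Complex x y) * exp_quot t (Complex x y) * gauss_factor h (Complex x y)) \<in> borel_measurable lborel"
      using borel_measurable_integrable[OF P_int[OF x, of t]] by measurable
    show "AE y in lborel. norm (P (Complex x y) * exp_quot t (Complex x y) * gauss_factor h (Complex x y))
      \<le> norm (norm (P (Complex x y) * exp_quot t (Complex x y)) * exp (c\<^sup>2))"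
      using gauss_bound[of x h] x h by (intro AE_I2) (simp add: norm_mult mult_left_mono)
  qed
  have P_lim: "(\<lambda>n. LINT y|lborel. P (Complex x y) * exp_quot t (Complex x y) * gauss_factor (1 / real (Suc n)) (Complex x y))
     \<longlonglongrightarrow> (LINT y|lborel. P (Complex x y) * exp_quot t (Complex x y))" if x: "\<bar>x\<bar> = c" for x t
  proof (rule integral_dominated_convergence[OF _ _ integrable_mult_left[OF integrable_norm[OF P_int[OF x, of t]], of "exp (c\<^sup>2)"]])
    show "(\<lambda>y. P (Complex x y) * exp_quot t (Complex x y)) \<in> borel_measurable lborel"
      by (rule borel_measurable_integrable[OF P_int[OF x]])
    then show "(\<lambda>y. P (Complex x y) * exp_quot t (Complex x y) * gauss_factor (1 / real (Suc n)) (Complex x y)) \<in> borel_measurable lborel" for n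
      by measurable
    have "(\<lambda>n. gauss_factor (1 / real (Suc n)) s) \<longlonglongrightarrow> exp (of_real (0\<^sup>2 / 2) * s\<^sup>2)" for s
      unfolding gauss_factor_def by (intro tendsto_intros LIMSEQ_Suc[OF lim_const_over_n]) simp
    then have "(\<lambda>n. gauss_factor (1 / real (Suc n)) s) \<longlonglongrightarrow> 1" for s
      by simp
    from tendsto_mult[OF tendsto_const this]
    show "AE y in lborel. (\<lambda>n. P (Complex x y) * exp_quot t (Complex x y) * gauss_factor (1 / real (Suc n)) (Complex x y))
      \<longlonglongrightarrow> P (Complex x y) * exp_quot t (Complex x y)"
      by (intro AE_I2) simp
    show "AE y in lborel. norm (P (Complex x y) * exp_quot t (Complex x y) * gauss_factor (1 / real (Suc n)) (Complex x y))
      \<le> norm (P (Complex x y) * exp_quot t (Complex x y)) * exp (c\<^sup>2)" for n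
      using gauss_bound[of x "1 / real (Suc n)"] x by (intro AE_I2) (simp add: norm_mult mult_left_mono)
  qed
  have U_holo: "(\<lambda>s. H s * exp_quot t s * gauss_factor h s) holomorphic_on {s. - (3 / 2 * c) < Re s \<and> Re s < 3 / 2 * c}" for t h
    by (intro holomorphic_intros H_holo holomorphic_on_subset[OF holomorphic_exp_quot]) auto
  have U_eq: "AE y in lborel. F (Complex x y) * exp_quot t (Complex x y) * gauss_factor h (Complex x y) -
       P (Complex x y) * exp_quot t (Complex x y) * gauss_factor h (Complex x y) =
       H (Complex x y) * exp_quot t (Complex x y) * gauss_factor h (Complex x y)" if x: "\<bar>x\<bar> = c" for x t h
    using F_split[OF x] by eventually_elim (simp add: algebra_simps)
  have U_meas: "(\<lambda>y. H (Complex x y) * exp_quot t (Complex x y) * gauss_factor h (Complex x y)) \<in> borel_measurable lborel"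
    if "\<bar>x\<bar> = c" for x t h
    unfolding measurable_lborel1 measurable_lborel2
    by (rule continuous_imp_borel_Complex[where f = "\<lambda>s. H s * exp_quot t s * gauss_factor h s"],
        rule continuous_on_subset[OF holomorphic_on_imp_continuous_on[OF U_holo]]) (use that c in auto)
  \<comment> \<open>The growth condition on \<open>H\<close> would not give this: integrability on
    the two lines is inherited from \<open>F\<close> and \<open>P\<close>.\<close>
  have U_int: "integrable lborel (\<lambda>y. H (Complex x y) * exp_quot t (Complex x y) * gauss_factor h (Complex x y))"
    if x: "x = c \<or> x = - c" and h: "0 < h" "h \<le> 1" for x t h
  proof (rule integrable_cong_AE_imp[OF Bochner_Integration.integrable_diff[OF F_int[OF x h(1)] P_gauss_int]])
    show x': "\<bar>x\<bar> = c" using x c by auto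
    show "(\<lambda>y. H (Complex x y) * exp_quot t (Complex x y) * gauss_factor h (Complex x y)) \<in> borel_measurable lborel"
      by (rule U_meas[OF x'])
    show "AE y in lborel. F (Complex x y) * exp_quot t (Complex x y) * gauss_factor h (Complex x y) -
       P (Complex x y) * exp_quot t (Complex x y) * gauss_factor h (Complex x y) =
       H (Complex x y) * exp_quot t (Complex x y) * gauss_factor h (Complex x y)"
      by (rule U_eq[OF x'])
  qed (use h in auto)
  have U_shift: "(LINT y|lborel. H (Complex c y) * exp_quot t (Complex c y) * gauss_factor h (Complex c y)) =
      (LINT y|lborel. H (Complex (- c) y) * exp_quot t (Complex (- c) y) * gauss_factor h (Complex (- c) y))"
    if h: "0 < h" "h \<le> 1" for t h
  proof (rule strip_integral_shift[where U = "\<lambda>s. H s * exp_quot t s * gauss_factor h s", OF _ _ _ U_holo])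
    show "integrable lborel (\<lambda>y. H (Complex c y) * exp_quot t (Complex c y) * gauss_factor h (Complex c y))"
      "integrable lborel (\<lambda>y. H (Complex (- c) y) * exp_quot t (Complex (- c) y) * gauss_factor h (Complex (- c) y))"
      using U_int[of _ h] h by auto
    \<comment> \<open>Height at least 1 keeps |s| >= 1, so that \<open>exp_quot t\<close> is bounded
      by exp (c |t|) + 1.\<close>
    fix x y assume x: "\<bar>x\<bar> \<le> c" and y: "max 1 Y \<le> \<bar>y\<bar>"
    have H: "norm (H (Complex x y)) \<le> A * exp (B * exp (K * \<bar>y\<bar>))"
      using x y c by (intro growth in_ab) auto
    have s1: "norm (Complex x y) \<ge> 1"
      using abs_Im_le_cmod[of "Complex x y"] y by simp
    have "norm (exp_quot t (Complex x y)) \<le> (exp (c * \<bar>t\<bar>) + 1) / norm (Complex x y)"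
      using x s1 by (intro norm_exp_quot_le) auto
    also have "\<dots> \<le> (exp (c * \<bar>t\<bar>) + 1) / 1"
      using s1 by (intro divide_left_mono) (auto intro: add_nonneg_nonneg)
    finally have e: "norm (exp_quot t (Complex x y)) \<le> exp (c * \<bar>t\<bar>) + 1"
      by simp
    have "norm (H (Complex x y) * exp_quot t (Complex x y) * gauss_factor h (Complex x y)) \<le>
       (A * exp (B * exp (K * \<bar>y\<bar>))) * (exp (c * \<bar>t\<bar>) + 1) * exp (c\<^sup>2)"
      unfolding norm_mult using H e gauss_bound[OF x, of h y] h PL(1)
      by (intro mult_mono mult_nonneg_nonneg add_nonneg_nonneg) auto
    also have "\<dots> = (A * (exp (c * \<bar>t\<bar>) + 1) * exp (c\<^sup>2)) * exp (B * exp (K * \<bar>y\<bar>))"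
      by (simp add: mult_ac)
    finally show "norm (H (Complex x y) * exp_quot t (Complex x y) * gauss_factor h (Complex x y)) \<le>
       (A * (exp (c * \<bar>t\<bar>) + 1) * exp (c\<^sup>2)) * exp (B * exp (K * \<bar>y\<bar>))" .
  qed (use c(1) PL in \<open>auto intro: c(4)\<close>)
  have FP: "(LINT y|lborel. F (Complex x y) * exp_quot t (Complex x y) * gauss_factor h (Complex x y)) -
      (LINT y|lborel. P (Complex x y) * exp_quot t (Complex x y) * gauss_factor h (Complex x y)) =
      (LINT y|lborel. H (Complex x y) * exp_quot t (Complex x y) * gauss_factor h (Complex x y))"
    if x: "x = c \<or> x = - c" and h: "0 < h" "h \<le> 1" for x t h
  proof -
    have x': "\<bar>x\<bar> = c" using x c by auto
    have i: "integrable lborel (\<lambda>y. P (Complex x y) * exp_quot t (Complex x y) * gauss_factor h (Complex x y))"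
      using h by (intro P_gauss_int x') auto
    note Bochner_Integration.integral_diff[OF F_int[OF x h(1)] i, symmetric]
    also have "(LINT y|lborel. F (Complex x y) * exp_quot t (Complex x y) * gauss_factor h (Complex x y) -
        P (Complex x y) * exp_quot t (Complex x y) * gauss_factor h (Complex x y)) =
      (LINT y|lborel. H (Complex x y) * exp_quot t (Complex x y) * gauss_factor h (Complex x y))"
      by (rule integral_cong_AE[OF _ U_meas[OF x'] U_eq[OF x']])
         (intro borel_measurable_integrable Bochner_Integration.integrable_diff F_int x h i)
    finally show ?thesis .
  qed
  \<comment> \<open>The integrals of \<open>H\<close> over the two lines agree, so for each n the
    differences for \<open>F\<close> and for \<open>P\<close> agree. The former tend to the
    left-hand side by inversion, the latter to the right-hand side by dominated convergence.\<close>
  have main: "2 * pi * (\<mu>\<^sub>r t - \<mu>\<^sub>l t) =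
      (LINT y|lborel. P (Complex c y) * exp_quot t (Complex c y)) - (LINT y|lborel. P (Complex (- c) y) * exp_quot t (Complex (- c) y))" for t
  proof -
    let ?IF = "\<lambda>x n. LINT y|lborel. F (Complex x y) * exp_quot t (Complex x y) * gauss_factor (1 / real (Suc n)) (Complex x y)"
    let ?IP = "\<lambda>x n. LINT y|lborel. P (Complex x y) * exp_quot t (Complex x y) * gauss_factor (1 / real (Suc n)) (Complex x y)"
    have "?IF c n - ?IP c n = ?IF (- c) n - ?IP (- c) n" for n
      using FP[of c "1 / real (Suc n)" t] FP[of "- c" "1 / real (Suc n)" t] U_shift[of "1 / real (Suc n)" t] by simp
    then have "?IF c n - ?IF (- c) n = ?IP c n - ?IP (- c) n" for n
      by (simp add: algebra_simps)
    moreover have "(\<lambda>n. ?IP c n - ?IP (- c) n) \<longlonglongrightarrow>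
      (LINT y|lborel. P (Complex c y) * exp_quot t (Complex c y)) - (LINT y|lborel. P (Complex (- c) y) * exp_quot t (Complex (- c) y))"
      using c by (intro tendsto_diff P_lim) auto
    moreover have "(\<lambda>n. ?IF c n - ?IF (- c) n) \<longlonglongrightarrow> 2 * pi * \<mu>\<^sub>r t - 2 * pi * \<mu>\<^sub>l t"
      using right(4) left(4) Lr' Ll' c by (intro tendsto_diff) auto
    ultimately show ?thesis
      using LIMSEQ_unique by (simp add: right_diff_distrib)
  qed
  have sums: "(\<lambda>n. residue (\<lambda>s. series.pp n s * exp_quot t s) (\<i> * of_real (p n))) sums (\<mu>\<^sub>r t - \<mu>\<^sub>l t)" for t
    using series.residues_sums[of t] unfolding P_def[symmetric] main[symmetric] by simp
  have res: "residue (\<lambda>s. (exp (s * of_real t) - 1) * (F s / s)) (\<i> * of_real (p n)) =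
      residue (\<lambda>s. series.pp n s * exp_quot t s) (\<i> * of_real (p n))" for t n
    by (rule residue_principal_part[OF sing[OF pole_in]])
  show ?thesis
    unfolding res using sums series.residues_uniform_limit[OF sums] by blast
qed

end
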